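(* Let $n\ge1$ and let $V$ be an irreducible (finite-dimensional, complex) representation of $SL(n+1)$. Then $\mathrm{degen}(V)=n$ if $V$ is the standard representation, its dual, or (if $n=1$) if $V$ is one of the representations $\mathrm{Sym}^{2\ell+1}(\mathbb{C}^2)$ for some $\ell\ge0$. Otherwise, $\mathrm{degen}(V)\le n-1$.
   Context: Let $H$ be a semisimple complex group with maximal torus $T$ and character lattice $\chi(T)$. For a positive-dimensional representation $V$ of $H$, the degeneracy $\mathrm{degen}(V)$ is the smallest integer $m\ge0$ such that there exist $T$-weights $\xi_1,\dots,\xi_{m+1}$ of $V$ and $a_i\in\mathbb{Q}_{\ge0}$ with $\sum_{i=1}^{m+1}a_i=1$ and $\sum_{i=1}^{m+1}a_i\xi_i=0$ in $\chi(T)\otimes\mathbb{Q}$. *)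

theory Defs
  imports
    "HOL-Analysis.Analysis"
    "HOL-Library.Function_Algebras"
    "HOL-Library.Poly_Mapping"
begin

section \<open>The group, its maximal torus and characters\<close>

text \<open>The matrices of \<open>SL(n+1)\<close> are indexed by a finite type \<open>'n\<close> with \<open>n+1\<close> elements.\<close>

definition SL :: "(complex ^ 'n ^ 'n) set" where
  "SL = {A. det A = 1}"

definition diag_torus :: "(complex ^ 'n ^ 'n) set" where
  "diag_torus = {A \<in> SL. \<forall>i j. i \<noteq> j \<longrightarrow> A $ i $ j = 0}"

inductive_set matrix_polys :: "((complex ^ 'n ^ 'n) \<Rightarrow> complex) set" where
  const: "(\<lambda>_. c) \<in> matrix_polys"
| entry: "(\<lambda>A. A $ i $ j) \<in> matrix_polys"
| add: "p \<in> matrix_polys \<Longrightarrow> q \<in> matrix_polys \<Longrightarrow> (\<lambda>A. p A + q A) \<in> matrix_polys"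
| mult: "p \<in> matrix_polys \<Longrightarrow> q \<in> matrix_polys \<Longrightarrow> (\<lambda>A. p A * q A) \<in> matrix_polys"

text \<open>Regular functions on a subset \<open>S\<close> of the matrix space that is Zariski closed, as \<open>SL\<close> and
  \<open>diag_torus\<close> are, are the restrictions to \<open>S\<close> of polynomials in the matrix entries.\<close>

definition regular_on :: "(complex ^ 'n ^ 'n) set \<Rightarrow> ((complex ^ 'n ^ 'n) \<Rightarrow> complex) \<Rightarrow> bool" where
  "regular_on S f \<longleftrightarrow> (\<exists>p\<in>matrix_polys. \<forall>A\<in>S. f A = p A)"

text \<open>The character lattice \<open>X(T)\<close>, as a set of functions that are \<open>undefined\<close> off \<open>T\<close>, so that equality of
  characters is equality on \<open>T\<close>. The group operation is written multiplicatively.\<close>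

definition characters :: "(complex ^ 'n ^ 'n) set \<Rightarrow> ((complex ^ 'n ^ 'n) \<Rightarrow> complex) set" where
  "characters T = {\<alpha> \<in> extensional T. regular_on T \<alpha> \<and> (\<forall>s\<in>T. \<alpha> s \<noteq> 0) \<and>
     (\<forall>s\<in>T. \<forall>t\<in>T. \<alpha> (s ** t) = \<alpha> s * \<alpha> t)}"

definition char_mult :: "(complex ^ 'n ^ 'n) set \<Rightarrow> (complex ^ 'n ^ 'n \<Rightarrow> complex) \<Rightarrow>
    (complex ^ 'n ^ 'n \<Rightarrow> complex) \<Rightarrow> complex ^ 'n ^ 'n \<Rightarrow> complex" where
  "char_mult T \<alpha> \<beta> = restrict (\<lambda>t. \<alpha> t * \<beta> t) T"


section \<open>Representations\<close>

locale SL_rep = vector_space smul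
  for smul :: "complex \<Rightarrow> 'v::ab_group_add \<Rightarrow> 'v" +
  fixes \<rho> :: "complex ^ 'n ^ 'n \<Rightarrow> 'v \<Rightarrow> 'v"
  assumes finite_dim: "\<exists>B. finite B \<and> span B = UNIV"
    and linear_action: "g \<in> SL \<Longrightarrow> Vector_Spaces.linear smul smul (\<rho> g)"
    and action_one: "\<rho> (mat 1) v = v"
    and action_mult: "g \<in> SL \<Longrightarrow> h \<in> SL \<Longrightarrow> \<rho> (g ** h) v = \<rho> g (\<rho> h v)"
    and algebraic: "Vector_Spaces.linear smul (*) f \<Longrightarrow> regular_on SL (\<lambda>g. f (\<rho> g v))"

locale irreducible_SL_rep = SL_rep smul \<rho>
  for smul :: "complex \<Rightarrow> 'v::ab_group_add \<Rightarrow> 'v" and \<rho> :: "complex ^ 'n ^ 'n \<Rightarrow> 'v \<Rightarrow> 'v" +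
  assumes nonzero: "\<exists>v::'v. v \<noteq> 0"
    and irreducible: "subspace W \<Longrightarrow> (\<And>g w. g \<in> SL \<Longrightarrow> w \<in> W \<Longrightarrow> \<rho> g w \<in> W) \<Longrightarrow> W = {0} \<or> W = UNIV"

text \<open>Isomorphism of the representation \<open>\<rho>\<close> with the representation \<open>\<sigma>\<close> on the subspace \<open>W\<close>.\<close>

definition rep_iso :: "(complex \<Rightarrow> 'v::ab_group_add \<Rightarrow> 'v) \<Rightarrow> (complex ^ 'n ^ 'n \<Rightarrow> 'v \<Rightarrow> 'v) \<Rightarrow>
    (complex \<Rightarrow> 'w::ab_group_add \<Rightarrow> 'w) \<Rightarrow> 'w set \<Rightarrow> (complex ^ 'n ^ 'n \<Rightarrow> 'w \<Rightarrow> 'w) \<Rightarrow> bool" where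
  "rep_iso smul \<rho> smul' W \<sigma> \<longleftrightarrow>
     (\<exists>\<phi>. Vector_Spaces.linear smul smul' \<phi> \<and> bij_betw \<phi> UNIV W \<and>
        (\<forall>g\<in>SL. \<forall>v. \<phi> (\<rho> g v) = \<sigma> g (\<phi> v)))"

definition is_standard :: "(complex \<Rightarrow> 'v::ab_group_add \<Rightarrow> 'v) \<Rightarrow> (complex ^ 'n ^ 'n \<Rightarrow> 'v \<Rightarrow> 'v) \<Rightarrow> bool" where
  "is_standard smul \<rho> \<longleftrightarrow> rep_iso smul \<rho> (*s) UNIV (\<lambda>g v. g *v v)"

definition fun_scale :: "complex \<Rightarrow> ('a \<Rightarrow> complex) \<Rightarrow> 'a \<Rightarrow> complex" where
  "fun_scale c f = (\<lambda>x. c * f x)"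

lemma vector_space_fun_scale: "vector_space fun_scale"
  by unfold_locales (auto simp: fun_scale_def fun_eq_iff algebra_simps)

definition is_dual_standard :: "(complex \<Rightarrow> 'v::ab_group_add \<Rightarrow> 'v) \<Rightarrow> (complex ^ 'n ^ 'n \<Rightarrow> 'v \<Rightarrow> 'v) \<Rightarrow> bool" where
  "is_dual_standard smul \<rho> \<longleftrightarrow>
     rep_iso smul \<rho> fun_scale {f :: complex ^ 'n \<Rightarrow> complex. Vector_Spaces.linear (*s) (*) f}
       (\<lambda>g f. \<lambda>x. f (matrix_inv g *v x))"

text \<open>The symmetric power \<open>Sym\<^sup>k\<close> of the standard representation is realised as the space of homogeneous
  polynomial functions of degree \<open>k\<close> on its dual: a vector \<open>v\<close> is the linear form \<open>\<xi> \<mapsto> \<Sum>i. v\<^sub>i \<xi>\<^sub>i\<close>, and the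
  product \<open>v\<^sub>1 \<cdots> v\<^sub>k\<close> in the symmetric algebra is the product of functions. The action
  \<open>g (v\<^sub>1 \<cdots> v\<^sub>k) = (g v\<^sub>1) \<cdots> (g v\<^sub>k)\<close> becomes precomposition with the transpose of \<open>g\<close>.\<close>

definition linear_form :: "complex ^ 'n \<Rightarrow> complex ^ 'n \<Rightarrow> complex" where
  "linear_form v = (\<lambda>\<xi>. \<Sum>i\<in>UNIV. v $ i * \<xi> $ i)"

definition sym_power :: "nat \<Rightarrow> (complex ^ 'n \<Rightarrow> complex) set" where
  "sym_power k = module.span fun_scale (range (\<lambda>v \<xi>. \<Prod>j<k. linear_form (v j) \<xi>))"

definition sym_action :: "complex ^ 'n ^ 'n \<Rightarrow> (complex ^ 'n \<Rightarrow> complex) \<Rightarrow> complex ^ 'n \<Rightarrow> complex" where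
  "sym_action g f = (\<lambda>\<xi>. f (transpose g *v \<xi>))"

lemma sym_action_product:
  "sym_action g (\<lambda>\<xi>. \<Prod>j<k. linear_form (v j) \<xi>) = (\<lambda>\<xi>. \<Prod>j<k. linear_form (g *v v j) \<xi>)"
proof -
  have "linear_form w (transpose g *v \<xi>) = linear_form (g *v w) \<xi>" for w \<xi>
    unfolding linear_form_def matrix_vector_mult_def transpose_def
    by (simp add: sum_distrib_left sum_distrib_right, subst sum.swap)
      (simp add: mult_ac)
  then show ?thesis by (simp add: sym_action_def)
qed

definition is_sym_power :: "nat \<Rightarrow> (complex \<Rightarrow> 'v::ab_group_add \<Rightarrow> 'v) \<Rightarrow> (complex ^ 'n ^ 'n \<Rightarrow> 'v \<Rightarrow> 'v) \<Rightarrow> bool" where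
  "is_sym_power k smul \<rho> \<longleftrightarrow> rep_iso smul \<rho> fun_scale (sym_power k) sym_action"


section \<open>Degeneracy\<close>

definition weights :: "(complex ^ 'n ^ 'n) set \<Rightarrow> (complex \<Rightarrow> 'v::ab_group_add \<Rightarrow> 'v) \<Rightarrow>
    (complex ^ 'n ^ 'n \<Rightarrow> 'v \<Rightarrow> 'v) \<Rightarrow> (complex ^ 'n ^ 'n \<Rightarrow> complex) set" where
  "weights T smul \<rho> = {\<alpha> \<in> characters T. \<exists>v. v \<noteq> 0 \<and> (\<forall>t\<in>T. \<rho> t v = smul (\<alpha> t) v)}"

text \<open>\<open>X(T) \<otimes> \<rat>\<close> is presented as the free rational vector space on the set \<open>X(T)\<close>, with basis
  \<open>Poly_Mapping.single \<alpha> 1\<close>, modulo the subspace spanned by \<open>[\<alpha>\<beta>] - [\<alpha>] - [\<beta>]\<close>. A formal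
  combination \<open>\<Sum>i. a\<^sub>i [\<xi>\<^sub>i]\<close> thus vanishes in \<open>X(T) \<otimes> \<rat>\<close> iff it lies in that subspace.\<close>

definition rat_scale :: "rat \<Rightarrow> ('a \<Rightarrow>\<^sub>0 rat) \<Rightarrow> 'a \<Rightarrow>\<^sub>0 rat" where
  "rat_scale q = Poly_Mapping.map ((*) q)"

lemma lookup_rat_scale: "Poly_Mapping.lookup (rat_scale q p) x = q * Poly_Mapping.lookup p x"
  by (simp add: rat_scale_def Poly_Mapping.map.rep_eq when_def)

lemma vector_space_rat_scale: "vector_space rat_scale"
  by unfold_locales
    (simp_all add: poly_mapping_eq_iff fun_eq_iff lookup_rat_scale lookup_add algebra_simps)

definition tensor_relations :: "(complex ^ 'n ^ 'n) set \<Rightarrow> ((complex ^ 'n ^ 'n \<Rightarrow> complex) \<Rightarrow>\<^sub>0 rat) set" where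
  "tensor_relations T = module.span rat_scale
     {Poly_Mapping.single (char_mult T \<alpha> \<beta>) 1 - Poly_Mapping.single \<alpha> 1 - Poly_Mapping.single \<beta> 1
       | \<alpha> \<beta>. \<alpha> \<in> characters T \<and> \<beta> \<in> characters T}"

definition degen :: "(complex ^ 'n ^ 'n) set \<Rightarrow> (complex \<Rightarrow> 'v::ab_group_add \<Rightarrow> 'v) \<Rightarrow>
    (complex ^ 'n ^ 'n \<Rightarrow> 'v \<Rightarrow> 'v) \<Rightarrow> nat" where
  "degen T smul \<rho> = (LEAST m. \<exists>\<xi> a.
     (\<forall>i\<in>{1..m+1}. \<xi> i \<in> weights T smul \<rho> \<and> a i \<ge> 0) \<and>
     (\<Sum>i=1..m+1. a i) = 1 \<and>
     (\<Sum>i=1..m+1. Poly_Mapping.single (\<xi> i) (a i)) \<in> tensor_relations T)"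

end

theory Submission
  imports
    Defs
    "HOL-Computational_Algebra.Polynomial"
begin

text \<open>
  Weights are written as integer vectors indexed by \<open>'n\<close>, modulo constant vectors. If \<open>\<mu>\<close> is a weight with
  \<open>\<mu>\<^sub>j < \<mu>\<^sub>i\<close>, then so is \<open>\<mu> - e\<^sub>i + e\<^sub>j\<close>; iterating, some indicator vector \<open>e\<^sub>I\<close> with \<open>I \<noteq> UNIV\<close> is a weight,
  and by symmetry all \<open>e\<^sub>J\<close> with \<open>|J| = |I|\<close> are. If \<open>|I| = 0\<close> the degeneracy is 0. If \<open>2 \<le> |I| \<le> n - 1\<close>, a
  block of \<open>|I|\<close> indices together with the cyclic intervals of the remaining ones gives a relation between at
  most \<open>n\<close> weights (after replacing \<open>V\<close> by its twist under \<open>g \<mapsto> g\<close> inverse transpose if \<open>2 |I| > n + 1\<close>).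
  If \<open>|I| = 1\<close> and some weight is not of the form \<open>e\<^sub>i\<close>, then for \<open>n \<ge> 2\<close> either some \<open>e\<^sub>i + e\<^sub>j - e\<^sub>k\<close> is a
  weight, and \<open>(e\<^sub>i + e\<^sub>j - e\<^sub>k) + 2 e\<^sub>k + \<dots> = (1, \<dots>, 1)\<close> involves only \<open>n\<close> weights, or some opposite \<open>- e\<^sub>i\<close>
  is. The case \<open>|I| = n\<close> is the twist of \<open>|I| = 1\<close>. In the remaining cases let \<open>l\<close> be a functional extracting
  the top weight: \<open>l (g w)\<close> depends only on one row of \<open>g\<close>, and as a function of that row it identifies the
  representation with a symmetric power. The lower bounds come from evaluating a relation at
  \<open>diag(2, 1/2)\<close>, embedded at two indices, and taking \<open>ln |\<cdot>|\<close>.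
\<close>

section \<open>Linear algebra and independence of characters\<close>

text \<open>All information on weights is read off from the maps
  \<open>x \<mapsto> \<rho> (transv i j x) v\<close>. They are polynomial in x, their coefficients
  are weight vectors moved along the root e_i - e_j, and once a coefficient vanishes so do all later
  ones; this replaces the theory of weight strings. The number |I| is the class of a weight modulo
  the root lattice, which is why the case distinction is by |I|. The shortening trick for larger
  representations needs a third index, so SL(2) is separate: there the question is only whether
  weight 0 occurs, and this is the parity of the top weight. Dual representations are handled by
  twisting the action with an automorphism of the group, so that the vector space stays the same and
  only the signs of the weights change.\<close>

lemma vector_space_mult_complex: "vector_space ((*) :: complex \<Rightarrow> complex \<Rightarrow> complex)"
  by unfold_locales (auto simp: algebra_simps)

text \<open>Reduces identities between vectors to identities between scalars, so that comparison of
  coefficients and independence of characters apply to vector-valued maps.\<close>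

lemma separating_functional:
  fixes smul :: "complex \<Rightarrow> 'v::ab_group_add \<Rightarrow> 'v"
  assumes "vector_space smul" and v: "v \<notin> module.span smul S"
  shows "\<exists>f. Vector_Spaces.linear smul (*) f \<and> f v = 1 \<and> (\<forall>w\<in>module.span smul S. f w = 0)"
proof -
  interpret vector_space smul by fact
  interpret vector_space_pair smul "(*) :: complex \<Rightarrow> complex \<Rightarrow> complex"
    by (intro vector_space_pair.intro assms(1) vector_space_mult_complex)
  obtain B where B: "B \<subseteq> S" "independent B" "S \<subseteq> span B"
    using maximal_independent_subset[of S] by auto
  have sB: "span B = span S"
    using B by (metis span_mono span_span subset_antisym)
  have ind: "independent (insert v B)"
    using B v sB by (intro independent_insertI) auto
  obtain f where f: "Vector_Spaces.linear smul (*) f" "\<forall>x\<in>insert v B. f x = (if x = v then 1 else 0)"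
    using linear_independent_extend[OF ind, of "\<lambda>x. if x = v then 1 else 0"] by auto
  have vB: "v \<notin> B" using v B(1) span_superset by auto
  interpret f: Vector_Spaces.linear smul "(*)" f by fact
  have "f w = 0" if "w \<in> span B" for w
    using that
  proof (induction rule: span_induct_alt)
    case base show ?case by (rule f.zero)
  next
    case (step c x y) then show ?case using f(2) vB by (auto simp: f.add f.scale)
  qed
  with f sB show ?thesis by auto
qed

lemma separating_functional_0:
  fixes smul :: "complex \<Rightarrow> 'v::ab_group_add \<Rightarrow> 'v"
  assumes "vector_space smul" and "v \<noteq> 0"
  shows "\<exists>f. Vector_Spaces.linear smul (*) f \<and> f v = 1"
proof -
  interpret vector_space smul by fact
  show ?thesis using separating_functional[OF assms(1), of v "{}"] assms(2) by auto
qed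

lemma linear_functional_sum:
  assumes "Vector_Spaces.linear smul ((*) :: complex \<Rightarrow> complex \<Rightarrow> complex) f"
  shows "f (\<Sum>i\<in>I. smul (c i) (w i)) = (\<Sum>i\<in>I. c i * f (w i))"
proof -
  interpret f: Vector_Spaces.linear smul "(*)" f by fact
  show ?thesis by (simp add: f.sum f.scale)
qed

text \<open>A functional that kills W but not \<open>w k\<close> would turn the sum into a scalar
  polynomial that vanishes everywhere and yet has a nonzero coefficient.\<close>

lemma polynomial_coeffs_in_subspace:
  fixes smul :: "complex \<Rightarrow> 'v::ab_group_add \<Rightarrow> 'v"
  assumes V: "vector_space smul"
    and W: "module.subspace smul W" and p: "\<And>x. (\<Sum>k\<le>d. smul (x ^ k) (w k)) \<in> W" and "k \<le> d"
  shows "w k \<in> W"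
proof (rule ccontr)
  interpret vector_space smul by fact
  assume "w k \<notin> W"
  then have "w k \<notin> span W" using W by (simp add: span_eq_iff[THEN iffD2])
  from separating_functional[OF V this] obtain f
    where f: "Vector_Spaces.linear smul (*) f" "f (w k) = 1" "\<forall>w\<in>span W. f w = 0" by auto
  have "(\<Sum>k\<le>d. f (w k) * x ^ k) = 0" for x
    using f(3) p[of x] linear_functional_sum[OF f(1), of "\<lambda>k. x ^ k" w "{..d}"]
    by (simp add: span_base mult.commute)
  then have "\<forall>k\<le>d. f (w k) = 0" by (subst polyfun_eq_0[symmetric]) auto
  with f(2) \<open>k \<le> d\<close> show False by auto
qed

lemma polynomial_coeffs_zero:
  fixes smul :: "complex \<Rightarrow> 'v::ab_group_add \<Rightarrow> 'v"
  assumes "vector_space smul" and "\<And>x. (\<Sum>k\<le>d. smul (x ^ k) (w k)) = 0" and "k \<le> d"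
  shows "w k = 0"
proof -
  interpret vector_space smul by fact
  show ?thesis using polynomial_coeffs_in_subspace[OF assms(1), of "{0}" w d k] assms by (auto simp: subspace_single_0)
qed

text \<open>The value 0 off T makes agreement on T the same as equality of functions, and
  \<open>h e = 1\<close> excludes the zero function; the independence argument uses both.\<close>

definition multiplicative_on :: "'g set \<Rightarrow> ('g \<Rightarrow> 'g \<Rightarrow> 'g) \<Rightarrow> 'g \<Rightarrow> ('g \<Rightarrow> complex) \<Rightarrow> bool" where
  "multiplicative_on T m e h \<longleftrightarrow> h e = 1 \<and> (\<forall>s\<in>T. \<forall>t\<in>T. h (m s t) = h s * h t) \<and> (\<forall>s. s \<notin> T \<longrightarrow> h s = 0)"

text \<open>Dedekind's argument: the relation at \<open>m s t\<close> minus \<open>\<psi> s\<close>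
  times the relation at t has no \<psi> term, so by induction
  \<open>c h * (h s - \<psi> s) = 0\<close> for all other h and all s.\<close>

lemma multiplicative_coeffs_zero:
  assumes fin: "finite S" and S: "\<forall>h\<in>S. multiplicative_on T m e h"
    and e: "e \<in> T" and m: "\<And>s t. s \<in> T \<Longrightarrow> t \<in> T \<Longrightarrow> m s t \<in> T"
    and z: "\<And>t. t \<in> T \<Longrightarrow> (\<Sum>h\<in>S. c h * h t) = 0"
  shows "\<forall>h\<in>S. c h = 0"
  using fin S z
proof (induction S arbitrary: c rule: finite_induct)
  case empty then show ?case by simp
next
  case (insert \<psi> S)
  have *: "c h * (h s - \<psi> s) = 0" if "h \<in> S" "s \<in> T" for s h
  proof -
    have "\<forall>h\<in>S. c h * (h s - \<psi> s) = 0"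
    proof (rule insert.IH)
      fix t assume t: "t \<in> T"
      have 1: "c \<psi> * \<psi> t = - (\<Sum>h\<in>S. c h * h t)"
        using insert.prems(2)[OF t] insert.hyps by (simp add: eq_neg_iff_add_eq_0)
      have "h (m s t) = h s * h t" if "h \<in> insert \<psi> S" for h
        using insert.prems(1) that \<open>s \<in> T\<close> t by (auto simp: multiplicative_on_def)
      then have "(\<Sum>h\<in>S. c h * h (m s t)) = (\<Sum>h\<in>S. c h * (h s * h t))" "\<psi> (m s t) = \<psi> s * \<psi> t"
        by auto
      with insert.prems(2)[OF m[OF that(2) t]] insert.hyps
      have "\<psi> s * (c \<psi> * \<psi> t) + (\<Sum>h\<in>S. c h * (h s * h t)) = 0"
        by (simp add: mult_ac)
      then show "(\<Sum>h\<in>S. c h * (h s - \<psi> s) * h t) = 0"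
        unfolding 1 by (simp add: algebra_simps sum_subtractf sum_distrib_left)
    qed (use insert.prems in auto)
    then show ?thesis using that by auto
  qed
  have c0: "c h = 0" if "h \<in> S" for h
  proof (rule ccontr)
    assume "c h \<noteq> 0"
    then have "h s = \<psi> s" if "s \<in> T" for s using *[OF \<open>h \<in> S\<close> that] by simp
    moreover have "h s = \<psi> s" if "s \<notin> T" for s
      using insert.prems(1) that \<open>h \<in> S\<close> by (simp add: multiplicative_on_def)
    ultimately have "h = \<psi>" by blast
    with that insert.hyps show False by simp
  qed
  moreover have "c \<psi> = 0"
    using insert.prems(2)[OF e] insert.hyps c0 insert.prems(1) by (simp add: multiplicative_on_def)
  ultimately show ?case by simp
qed

interpretation fun_space: vector_space "fun_scale :: complex \<Rightarrow> ('a \<Rightarrow> complex) \<Rightarrow> 'a \<Rightarrow> complex"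
  by (rule vector_space_fun_scale)

lemma sum_fun_apply: "(\<Sum>i\<in>I. F i) x = (\<Sum>i\<in>I. F i x)"
  by (induction I rule: infinite_finite_induct) auto

lemma multiplicative_independent:
  assumes e: "e \<in> T" and m: "\<And>s t. s \<in> T \<Longrightarrow> t \<in> T \<Longrightarrow> m s t \<in> T"
  shows "fun_space.independent {h. multiplicative_on T m e h}"
  unfolding fun_space.independent_explicit_module
proof (intro allI impI)
  fix S :: "('a \<Rightarrow> complex) set" and u h
  assume *: "finite S" "S \<subseteq> {h. multiplicative_on T m e h}" "(\<Sum>v\<in>S. fun_scale (u v) v) = 0" "h \<in> S"
  have "\<forall>h\<in>S. u h = 0"
  proof (rule multiplicative_coeffs_zero[where m = m, OF *(1) _ e m])
    fix t assume "t \<in> T"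
    show "(\<Sum>h\<in>S. u h * h t) = 0"
      using fun_cong[OF *(3), of t] by (simp add: sum_fun_apply fun_scale_def)
  qed (use * in auto)
  with * show "u h = 0" by auto
qed

section \<open>Matrices\<close>

text \<open>For i \<noteq> j this is the root subgroup of e_i - e_j; left multiplication adds x
  times row j to row i.\<close>

definition transv :: "'n \<Rightarrow> 'n \<Rightarrow> complex \<Rightarrow> complex ^ 'n ^ 'n" where
  "transv i j x = (\<chi> k l. of_bool (k = l) + (if k = i \<and> l = j then x else 0))"

lemma transv_mult_row:
  "(transv i j x ** A) $ k = A $ k + (if k = i then x *s A $ j else 0)"
  by (simp add: vec_eq_iff transv_def matrix_matrix_mult_def distrib_right sum.distrib of_bool_def
      if_distrib[where f = "\<lambda>y. y * _"] cong: if_cong)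

lemma transv_mult_entry:
  "(transv i j x ** A) $ k $ l = A $ k $ l + (if k = i then x * A $ j $ l else 0)"
  by (simp add: transv_mult_row)

lemma mult_transv_entry:
  "(A ** transv i j x) $ k $ l = A $ k $ l + (if l = j then A $ k $ i * x else 0)"
proof -
  have "(A ** transv i j x) $ k $ l =
      (\<Sum>m\<in>UNIV. (if m = l then A $ k $ l else 0) + (if m = i then (if l = j then A $ k $ i * x else 0) else 0))"
    unfolding matrix_matrix_mult_def transv_def vec_lambda_beta by (intro sum.cong) (auto simp: distrib_left)
  then show ?thesis by (simp add: sum.distrib)
qed

lemma transv_0: "transv i j 0 = mat 1"
  by (simp add: transv_def mat_def vec_eq_iff)

lemma transv_add: "i \<noteq> j \<Longrightarrow> transv i j x ** transv i j y = transv i j (x + y)"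
  by (simp add: vec_eq_iff transv_mult_entry) (simp add: transv_def)

lemma det_transv_mult:
  assumes "i \<noteq> j" shows "det (transv i j x ** A) = det A"
proof -
  have "transv i j x ** A = (\<chi> k. if k = i then row i A + x *s row j A else row k A)"
    by (simp add: vec_eq_iff transv_mult_row row_def)
  then show ?thesis by (simp only: det_row_operation[OF assms])
qed

lemma transv_SL: "i \<noteq> j \<Longrightarrow> transv i j x \<in> SL"
  using det_transv_mult[of i j x "mat 1"] by (simp add: SL_def)

lemma SL_one: "mat 1 \<in> SL" by (simp add: SL_def)

lemma SL_mult: "A \<in> SL \<Longrightarrow> B \<in> SL \<Longrightarrow> A ** B \<in> SL"
  by (simp add: SL_def det_mul)

lemma SL_inverse:
  fixes A :: "complex ^ 'n ^ 'n"
  assumes "A \<in> SL"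
  shows "A ** matrix_inv A = mat 1" "matrix_inv A ** A = mat 1" "matrix_inv A \<in> SL"
proof -
  have "invertible A" using assms by (simp add: SL_def invertible_det_nz)
  then have "\<exists>B. A ** B = mat 1 \<and> B ** A = mat 1" by (simp add: invertible_def)
  from someI_ex[OF this] show *: "A ** matrix_inv A = mat 1" and "matrix_inv A ** A = mat 1"
    by (simp_all add: matrix_inv_def)
  have "det A * det (matrix_inv A) = 1" unfolding det_mul[symmetric] * by simp
  then show "matrix_inv A \<in> SL" using assms by (simp add: SL_def)
qed

lemma SL_row_nonzero:
  assumes "A \<in> SL" shows "A $ a \<noteq> 0"
proof
  assume "A $ a = 0"
  then have "row a A = 0" by (simp add: row_def vec_eq_iff)
  with det_zero_row(1)[OF this] assms show False by (simp add: SL_def)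
qed

section \<open>The diagonal torus, its coroots and representatives of reflections\<close>

lemma diag_torus_SL: "t \<in> diag_torus \<Longrightarrow> t \<in> SL" by (simp add: diag_torus_def)

lemma diag_torus_off_diag: "t \<in> diag_torus \<Longrightarrow> i \<noteq> j \<Longrightarrow> t $ i $ j = 0"
  by (simp add: diag_torus_def)

lemma diag_torus_prod:
  fixes t :: "complex ^ 'n ^ 'n"
  assumes "t \<in> diag_torus" shows "(\<Prod>i\<in>UNIV. t $ i $ i) = 1"
  using assms det_diagonal[of t] by (simp add: diag_torus_def SL_def)

lemma diag_torus_nonzero: "t \<in> diag_torus \<Longrightarrow> t $ i $ i \<noteq> 0"
  using diag_torus_prod[of t] by (metis UNIV_I finite prod_zero zero_neq_one)

lemma diag_torus_mult_left:
  assumes "t \<in> diag_torus" shows "(t ** A) $ i $ j = t $ i $ i * A $ i $ j"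
proof -
  have "(t ** A) $ i $ j = (\<Sum>k\<in>UNIV. if k = i then t $ i $ i * A $ i $ j else 0)"
    unfolding matrix_matrix_mult_def vec_lambda_beta
    by (rule sum.cong) (use diag_torus_off_diag[OF assms] in auto)
  then show ?thesis by simp
qed

lemma diag_torus_mult_right:
  assumes "t \<in> diag_torus" shows "(A ** t) $ i $ j = A $ i $ j * t $ j $ j"
proof -
  have "(A ** t) $ i $ j = (\<Sum>k\<in>UNIV. if k = j then A $ i $ j * t $ j $ j else 0)"
    unfolding matrix_matrix_mult_def vec_lambda_beta
    by (rule sum.cong) (use diag_torus_off_diag[OF assms] in auto)
  then show ?thesis by simp
qed

lemma diag_torus_mult: "s \<in> diag_torus \<Longrightarrow> t \<in> diag_torus \<Longrightarrow> s ** t \<in> diag_torus"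
  using diag_torus_mult_left[of s t]
  by (auto simp: diag_torus_def SL_mult)

lemma diag_torus_one: "mat 1 \<in> diag_torus"
  using SL_one by (simp add: diag_torus_def) (simp add: mat_def)

definition diag_mat :: "('n \<Rightarrow> complex) \<Rightarrow> complex ^ 'n ^ 'n" where
  "diag_mat d = (\<chi> i j. if i = j then d i else 0)"

lemma diag_mat_entry: "diag_mat d $ i $ j = (if i = j then d i else 0)"
  by (simp add: diag_mat_def)

lemma diag_mat_torus:
  fixes d :: "'n::finite \<Rightarrow> complex"
  assumes "(\<Prod>i\<in>UNIV. d i) = 1" shows "diag_mat d \<in> diag_torus"
  using assms det_diagonal[of "diag_mat d"] by (simp add: diag_torus_def SL_def diag_mat_entry)

definition coroot :: "'n \<Rightarrow> 'n \<Rightarrow> complex \<Rightarrow> complex ^ 'n ^ 'n" where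
  "coroot i j c = diag_mat (\<lambda>k. if k = i then c else if k = j then inverse c else 1)"

lemma coroot_entry: "coroot i j c $ k $ k = (if k = i then c else if k = j then inverse c else 1)"
  by (simp add: coroot_def diag_mat_entry)

lemma prod_two_point:
  fixes i j :: "'n::finite"
  assumes "i \<noteq> j" and "\<And>k. k \<noteq> i \<Longrightarrow> k \<noteq> j \<Longrightarrow> f k = (1 :: 'a::comm_monoid_mult)"
  shows "(\<Prod>k\<in>UNIV. f k) = f i * f j"
proof -
  have "(\<Prod>k\<in>UNIV. f k) = (\<Prod>k\<in>{i, j}. f k)"
    by (rule prod.mono_neutral_right) (use assms in auto)
  then show ?thesis using assms(1) by simp
qed

lemma coroot_torus: "i \<noteq> j \<Longrightarrow> c \<noteq> 0 \<Longrightarrow> coroot i j c \<in> diag_torus"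
  unfolding coroot_def by (rule diag_mat_torus, subst prod_two_point[of i j]) auto

lemma torus_transv:
  assumes "t \<in> diag_torus" "i \<noteq> j"
  shows "t ** transv i j x = transv i j (t $ i $ i / t $ j $ j * x) ** t"
  using assms(2) diag_torus_nonzero[OF assms(1)]
  by (simp add: vec_eq_iff diag_torus_mult_left[OF assms(1)] diag_torus_mult_right[OF assms(1)] )
    (auto simp: transv_def)

text \<open>Defined as a product of transvections, so that a subspace stable under the two opposite
  root subgroups is visibly stable under it.\<close>

definition weyl :: "'n \<Rightarrow> 'n \<Rightarrow> complex ^ 'n ^ 'n" where
  "weyl i j = transv i j 1 ** (transv j i (-1) ** transv i j 1)"

lemma weyl_entry:
  "i \<noteq> j \<Longrightarrow> weyl i j $ k $ l =
    (if k = i then of_bool (l = j) else if k = j then - of_bool (l = i) else of_bool (k = l))"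
  by (simp add: weyl_def transv_mult_entry) (auto simp: transv_def)

lemma weyl_SL: "i \<noteq> j \<Longrightarrow> weyl i j \<in> SL"
  by (simp add: weyl_def SL_mult transv_SL)

lemma torus_weyl:
  assumes "t \<in> diag_torus" "i \<noteq> j"
  defines "t' \<equiv> diag_mat (\<lambda>k. t $ Transposition.transpose i j k $ Transposition.transpose i j k)"
  shows "t' \<in> diag_torus" "t ** weyl i j = weyl i j ** t'"
proof -
  have "(\<Prod>k\<in>UNIV. t $ Transposition.transpose i j k $ Transposition.transpose i j k)
      = (\<Prod>k\<in>UNIV. t $ k $ k)"
    by (rule prod.reindex_bij_betw[of "Transposition.transpose i j"]) simp
  then show t': "t' \<in> diag_torus"
    unfolding t'_def by (intro diag_mat_torus) (simp add: diag_torus_prod[OF assms(1)])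
  show "t ** weyl i j = weyl i j ** t'"
    using assms(2)
    unfolding vec_eq_iff diag_torus_mult_left[OF assms(1)] diag_torus_mult_right[OF t']
    by (auto simp: weyl_entry t'_def diag_mat_entry Transposition.transpose_def)
qed

lemma transpose_mult_vec: "transpose g *v \<xi> = (\<chi> l. \<Sum>k\<in>UNIV. \<xi> $ k * g $ k $ l)"
  for g :: "complex ^ 'n ^ 'm"
  unfolding matrix_vector_mult_def transpose_def by (simp add: vec_eq_iff mult.commute)

text \<open>Makes right translation of matrices, seen on functions of row a, coincide with
  \<open>sym_action\<close>.\<close>

lemma mult_row: "(h ** g) $ a = transpose g *v (h $ a)" for g :: "complex ^ 'n ^ 'm"
  unfolding transpose_mult_vec by (simp add: vec_eq_iff matrix_matrix_mult_def)

text \<open>Gaussian elimination on the columns; the rows to be modified are never the row \<open>a\<close>.\<close>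

lemma row_stabiliser_induct:
  fixes A :: "complex ^ 'n ^ 'n"
  assumes A: "A \<in> SL" and row: "A $ a = axis a 1"
    and step: "\<And>A i j x. A \<in> SL \<Longrightarrow> i \<noteq> a \<Longrightarrow> i \<noteq> j \<Longrightarrow> Q (transv i j x ** A) \<Longrightarrow> Q A"
    and diag: "\<And>t. t \<in> diag_torus \<Longrightarrow> t $ a $ a = 1 \<Longrightarrow> Q t"
  shows "Q A"
proof -
  define good where "good k A \<longleftrightarrow> (\<forall>l. l \<noteq> k \<longrightarrow> A $ l $ k = 0)" for k and A :: "complex ^ 'n ^ 'n"
  \<comment> \<open>K collects the finished columns, i is the current column, and R holds the rows
    in which column i still has to be cleared.\<close>
  have clear: "Q A" if "A \<in> SL" "A $ a = axis a 1" "finite R" "a \<notin> R" "i \<notin> R" "A $ i $ i \<noteq> 0"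
    "\<forall>k\<in>K. good k A" "i \<notin> K" "\<forall>l. l \<noteq> i \<longrightarrow> l \<notin> R \<longrightarrow> A $ l $ i = 0"
    and IH: "\<And>A. A \<in> SL \<Longrightarrow> A $ a = axis a 1 \<Longrightarrow> \<forall>k\<in>insert i K. good k A \<Longrightarrow> Q A"
  for A R i K
    using that(3) that(1,2,4-9)
  proof (induction R arbitrary: A rule: finite_induct)
    case empty
    then show ?case by (intro IH) (auto simp: good_def)
  next
    case (insert r R)
    define x where "x = - A $ r $ i / A $ i $ i"
    have ri: "r \<noteq> i" "r \<noteq> a" using insert.prems by auto
    have e: "(transv r i x ** A) $ l $ k = A $ l $ k + (if l = r then x * A $ i $ k else 0)" for l k
      by (rule transv_mult_entry)
    show ?case
    proof (rule step[OF insert.prems(1) ri(2) ri(1), of x], rule insert.IH)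
      show "transv r i x ** A \<in> SL" using insert.prems(1) ri by (simp add: SL_mult transv_SL)
      show "(transv r i x ** A) $ a = axis a 1" using insert.prems(2) ri by (simp add: transv_mult_row)
      show "(transv r i x ** A) $ i $ i \<noteq> 0" using insert.prems ri by (simp add: e)
      show "\<forall>k\<in>K. good k (transv r i x ** A)" using insert.prems ri
        unfolding good_def e by (metis add.right_neutral mult_zero_right)
      show "\<forall>l. l \<noteq> i \<longrightarrow> l \<notin> R \<longrightarrow> (transv r i x ** A) $ l $ i = 0"
        unfolding e using insert.prems ri by (auto simp: x_def)
    qed (use insert.prems in auto)
  qed
  have main: "Q A" if "finite R" "A \<in> SL" "A $ a = axis a 1" "\<forall>k. k \<notin> R \<longrightarrow> good k A" for R A
    using that
  proof (induction R arbitrary: A rule: finite_induct)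
    case empty
    then show ?case by (intro diag) (auto simp: good_def diag_torus_def)
  next
    case (insert i R)
    define K where "K = - insert i R"
    have K: "\<forall>k\<in>K. good k A" "i \<notin> K" using insert.prems by (auto simp: K_def)
    have IH: "Q A" if "A \<in> SL" "A $ a = axis a 1" "\<forall>k\<in>insert i K. good k A" for A
      using that by (intro insert.IH) (auto simp: K_def)
    have "\<exists>r. r \<notin> K \<and> A $ r $ i \<noteq> 0"
    proof (rule ccontr)
      assume no: "\<not> ?thesis"
      have nz: "A $ k $ k \<noteq> 0" if "k \<in> K" for k
      proof
        assume "A $ k $ k = 0"
        then have "column k A = 0" using K that by (auto simp: column_def good_def vec_eq_iff)
        with det_zero_column(1)[OF this] insert.prems(1) show False by (simp add: SL_def)
      qed
      \<comment> \<open>Without a pivot outside K, column i is a combination of the finished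
        columns, each of which has only its diagonal entry; x is the resulting kernel
        vector.\<close>
      define x where "x = (\<chi> k. if k = i then 1 else if k \<in> K then - A $ k $ i / A $ k $ k else 0)"
      have "(A *v x) $ r = 0" for r
      proof -
        have "(A *v x) $ r = (\<Sum>k\<in>UNIV. A $ r $ k * x $ k)" by (simp add: matrix_vector_mult_def)
        also have "\<dots> = (\<Sum>k\<in>UNIV. (if k = i then A $ r $ i else 0) + (if k = r then (if r \<in> K then - A $ r $ i else 0) else 0))"
          using K nz unfolding good_def by (intro sum.cong) (auto simp: x_def)
        also have "\<dots> = A $ r $ i + (if r \<in> K then - A $ r $ i else 0)"
          by (simp add: sum.distrib)
        also have "\<dots> = 0" using no by auto
        finally show ?thesis .
      qed
      then have "A *v x = 0" by (simp add: vec_eq_iff)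
      then have "x = 0" by (metis SL_inverse(2) insert.prems(1) matrix_vector_mul_assoc
            matrix_vector_mul_lid matrix_vector_mult_0_right)
      moreover have "x $ i = 1" by (simp add: x_def)
      ultimately show False by simp
    qed
    then obtain r where r: "r \<notin> K" "A $ r $ i \<noteq> 0" by auto
    show ?case
    proof (cases "i = a")
      case True
      have 1: "A $ i $ i \<noteq> 0" using True insert.prems(2) by (simp add: axis_def)
      show ?thesis
        by (rule clear[OF insert.prems(1,2) _ _ _ 1 K _ IH, of "UNIV - {a}"]) (use True in auto)
    next
      \<comment> \<open>Row a already has entry 0 in column i, so only rows other than a need to
        change; a zero on the diagonal is first removed by adding the pivot row r to row i.\<close>
      case False
      have a_i: "A $ a $ i = 0" using False insert.prems(2) by (simp add: axis_def)
      have reduced: "Q B" if "B \<in> SL" "B $ a = axis a 1" "B $ i $ i \<noteq> 0" "\<forall>k\<in>K. good k B" for B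
      proof (rule clear[OF that(1,2) _ _ _ that(3,4) K(2) _ IH, of "UNIV - {a, i}"])
        show "\<forall>l. l \<noteq> i \<longrightarrow> l \<notin> UNIV - {a, i} \<longrightarrow> B $ l $ i = 0"
          using that(2) False by (auto simp: axis_def)
      qed auto
      show ?thesis
      proof (cases "A $ i $ i = 0")
        case False
        with reduced insert.prems K show ?thesis by blast
      next
        case True
        then have ri: "r \<noteq> i" using r by auto
        show ?thesis
        proof (rule step[OF insert.prems(1) False ri[symmetric], of 1], rule reduced)
          show "transv i r 1 ** A \<in> SL" using insert.prems(1) ri by (simp add: SL_mult transv_SL)
          show "(transv i r 1 ** A) $ a = axis a 1"
            using insert.prems(2) \<open>i \<noteq> a\<close> by (simp add: transv_mult_row)
          show "(transv i r 1 ** A) $ i $ i \<noteq> 0" using True r by (simp add: transv_mult_entry)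
          have "A $ r $ k = 0" if k: "k \<in> K" for k
          proof -
            have "r \<noteq> k" using k r(1) by auto
            with bspec[OF K(1) k] show ?thesis by (simp add: good_def)
          qed
          then show "\<forall>k\<in>K. good k (transv i r 1 ** A)"
            using K(1) by (simp add: good_def transv_mult_entry)
        qed
      qed
    qed
  qed
  show ?thesis using main[of UNIV A] A row by auto
qed

section \<open>Matrices of determinant one with a prescribed row\<close>

lemma row_unipotent_induct:
  fixes a :: "'n::finite" and x :: "'n \<Rightarrow> complex"
  defines "U \<equiv> \<lambda>J. (\<chi> r c. of_bool (r = c) + (if r = a \<and> c \<in> J then x c else 0)) :: complex ^ 'n ^ 'n"
  assumes "finite J" "a \<notin> J" and base: "Q (mat 1)"
    and step: "\<And>A j. Q A \<Longrightarrow> j \<noteq> a \<Longrightarrow> Q (transv a j (x j) ** A)"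
  shows "Q (U J)"
  using assms(2,3)
proof (induction J rule: finite_induct)
  case empty
  have "U {} = mat 1" by (simp add: U_def mat_def vec_eq_iff)
  then show ?case using base by simp
next
  case (insert j J)
  then have j: "j \<noteq> a" by auto
  \<comment> \<open>Row j of \<open>U J\<close> is a unit vector because j \<noteq> a, so the left
    factor fills in exactly one entry of row a.\<close>
  have "U (insert j J) = transv a j (x j) ** U J"
    using j insert.hyps by (auto simp: vec_eq_iff transv_mult_entry U_def)
  with insert j step show ?case by simp
qed

lemma exists_torus_entry:
  fixes a :: "'n::finite"
  assumes "2 \<le> CARD('n)" "c \<noteq> 0"
  obtains t :: "complex ^ 'n ^ 'n" where "t \<in> diag_torus" "t $ a $ a = c"
proof -
  have "\<exists>b. b \<noteq> a"
  proof (rule ccontr)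
    assume "\<not> ?thesis"
    then have "(UNIV :: 'n set) = {a}" by auto
    then have "CARD('n) = card {a}" by metis
    with assms(1) show False by simp
  qed
  then obtain b where "b \<noteq> a" by auto
  then show ?thesis
    using that[of "coroot a b c"] coroot_torus[of a b c] assms(2) by (simp add: coroot_entry)
qed

lemma exists_SL_row:
  fixes \<xi> :: "complex ^ 'n"
  assumes "2 \<le> CARD('n)" "\<xi> \<noteq> 0"
  obtains h where "h \<in> SL" "h $ a = \<xi>"
proof -
  have *: "\<exists>h\<in>SL. h $ a = \<xi>" if nz: "\<xi> $ a \<noteq> 0" for \<xi> :: "complex ^ 'n"
  proof -
    obtain t :: "complex ^ 'n ^ 'n" where t: "t \<in> diag_torus" "t $ a $ a = \<xi> $ a"
      using exists_torus_entry[OF assms(1) nz] by blast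
    define U :: "complex ^ 'n ^ 'n" where
      "U = (\<chi> r c. of_bool (r = c) + (if r = a \<and> c \<in> UNIV - {a} then \<xi> $ c / \<xi> $ a else 0))"
    have "U \<in> SL" unfolding U_def
      by (rule row_unipotent_induct) (auto simp: SL_one SL_mult transv_SL)
    moreover have "(t ** U) $ a = \<xi>"
      using nz t by (auto simp: vec_eq_iff diag_torus_mult_left U_def)
    ultimately show ?thesis using SL_mult[OF diag_torus_SL[OF t(1)], of U] by (intro bexI[of _ "t ** U"])
  qed
  show ?thesis
  proof (cases "\<xi> $ a = 0")
    case False with *[of \<xi>] that show ?thesis by metis
  next
    case True
    obtain b where b: "\<xi> $ b \<noteq> 0" using assms(2) by (auto simp: vec_eq_iff)
    with True have ab: "b \<noteq> a" by auto
    \<comment> \<open>This row has a nonzero entry at a; subtracting \<open>1 / \<xi> $ b\<close>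
      times column b from column a afterwards restores \<xi>.\<close>
    define \<eta> where "\<eta> = \<xi> + axis a 1"
    have "\<eta> $ a \<noteq> 0" using True by (simp add: \<eta>_def)
    then obtain h where h: "h \<in> SL" "h $ a = \<eta>" using *[of \<eta>] by metis
    have "(h ** transv b a (- 1 / \<xi> $ b)) $ a = \<xi>"
      using b ab True by (auto simp: vec_eq_iff mult_transv_entry h \<eta>_def axis_def)
    moreover have "h ** transv b a (- 1 / \<xi> $ b) \<in> SL" using h ab by (simp add: SL_mult transv_SL)
    ultimately show ?thesis using that by metis
  qed
qed

section \<open>Weights and root subgroups\<close>

text \<open>Extended by 0 off the torus, the characters are elements of the vector space of functions, and they
  coincide as functions iff their exponents differ by a constant vector.\<close>

definition tchar :: "('n \<Rightarrow> int) \<Rightarrow> complex ^ 'n ^ 'n \<Rightarrow> complex" where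
  "tchar \<mu> A = (if A \<in> diag_torus then \<Prod>i\<in>UNIV. A $ i $ i powi \<mu> i else 0)"

definition shift_root :: "('n \<Rightarrow> int) \<Rightarrow> 'n \<Rightarrow> 'n \<Rightarrow> int \<Rightarrow> 'n \<Rightarrow> int" where
  "shift_root \<mu> i j k = (\<lambda>l. \<mu> l + (if l = i then k else if l = j then - k else 0))"

lemma shift_root_0 [simp]: "shift_root \<mu> i j 0 = \<mu>"
  by (simp add: shift_root_def fun_eq_iff)

lemma shift_root_add: "shift_root (shift_root \<mu> i j k) i j l = shift_root \<mu> i j (k + l)"
  by (simp add: shift_root_def fun_eq_iff)

lemma shift_root_swap: "i \<noteq> j \<Longrightarrow> shift_root \<mu> j i k = shift_root \<mu> i j (- k)"
  by (auto simp: shift_root_def fun_eq_iff)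

lemma multiplicative_tchar: "multiplicative_on diag_torus (**) (mat 1) (tchar \<mu>)"
  unfolding multiplicative_on_def tchar_def
  by (auto simp: diag_torus_one diag_torus_mult diag_torus_mult_left power_int_mult_distrib
      prod.distrib) (simp add: mat_def)

lemma tchar_mult: "s \<in> diag_torus \<Longrightarrow> t \<in> diag_torus \<Longrightarrow> tchar \<mu> (s ** t) = tchar \<mu> s * tchar \<mu> t"
  using multiplicative_tchar[of \<mu>] by (simp add: multiplicative_on_def)

lemma tchar_one: "tchar \<mu> (mat 1) = 1"
  using multiplicative_tchar[of \<mu>] by (simp add: multiplicative_on_def)

lemma tchar_nonzero: "t \<in> diag_torus \<Longrightarrow> tchar \<mu> t \<noteq> 0"
  by (simp add: tchar_def diag_torus_nonzero)

lemma tchar_coroot: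
  assumes "i \<noteq> j" "c \<noteq> 0"
  shows "tchar \<mu> (coroot i j c) = c powi (\<mu> i - \<mu> j)"
proof -
  have "tchar \<mu> (coroot i j c) = c powi \<mu> i * inverse c powi \<mu> j"
    using assms unfolding tchar_def
    by (simp add: coroot_torus, subst prod_two_point[of i j]) (auto simp: coroot_entry)
  then show ?thesis
    using assms by (simp add: power_int_diff power_int_inverse divide_inverse)
qed

lemma powi_2_inject: "(2 :: complex) powi a = 2 powi b \<Longrightarrow> a = b"
proof -
  assume "(2 :: complex) powi a = 2 powi b"
  then have "norm ((2 :: complex) powi a) = norm ((2 :: complex) powi b)" by simp
  then have "(2 :: real) powi a = 2 powi b" by (simp add: norm_power_int)
  then show "a = b" by (metis linorder_neq_iff one_less_numeral_iff power_int_strict_increasing semiring_norm(76) less_irrefl)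
qed

text \<open>Both sides are the exponents of 2 in the values at \<open>coroot i j 2\<close>, and
  distinct integer powers of 2 differ.\<close>

lemma tchar_eq_imp:
  assumes "tchar \<mu> = tchar \<nu>"
  shows "\<mu> i - \<mu> j = \<nu> i - \<nu> j"
proof (cases "i = j")
  case False
  then show ?thesis using tchar_coroot[of i j 2 \<mu>] tchar_coroot[of i j 2 \<nu>] assms powi_2_inject by auto
qed auto

lemma tchar_add: "t \<in> diag_torus \<Longrightarrow> tchar (\<lambda>i. \<mu> i + \<nu> i) t = tchar \<mu> t * tchar \<nu> t"
  by (simp add: tchar_def power_int_add diag_torus_nonzero prod.distrib)

lemma tchar_const: "t \<in> diag_torus \<Longrightarrow> tchar (\<lambda>i. c) t = 1"
proof -
  assume t: "t \<in> diag_torus"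
  have nat: "(\<Prod>i\<in>UNIV. t $ i $ i ^ n) = 1" for n
    using diag_torus_prod[OF t] by (simp add: prod_power_distrib[symmetric])
  have "(\<Prod>i\<in>UNIV. inverse (t $ i $ i ^ n)) = inverse (\<Prod>i\<in>UNIV. t $ i $ i ^ n)" for n
    by (simp only: prod_inversef[symmetric] o_def)
  with t nat show ?thesis
    by (cases c rule: int_cases2) (simp_all add: tchar_def power_int_minus)
qed

lemma tchar_add_const: "tchar (\<lambda>i. \<mu> i + c) = tchar \<mu>"
proof
  fix t show "tchar (\<lambda>i. \<mu> i + c) t = tchar \<mu> t"
    by (cases "t \<in> diag_torus") (simp add: tchar_add tchar_const, simp add: tchar_def)
qed

lemma tchar_shift_root:
  assumes "t \<in> diag_torus" "i \<noteq> j"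
  shows "tchar (shift_root \<mu> i j (int k)) t = tchar \<mu> t * (t $ i $ i / t $ j $ j) ^ k"
proof -
  have "tchar (\<lambda>l. if l = i then int k else if l = j then - int k else 0) t = (t $ i $ i / t $ j $ j) ^ k"
    using assms unfolding tchar_def
    by (simp, subst prod_two_point[of i j]) (auto simp: power_int_minus power_divide divide_inverse power_mult_distrib power_inverse)
  then show ?thesis unfolding shift_root_def using assms(1) by (simp add: tchar_add)
qed

lemma tchar_swap:
  assumes "t \<in> diag_torus" "i \<noteq> j"
  shows "tchar \<mu> (diag_mat (\<lambda>k. t $ Transposition.transpose i j k $ Transposition.transpose i j k))
    = tchar (\<mu> \<circ> Transposition.transpose i j) t"
proof -
  let ?\<tau> = "Transposition.transpose i j"
  have "(\<Prod>k\<in>UNIV. t $ ?\<tau> k $ ?\<tau> k powi \<mu> k) = (\<Prod>k\<in>UNIV. t $ ?\<tau> (?\<tau> k) $ ?\<tau> (?\<tau> k) powi \<mu> (?\<tau> k))"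
    by (rule prod.reindex_bij_betw[of ?\<tau>, symmetric]) simp
  then show ?thesis
    using torus_weyl(1)[OF assms] assms(1) by (simp add: tchar_def diag_mat_entry)
qed

text \<open>The last two assumptions are all that is needed of \<open>algebraic\<close>, and they are visibly stable under
  twisting by inverse transposition.\<close>

locale split_rep = vector_space smul
  for smul :: "complex \<Rightarrow> 'v::ab_group_add \<Rightarrow> 'v" +
  fixes \<rho> :: "complex ^ 'n ^ 'n \<Rightarrow> 'v \<Rightarrow> 'v"
  assumes finite_dim: "\<exists>B. finite B \<and> span B = UNIV"
    and linear_action: "g \<in> SL \<Longrightarrow> Vector_Spaces.linear smul smul (\<rho> g)"
    and action_one: "\<rho> (mat 1) v = v"
    and action_mult: "g \<in> SL \<Longrightarrow> h \<in> SL \<Longrightarrow> \<rho> (g ** h) v = \<rho> g (\<rho> h v)"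
    and weight_span: "span {v. \<exists>\<mu>. \<forall>t\<in>diag_torus. \<rho> t v = smul (tchar \<mu> t) v} = UNIV"
    and root_poly: "i \<noteq> j \<Longrightarrow> \<exists>d w. \<forall>x. \<rho> (transv i j x) v = (\<Sum>k\<le>d. smul (x ^ k) (w k))"
begin

definition wspace :: "('n \<Rightarrow> int) \<Rightarrow> 'v set" where
  "wspace \<mu> = {v. \<forall>t\<in>diag_torus. \<rho> t v = smul (tchar \<mu> t) v}"

definition wts :: "('n \<Rightarrow> int) set" where
  "wts = {\<mu>. \<exists>v\<in>wspace \<mu>. v \<noteq> 0}"

lemma vs: "vector_space smul" by (rule vector_space_axioms)

lemma action_add: "g \<in> SL \<Longrightarrow> \<rho> g (v + w) = \<rho> g v + \<rho> g w"
  using linear_action[of g] by (simp add: Vector_Spaces.linear_iff)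

lemma action_scale: "g \<in> SL \<Longrightarrow> \<rho> g (smul c v) = smul c (\<rho> g v)"
  using linear_action[of g] by (simp add: Vector_Spaces.linear_iff)

lemma action_zero: "g \<in> SL \<Longrightarrow> \<rho> g 0 = 0"
  using action_scale[of g 0 0] by simp

lemma action_sum: "g \<in> SL \<Longrightarrow> \<rho> g (\<Sum>i\<in>I. f i) = (\<Sum>i\<in>I. \<rho> g (f i))"
  by (induction I rule: infinite_finite_induct) (simp_all add: action_zero action_add)

lemma action_inverse:
  assumes "g \<in> SL" shows "\<rho> (matrix_inv g) (\<rho> g v) = v" "\<rho> g (\<rho> (matrix_inv g) v) = v"
  using assms SL_inverse[OF assms] action_mult action_one by metis+

lemma action_eq_0_iff: "g \<in> SL \<Longrightarrow> \<rho> g v = 0 \<longleftrightarrow> v = 0"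
  by (metis action_inverse(1) action_zero SL_inverse(3))

lemma action_span:
  assumes "g \<in> SL" "\<And>w. w \<in> S \<Longrightarrow> \<rho> g w \<in> span S'" "v \<in> span S"
  shows "\<rho> g v \<in> span S'"
  using assms(3)
proof (induction rule: span_induct_alt)
  case base then show ?case by (simp add: action_zero assms(1) span_zero)
next
  case (step c x y) then show ?case
    by (simp add: action_add action_scale assms(1,2) span_add span_scale)
qed

lemma span_wspaces: "span (\<Union>\<mu>. wspace \<mu>) = UNIV"
proof -
  have "(\<Union>\<mu>. wspace \<mu>) = {v. \<exists>\<mu>. \<forall>t\<in>diag_torus. \<rho> t v = smul (tchar \<mu> t) v}"
    by (auto simp: wspace_def)
  then show ?thesis using weight_span by simp
qed

lemma wspace_cong: "tchar \<mu> = tchar \<nu> \<Longrightarrow> wspace \<mu> = wspace \<nu>"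
  by (simp add: wspace_def)

lemma zero_in_wspace: "0 \<in> wspace \<mu>"
  by (simp add: wspace_def action_zero diag_torus_SL)

lemma wts_cong: "tchar \<mu> = tchar \<nu> \<Longrightarrow> \<mu> \<in> wts \<longleftrightarrow> \<nu> \<in> wts"
  using wspace_cong[of \<mu> \<nu>] by (simp add: wts_def)

lemma wts_add_const: "(\<lambda>i. \<mu> i + c) \<in> wts \<longleftrightarrow> \<mu> \<in> wts"
  by (rule wts_cong[OF tchar_add_const])

text \<open>For a functional f with \<open>f v = 1\<close>, the function
  \<open>t \<mapsto> f (\<rho> t v)\<close> on the torus is \<open>tchar \<mu>\<close>, while
  membership in the span makes it a combination of the \<open>tchar \<nu>\<close> with \<nu> in S.
  Independence of characters then decides.\<close>

lemma wspace_in_span: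
  assumes v: "v \<in> wspace \<mu>" "v \<noteq> 0" "v \<in> span (\<Union>\<nu>\<in>S. wspace \<nu>)"
  shows "\<exists>\<nu>\<in>S. tchar \<nu> = tchar \<mu>"
proof (rule ccontr)
  assume no: "\<not> ?thesis"
  obtain f where f: "Vector_Spaces.linear smul (*) f" "f v = 1"
    using separating_functional_0[OF vs v(2)] by auto
  interpret f: Vector_Spaces.linear smul "(*)" f by fact
  have sp: "(\<lambda>t. if t \<in> diag_torus then f (\<rho> t w) else 0) \<in> fun_space.span (tchar ` S)"
    if "w \<in> span (\<Union>\<nu>\<in>S. wspace \<nu>)" for w
    using that
  proof (induction rule: span_induct_alt)
    case base
    have "(\<lambda>t. if t \<in> diag_torus then f (\<rho> t 0) else 0) = 0"
      by (simp add: fun_eq_iff action_zero diag_torus_SL)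
    then show ?case by (simp add: fun_space.span_zero)
  next
    case (step c x y)
    then obtain \<nu> where \<nu>: "\<nu> \<in> S" "x \<in> wspace \<nu>" by auto
    have "(\<lambda>t. if t \<in> diag_torus then f (\<rho> t (smul c x + y)) else 0) =
       fun_scale (c * f x) (tchar \<nu>) + (\<lambda>t. if t \<in> diag_torus then f (\<rho> t y) else 0)"
      using \<nu>(2) by (auto simp: fun_eq_iff fun_scale_def wspace_def action_add action_scale diag_torus_SL
          f.add f.scale tchar_def)
    then show ?case
      using step \<nu> by (simp add: fun_space.span_add fun_space.span_scale fun_space.span_base)
  qed
  have "(\<lambda>t. if t \<in> diag_torus then f (\<rho> t v) else 0) = tchar \<mu>"
    using v(1) f(2) by (auto simp: fun_eq_iff wspace_def f.scale tchar_def)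
  with sp[OF v(3)] have "tchar \<mu> \<in> fun_space.span (tchar ` S)" by simp
  moreover have "tchar ` S \<subseteq> {h. multiplicative_on diag_torus (**) (mat 1) h} - {tchar \<mu>}"
    using no multiplicative_tchar by auto
  ultimately have "fun_space.dependent {h. multiplicative_on diag_torus (**) (mat 1 :: complex ^ 'n ^ 'n) h}"
    unfolding fun_space.dependent_def using multiplicative_tchar fun_space.span_mono by blast
  with multiplicative_independent[of "mat 1 :: complex ^ 'n ^ 'n" diag_torus "(**)"]
  show False using diag_torus_one diag_torus_mult by blast
qed

text \<open>A finite spanning set lies in the span of finitely many weight spaces, so up to constant
  vectors there are finitely many weights. As adding constants makes \<open>wts\<close> itself
  infinite, the conclusion is about coordinate differences.\<close>

lemma wts_bounded: "\<exists>C. \<forall>\<mu>\<in>wts. \<forall>i j. \<mu> i - \<mu> j \<le> C"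
proof -
  have fin: "\<exists>S. finite S \<and> b \<in> span (\<Union>\<nu>\<in>S. wspace \<nu>)" for b
  proof -
    have "b \<in> span (\<Union>\<mu>. wspace \<mu>)" by (simp add: span_wspaces)
    then show ?thesis
    proof (induction rule: span_induct_alt)
      case base then show ?case by (metis finite.emptyI span_zero)
    next
      case (step c x y)
      then obtain \<nu> S where *: "x \<in> wspace \<nu>" "finite S" "y \<in> span (\<Union>\<nu>\<in>S. wspace \<nu>)" by auto
      have "smul c x + y \<in> span (\<Union>\<nu>\<in>insert \<nu> S. wspace \<nu>)"
        using * span_mono[of "\<Union>\<nu>\<in>S. wspace \<nu>" "\<Union>\<nu>\<in>insert \<nu> S. wspace \<nu>"]
        by (intro span_add span_scale) (auto intro: span_base)
      with * show ?case by (metis finite.insertI)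
    qed
  qed
  then obtain F where F: "\<And>b. finite (F b)" "\<And>b. b \<in> span (\<Union>\<nu>\<in>F b. wspace \<nu>)" by metis
  obtain B where B: "finite B" "span B = UNIV" using finite_dim by auto
  define S where "S = (\<Union>b\<in>B. F b)"
  have S: "finite S" using B F by (simp add: S_def)
  have "b \<in> span (\<Union>\<nu>\<in>S. wspace \<nu>)" if "b \<in> B" for b
    using F(2)[of b] span_mono[of "\<Union>\<nu>\<in>F b. wspace \<nu>" "\<Union>\<nu>\<in>S. wspace \<nu>"] that by (auto simp: S_def)
  then have all: "span (\<Union>\<nu>\<in>S. wspace \<nu>) = UNIV"
    using span_mono[of B "span (\<Union>\<nu>\<in>S. wspace \<nu>)"] B(2) by (auto simp: span_span)
  define C where "C = Max ((\<lambda>(\<nu>, i, j). \<nu> i - \<nu> j) ` (S \<times> UNIV \<times> UNIV))"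
  have "\<mu> i - \<mu> j \<le> C" if "\<mu> \<in> wts" for \<mu> i j
  proof -
    obtain v where "v \<in> wspace \<mu>" "v \<noteq> 0" using \<open>\<mu> \<in> wts\<close> by (auto simp: wts_def)
    with wspace_in_span[of v \<mu> S] all obtain \<nu> where \<nu>: "\<nu> \<in> S" "tchar \<nu> = tchar \<mu>" by auto
    have "\<mu> i - \<mu> j = (\<lambda>(\<nu>, i, j). \<nu> i - \<nu> j) (\<nu>, i, j)" using tchar_eq_imp[OF \<nu>(2)] by simp
    also have "\<dots> \<le> C" unfolding C_def by (intro Max_ge imageI) (use S \<nu>(1) in auto)
    finally show ?thesis .
  qed
  then show ?thesis by blast
qed

text \<open>Conjugation by the torus rescales x by the root, so comparing coefficients of x^k gives
  \<open>z k\<close> its weight; \<open>z k\<close> is E^k / k! applied to v, with E the root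
  vector. That the coefficients have no gaps comes from \<open>transv_add\<close>: the coefficient
  of x^l in the action of x + y expresses the action of \<open>transv i j y\<close> on
  \<open>z l\<close> through binomial multiples of the \<open>z m\<close>.\<close>

lemma root_expansion:
  assumes v: "v \<in> wspace \<mu>" and ij: "i \<noteq> j"
  shows "\<exists>d z. (\<forall>x. \<rho> (transv i j x) v = (\<Sum>k\<le>d. smul (x ^ k) (z k))) \<and> z 0 = v \<and>
    (\<forall>k. z k \<in> wspace (shift_root \<mu> i j (int k))) \<and> (\<forall>l m. z l = 0 \<longrightarrow> l \<le> m \<longrightarrow> z m = 0)"
proof -
  obtain d w where w: "\<And>x. \<rho> (transv i j x) v = (\<Sum>k\<le>d. smul (x ^ k) (w k))"
    using root_poly[OF ij, of v] by auto
  \<comment> \<open>Padding by 0 beyond d lets the weight and gap statements hold for every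
    index.\<close>
  define z where "z k = (if k \<le> d then w k else 0)" for k
  have z: "\<rho> (transv i j x) v = (\<Sum>k\<le>d. smul (x ^ k) (z k))" for x
    using w by (simp add: z_def)
  have SL: "transv i j x \<in> SL" for x using ij by (rule transv_SL)
  have "z 0 = v"
  proof -
    have "v = \<rho> (transv i j 0) v" by (simp add: transv_0 action_one)
    also have "\<dots> = (\<Sum>k\<le>d. if k = 0 then z k else 0)"
      unfolding z by (intro sum.cong) (auto simp: power_0_left)
    finally show ?thesis by simp
  qed
  moreover have "z k \<in> wspace (shift_root \<mu> i j (int k))" for k
  proof (cases "k \<le> d")
    case False
    then show ?thesis by (simp add: z_def zero_in_wspace)
  next
    case True
    have "\<rho> t (z k) = smul (tchar \<mu> t * (t $ i $ i / t $ j $ j) ^ k) (z k)" if t: "t \<in> diag_torus" for t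
    proof -
      let ?c = "t $ i $ i / t $ j $ j"
      have "(\<Sum>k\<le>d. smul (x ^ k) (\<rho> t (z k) - smul (tchar \<mu> t * ?c ^ k) (z k))) = 0" for x
      proof -
        have "\<rho> t (\<rho> (transv i j x) v) = \<rho> (transv i j (?c * x)) (\<rho> t v)"
          using action_mult[OF diag_torus_SL[OF t] SL, of x v] action_mult[OF SL diag_torus_SL[OF t], of "?c * x" v]
            torus_transv[OF t ij, of x] by simp
        also have "\<rho> t v = smul (tchar \<mu> t) v" using v t by (simp add: wspace_def)
        finally have "(\<Sum>k\<le>d. smul (x ^ k) (\<rho> t (z k))) = (\<Sum>k\<le>d. smul (tchar \<mu> t * (?c * x) ^ k) (z k))"
          by (simp add: z action_sum action_scale diag_torus_SL t SL scale_sum_right)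
        also have "\<dots> = (\<Sum>k\<le>d. smul (x ^ k) (smul (tchar \<mu> t * ?c ^ k) (z k)))"
          by (intro sum.cong refl) (simp only: power_mult_distrib scale_scale mult_ac)
        finally show ?thesis by (simp add: scale_right_diff_distrib sum_subtractf)
      qed
      from polynomial_coeffs_zero[OF vs this True] show ?thesis by simp
    qed
    then show ?thesis by (simp add: wspace_def tchar_shift_root ij)
  qed
  moreover have "z m = 0" if l: "z l = 0" "l \<le> m" for l m
  proof (cases "m \<le> d")
    case False then show ?thesis by (simp add: z_def)
  next
    case True
    then have ld: "l \<le> d" using l by simp
    have coeff: "\<rho> (transv i j y) (z l) = (\<Sum>m\<le>d. smul (of_nat (m choose l) * y ^ (m - l)) (z m))" for y
    proof -
      have "(\<Sum>l\<le>d. smul (x ^ l) (\<rho> (transv i j y) (z l) - (\<Sum>m\<le>d. smul (of_nat (m choose l) * y ^ (m - l)) (z m)))) = 0" for x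
      proof -
        have "(\<Sum>l\<le>d. smul (x ^ l) (\<rho> (transv i j y) (z l))) = \<rho> (transv i j y) (\<rho> (transv i j x) v)"
          by (simp add: z action_sum action_scale SL)
        also have "\<dots> = \<rho> (transv i j (x + y)) v"
          using action_mult[OF SL SL, of y x v] transv_add[OF ij, of y x] by (simp add: add.commute)
        also have "\<dots> = (\<Sum>m\<le>d. smul (\<Sum>l\<le>d. of_nat (m choose l) * x ^ l * y ^ (m - l)) (z m))"
          unfolding z
        proof (intro sum.cong refl arg_cong2[where f = smul])
          fix m assume "m \<in> {..d}"
          then show "(x + y) ^ m = (\<Sum>l\<le>d. of_nat (m choose l) * x ^ l * y ^ (m - l))"
            unfolding binomial_ring by (intro sum.mono_neutral_left) auto
        qed
        also have "\<dots> = (\<Sum>l\<le>d. smul (x ^ l) (\<Sum>m\<le>d. smul (of_nat (m choose l) * y ^ (m - l)) (z m)))"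
          by (simp add: scale_sum_left scale_sum_right, subst sum.swap) (simp add: mult_ac)
        finally show ?thesis by (simp add: scale_right_diff_distrib sum_subtractf)
      qed
      from polynomial_coeffs_zero[OF vs this ld] show ?thesis by simp
    qed
    have "(\<Sum>m\<le>d. smul (y ^ m) (smul (of_nat (m choose l)) (z m))) = 0" for y
    proof -
      have "0 = smul (y ^ l) (\<rho> (transv i j y) (z l))" using l by (simp add: action_zero SL)
      also have "\<dots> = (\<Sum>m\<le>d. smul (y ^ m) (smul (of_nat (m choose l)) (z m)))"
        unfolding coeff scale_sum_right
      proof (intro sum.cong refl)
        fix m
        show "smul (y ^ l) (smul (of_nat (m choose l) * y ^ (m - l)) (z m)) = smul (y ^ m) (smul (of_nat (m choose l)) (z m))"
          by (cases "l \<le> m") (simp_all add: mult_ac power_add[symmetric] binomial_eq_0)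
      qed
      finally show ?thesis by simp
    qed
    from polynomial_coeffs_zero[OF vs this True] l(2) show ?thesis by (simp add: scale_eq_0_iff)
  qed
  ultimately show ?thesis using z by blast
qed

lemma weyl_wspace:
  assumes "v \<in> wspace \<mu>" "i \<noteq> j"
  shows "\<rho> (weyl i j) v \<in> wspace (\<mu> \<circ> Transposition.transpose i j)"
  unfolding wspace_def
proof (intro CollectI ballI)
  fix t :: "complex ^ 'n ^ 'n" assume t: "t \<in> diag_torus"
  let ?t' = "diag_mat (\<lambda>k. t $ Transposition.transpose i j k $ Transposition.transpose i j k)"
  note t' = torus_weyl[OF t assms(2)]
  have "\<rho> t (\<rho> (weyl i j) v) = \<rho> (weyl i j) (\<rho> ?t' v)"
    using action_mult[OF diag_torus_SL[OF t] weyl_SL[OF assms(2)], of v]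
      action_mult[OF weyl_SL[OF assms(2)] diag_torus_SL[OF t'(1)], of v] t'(2) by simp
  also have "\<rho> ?t' v = smul (tchar \<mu> ?t') v" using assms(1) t'(1) by (simp add: wspace_def)
  finally show "\<rho> t (\<rho> (weyl i j) v) = smul (tchar (\<mu> \<circ> Transposition.transpose i j) t) (\<rho> (weyl i j) v)"
    using assms by (simp add: action_scale weyl_SL tchar_swap[OF t assms(2)])
qed

lemma wts_swap:
  assumes "\<mu> \<in> wts" shows "\<mu> \<circ> Transposition.transpose i j \<in> wts"
proof (cases "i = j")
  case True with assms show ?thesis by simp
next
  case False with assms weyl_wspace[OF _ False] action_eq_0_iff[OF weyl_SL[OF False]] show ?thesis
    unfolding wts_def by blast
qed

text \<open>If the \<open>\<mu> - (e\<^sub>i - e\<^sub>j)\<close> weight space vanishes, the weight spaces of \<open>\<mu> + k (e\<^sub>i - e\<^sub>j)\<close>, \<open>k \<ge> 0\<close>, span a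
  subspace that is stable under both root subgroups, hence under \<open>weyl i j\<close>; but the latter sends weight \<open>\<mu>\<close>
  to a weight that does not occur in it.\<close>

lemma wts_balance:
  assumes mu: "\<mu> \<in> wts" and lt: "\<mu> j < \<mu> i"
  shows "shift_root \<mu> i j (-1) \<in> wts"
proof (rule ccontr)
  assume gap: "shift_root \<mu> i j (-1) \<notin> wts"
  have ij: "i \<noteq> j" using lt by auto
  note ji = ij[symmetric]
  define S where "S = range (\<lambda>k::nat. shift_root \<mu> i j (int k))"
  define Y where "Y = (\<Union>\<nu>\<in>S. wspace \<nu>)"
  have Yb: "w \<in> span Y" if "w \<in> wspace (shift_root \<mu> i j (int k))" for w k
    using that unfolding Y_def S_def by (intro span_base) auto
  have up: "\<rho> (transv i j x) w \<in> span Y" if "w \<in> span Y" for x w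
  proof (rule action_span[OF transv_SL[OF ij] _ that])
    fix w assume "w \<in> Y"
    then obtain k where "w \<in> wspace (shift_root \<mu> i j (int k))" unfolding Y_def S_def by auto
    from root_expansion[OF this ij] obtain d z where
      z: "\<forall>x. \<rho> (transv i j x) w = (\<Sum>k\<le>d. smul (x ^ k) (z k))"
        "\<forall>l. z l \<in> wspace (shift_root (shift_root \<mu> i j (int k)) i j (int l))"
        "\<forall>l m. z l = 0 \<longrightarrow> l \<le> m \<longrightarrow> z m = 0"
      by (elim exE conjE)
    note z2 = z(2)[rule_format, unfolded shift_root_add of_nat_add[symmetric]]
    show "\<rho> (transv i j x) w \<in> span Y"
      unfolding z(1)[rule_format] by (intro span_sum span_scale Yb[OF z2])
  qed
  have down: "\<rho> (transv j i x) w \<in> span Y" if "w \<in> span Y" for x w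
  proof (rule action_span[OF transv_SL[OF ji] _ that])
    fix w assume "w \<in> Y"
    then obtain k where "w \<in> wspace (shift_root \<mu> i j (int k))" unfolding Y_def S_def by auto
    from root_expansion[OF this ji] obtain d z where
      z: "\<forall>x. \<rho> (transv j i x) w = (\<Sum>k\<le>d. smul (x ^ k) (z k))"
        "\<forall>l. z l \<in> wspace (shift_root (shift_root \<mu> i j (int k)) j i (int l))"
        "\<forall>l m. z l = 0 \<longrightarrow> l \<le> m \<longrightarrow> z m = 0"
      by (elim exE conjE)
    note z2 = z(2)[rule_format, unfolded shift_root_swap[OF ij] shift_root_add, folded diff_conv_add_uminus]
    \<comment> \<open>This term has weight \<mu> - (e_i - e_j), which does not occur; as the
      coefficients have no gaps, all later terms vanish too.\<close>
    have "z (Suc k) \<in> wspace (shift_root \<mu> i j (-1))" using z2[of "Suc k"] by (simp only: of_nat_Suc) simp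
    with gap have "z (Suc k) = 0" by (auto simp: wts_def)
    then have z0: "z l = 0" if "k < l" for l using z(3)[rule_format, of "Suc k" l] that by simp
    have "z l \<in> span Y" for l
    proof (cases "k < l")
      case True then show ?thesis by (simp add: z0 span_zero)
    next
      case False then show ?thesis using z2[of l] Yb[of "z l" "k - l"] by (simp add: of_nat_diff)
    qed
    then show "\<rho> (transv j i x) w \<in> span Y"
      unfolding z(1)[rule_format] by (intro span_sum span_scale)
  qed
  obtain v where v: "v \<in> wspace \<mu>" "v \<noteq> 0" using mu by (auto simp: wts_def)
  have "\<rho> (weyl i j) v \<in> span Y"
    using up down Yb[of v 0] v
    by (simp add: weyl_def action_mult SL_mult transv_SL ij ji)
  with wspace_in_span[OF weyl_wspace[OF v(1) ij]] action_eq_0_iff[OF weyl_SL[OF ij]] v(2)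
  obtain k where k: "tchar (shift_root \<mu> i j (int k)) = tchar (\<mu> \<circ> Transposition.transpose i j)"
    unfolding Y_def S_def by blast
  \<comment> \<open>The coordinate difference between i and j is at least \<mu> i - \<mu> j > 0 on
    the left and equals \<mu> j - \<mu> i < 0 on the right.\<close>
  from tchar_eq_imp[OF k, of i j] lt ij show False by (simp add: shift_root_def)
qed

end

section \<open>Convex relations between weights\<close>

text \<open>A convex combination of \<open>r\<close> elements of \<open>P\<close> (repetitions allowed) is a constant vector, i.e. zero in
  \<open>X(T) \<otimes> \<rat>\<close>; the coefficients are scaled to natural numbers.\<close>

definition rel_bound :: "('n \<Rightarrow> int) set \<Rightarrow> nat \<Rightarrow> bool" where
  "rel_bound P r \<longleftrightarrow> (\<exists>\<mu> c. (\<forall>s<r. \<mu> s \<in> P) \<and> (\<exists>s<r. c s \<noteq> 0) \<and>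
     (\<exists>k. \<forall>i. (\<Sum>s<r. int (c s) * \<mu> s i) = k))"

lemma rel_boundI:
  fixes c :: "'s \<Rightarrow> nat"
  assumes "finite K" "\<And>s. s \<in> K \<Longrightarrow> \<mu> s \<in> P" "w \<in> K" "c w \<noteq> 0"
    "\<And>i. (\<Sum>s\<in>K. int (c s) * \<mu> s i) = k"
  shows "rel_bound P (card K)"
proof -
  obtain h where h: "bij_betw h {0..<card K} K" using ex_bij_betw_nat_finite[OF assms(1)] by auto
  then have hK: "h s \<in> K" if "s < card K" for s using that by (auto simp: bij_betw_def)
  obtain s1 where s1: "s1 < card K" "h s1 = w"
    using h assms(3) unfolding bij_betw_def by (metis atLeastLessThan_iff imageE)
  have "(\<Sum>s<card K. int (c (h s)) * \<mu> (h s) i) = k" for i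
    using sum.reindex_bij_betw[OF h, of "\<lambda>s. int (c s) * \<mu> s i"] assms(5)[of i]
    by (simp add: atLeast0LessThan)
  then show ?thesis
    unfolding rel_bound_def using hK assms(2,4) s1
    by (intro exI[of _ "\<lambda>s. \<mu> (h s)"] exI[of _ "\<lambda>s. c (h s)"]) auto
qed

lemma rel_bound_uminus:
  assumes "rel_bound P r" "\<And>\<mu>. \<mu> \<in> P \<Longrightarrow> (\<lambda>i. - \<mu> i) \<in> P'"
  shows "rel_bound P' r"
proof -
  obtain \<mu> c k where *: "\<forall>s<r. \<mu> s \<in> P" "\<exists>s<r. c s \<noteq> (0::nat)" "\<forall>i. (\<Sum>s<r. int (c s) * \<mu> s i) = k"
    using assms(1) by (auto simp: rel_bound_def)
  then show ?thesis
    unfolding rel_bound_def using assms(2)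
    by (intro exI[of _ "\<lambda>s i. - \<mu> s i"] exI[of _ c]) (auto simp: sum_negf)
qed

text \<open>With |I| = k these are the weights of the k-th exterior power of the standard
  representation.\<close>

definition ind :: "'n set \<Rightarrow> 'n \<Rightarrow> int" where
  "ind I = (\<lambda>i. of_bool (i \<in> I))"

lemma card_less_permuted:
  fixes f :: "nat \<Rightarrow> nat"
  assumes inj: "inj_on f {..<M}" and sub: "f ` {..<M} \<subseteq> {..<M}" and "k \<le> M"
  shows "card {s. s < M \<and> f s < k} = k"
proof -
  have "f ` {..<M} = {..<M}" using inj sub by (intro endo_inj_surj) auto
  then have "f ` {s. s < M \<and> f s < k} = {..<k}"
    using assms(3) by (auto simp: set_eq_iff image_iff) (metis lessThan_iff order_less_le_trans)+
  moreover have "inj_on f {s. s < M \<and> f s < k}" by (rule inj_on_subset[OF inj]) auto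
  ultimately show ?thesis by (metis card_image card_lessThan)
qed

text \<open>One block of \<open>k\<close> elements, taken \<open>k\<close> times, and the \<open>CARD('n) - k\<close> cyclic intervals of length \<open>k\<close>
  in the rest.\<close>

lemma rel_bound_subsets:
  assumes k: "2 \<le> k" "2 * k \<le> CARD('n::finite)"
    and P: "\<And>I :: 'n set. card I = k \<Longrightarrow> ind I \<in> P"
  shows "rel_bound P (CARD('n) - 1)"
proof -
  define N where "N = CARD('n)"
  define M where "M = N - k"
  \<comment> \<open>The assumption 2 \<le> k gives \<open>Suc M \<le> N - 1\<close>, the bound on
    the number of sets; 2 k \<le> N leaves room for intervals of length k outside the block.\<close>
  have M: "k \<le> M" "Suc M \<le> N - 1" "N = k + M" using k by (auto simp: M_def N_def)
  obtain g :: "'n \<Rightarrow> nat" where g: "bij_betw g UNIV {0..<N}"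
    using ex_bij_betw_finite_nat[of "UNIV :: 'n set"] by (auto simp: N_def)
  have card_g: "card {i. g i \<in> X} = card X" if "X \<subseteq> {0..<N}" for X
  proof -
    have "g ` {i. g i \<in> X} = X \<inter> range g" by auto
    also have "range g = {0..<N}" using g by (simp add: bij_betw_def)
    also have "X \<inter> {0..<N} = X" using that by auto
    finally have "g ` {i. g i \<in> X} = X" .
    moreover have "inj_on g {i. g i \<in> X}" using g by (auto simp: bij_betw_def intro: inj_on_subset)
    ultimately show ?thesis by (metis card_image)
  qed
  have gN: "g i < N" for i using g by (auto simp: bij_betw_def)
  \<comment> \<open>\<open>f s y\<close> is the position of y counted from s on a cycle of length M.
    Thus \<open>cyc\<close> counts the intervals through the point y, and \<open>cyc'\<close> the
    points of the interval that starts at s.\<close>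
  define f where "f s y = (if s \<le> y then y - s else y + M - s)" for s y :: nat
  have cyc: "card {s. s < M \<and> f s y < k} = k" if "y < M" for y
    using that M(1) by (intro card_less_permuted) (auto simp: f_def inj_on_def split: if_splits)
  have cyc': "card {y. y < M \<and> f s y < k} = k" if "s < M" for s
    using that M(1) by (intro card_less_permuted) (auto simp: f_def inj_on_def split: if_splits)
  define X where "X s = (if s < M then (\<lambda>y. k + y) ` {y. y < M \<and> f s y < k} else {..<k})" for s
  define I where "I s = {i. g i \<in> X s}" for s
  \<comment> \<open>Each point outside the block lies in k of the M intervals, so the block gets
    coefficient k to match; indices beyond M only pad the family to N - 1 members.\<close>
  define c where "c s = (if s < M then 1 else if s = M then k else 0)" for s
  have "card (X s) = k" for s
    using cyc'[of s] by (auto simp: X_def card_image)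
  moreover have "X s \<subseteq> {0..<N}" for s using M by (auto simp: X_def)
  ultimately have "card (I s) = k" for s by (simp add: I_def card_g)
  moreover have "(\<Sum>s<N - 1. int (c s) * ind (I s) i) = int k" for i
  proof -
    have "(\<Sum>s<N - 1. int (c s) * ind (I s) i) = (\<Sum>s<Suc M. int (c s) * ind (I s) i)"
      by (rule sum.mono_neutral_right) (use M in \<open>auto simp: c_def\<close>)
    also have "\<dots> = int (card {s. s < M \<and> g i \<in> X s}) + int k * of_bool (g i < k)"
    proof -
      have "(\<Sum>s<M. int (c s) * ind (I s) i) = (\<Sum>s<M. of_bool (g i \<in> X s))"
        by (intro sum.cong) (auto simp: c_def ind_def I_def)
      also have "\<dots> = int (card ({s. s < M} \<inter> {s. g i \<in> X s}))"
        by (simp add: sum_of_bool_eq lessThan_def)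
      finally show ?thesis by (auto simp: c_def ind_def I_def X_def Collect_conj_eq)
    qed
    also have "\<dots> = int k"
    proof (cases "g i < k")
      case True
      then have "{s. s < M \<and> g i \<in> X s} = {}" by (auto simp: X_def)
      then show ?thesis using True by simp
    next
      case False
      define y where "y = g i - k"
      have y: "g i = k + y" "y < M" using False gN[of i] M by (auto simp: y_def)
      then have "{s. s < M \<and> g i \<in> X s} = {s. s < M \<and> f s y < k}" by (auto simp: X_def)
      then show ?thesis using False cyc[OF y(2)] by simp
    qed
    finally show ?thesis .
  qed
  moreover have "M < N - 1" "c M \<noteq> 0" using M k by (auto simp: c_def)
  ultimately show ?thesis
    unfolding rel_bound_def using P unfolding N_def[symmetric]
    by (intro exI[of _ "\<lambda>s. ind (I s)"] exI[of _ c]) blast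
qed

lemma sum_shift_root: "i \<noteq> j \<Longrightarrow> (\<Sum>l\<in>UNIV. shift_root \<mu> i j k l) = (\<Sum>l\<in>UNIV. \<mu> l)" for i :: "'n::finite"
proof -
  assume ij: "i \<noteq> j"
  have "(\<Sum>l\<in>UNIV. shift_root \<mu> i j k l) = (\<Sum>l\<in>UNIV. \<mu> l + ((if l = i then k else 0) + (if l = j then - k else 0)))"
    using ij by (intro sum.cong) (auto simp: shift_root_def)
  then show ?thesis by (simp add: sum.distrib)
qed

lemma square_sum_shift_root:
  fixes \<mu> :: "'n::finite \<Rightarrow> int"
  assumes "\<mu> j + 2 \<le> \<mu> i"
  shows "(\<Sum>l\<in>UNIV. (shift_root \<mu> i j (-1) l)\<^sup>2) < (\<Sum>l\<in>UNIV. (\<mu> l)\<^sup>2)"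
proof -
  have ij: "i \<noteq> j" using assms by auto
  have "(\<Sum>l\<in>UNIV. (shift_root \<mu> i j (-1) l)\<^sup>2) =
      (\<Sum>l\<in>UNIV. (\<mu> l)\<^sup>2 + ((if l = i then 1 - 2 * \<mu> i else 0) + (if l = j then 1 + 2 * \<mu> j else 0)))"
    using ij by (intro sum.cong) (auto simp: shift_root_def power2_eq_square algebra_simps)
  also have "\<dots> = (\<Sum>l\<in>UNIV. (\<mu> l)\<^sup>2) + (1 - 2 * \<mu> i) + (1 + 2 * \<mu> j)"
    by (simp add: sum.distrib)
  finally show ?thesis using assms by simp
qed

section \<open>Balancing weights and the relations they supply\<close>

context split_rep
begin

text \<open>Moving a unit from the larger to the smaller coordinate shortens the vector if they
  differ by at least 2. A difference of 1 would merely be swapped, so the descent ends at vectors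
  with at most two consecutive values.\<close>

lemma balance_induct [consumes 1, case_names balance]:
  assumes "\<mu> \<in> wts"
    and step: "\<And>\<mu>. \<mu> \<in> wts \<Longrightarrow> (\<And>i j. \<mu> j + 2 \<le> \<mu> i \<Longrightarrow> Q (shift_root \<mu> i j (-1))) \<Longrightarrow> Q \<mu>"
  shows "Q \<mu>"
  using assms(1)
proof (induction "nat (\<Sum>l\<in>UNIV. (\<mu> l)\<^sup>2)" arbitrary: \<mu> rule: less_induct)
  case less
  show ?case
  proof (rule step[OF less.prems])
    fix i j assume ij: "\<mu> j + 2 \<le> \<mu> i"
    have "0 \<le> (\<Sum>l\<in>UNIV. (shift_root \<mu> i j (-1) l)\<^sup>2)" by (simp add: sum_nonneg)
    then show "Q (shift_root \<mu> i j (-1))"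
      using square_sum_shift_root[OF ij] wts_balance[OF less.prems, of j i] ij
      by (intro less.hyps) auto
  qed
qed

lemma almost_constant:
  fixes \<mu> :: "'n \<Rightarrow> int"
  assumes "\<And>i j. \<mu> i \<le> \<mu> j + 1"
  obtains I c where "I \<noteq> UNIV" "\<mu> = (\<lambda>i. ind I i + c)"
proof -
  define c where "c = Min (range \<mu>)"
  define I where "I = {i. \<mu> i \<noteq> c}"
  have c: "c \<in> range \<mu>" unfolding c_def by (rule Min_in) auto
  then obtain j where j: "\<mu> j = c" by auto
  have "c \<le> \<mu> i" for i unfolding c_def by (rule Min_le) auto
  then have "\<mu> i = ind I i + c" for i
    using assms[of i j] j by (auto simp: I_def ind_def) (smt (verit))
  moreover have "I \<noteq> UNIV" using j by (auto simp: I_def)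
  ultimately show ?thesis using that by blast
qed

text \<open>Each move preserves the coordinate sum, and adding a constant changes it by a multiple
  of \<open>CARD('n)\<close>. The congruence records the central character and later yields the
  parity of the top weight for SL(2).\<close>

lemma wts_reduction:
  assumes "\<mu> \<in> wts"
  shows "\<exists>I q. ind I \<in> wts \<and> I \<noteq> UNIV \<and> (\<Sum>l\<in>UNIV. \<mu> l) = int (card I) + int CARD('n) * q"
  using assms
proof (induction rule: balance_induct)
  case (balance \<mu>)
  show ?case
  proof (cases "\<exists>i j. \<mu> j + 2 \<le> \<mu> i")
    case True
    then obtain i j where ij: "\<mu> j + 2 \<le> \<mu> i" by auto
    then have "i \<noteq> j" by auto
    with balance(2)[OF ij] show ?thesis by (simp add: sum_shift_root)
  next
    case False
    have "\<mu> i \<le> \<mu> j + 1" for i j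
    proof (rule ccontr)
      assume "\<not> ?thesis"
      then have "\<mu> j + 2 \<le> \<mu> i" by linarith
      with False show False by blast
    qed
    then obtain I c where I: "I \<noteq> UNIV" "\<mu> = (\<lambda>i. ind I i + c)" using almost_constant by blast
    have "(\<Sum>l\<in>UNIV. \<mu> l) = int (card I) + int CARD('n) * c"
      by (simp add: I(2) sum.distrib ind_def sum_of_bool_eq)
    with I balance(1) wts_add_const show ?thesis by blast
  qed
qed

lemma ind_wts_card:
  assumes "ind I \<in> wts" "card I = card J"
  shows "ind J \<in> wts"
  using assms
proof (induction "card (I - J)" arbitrary: I)
  case 0
  then have "I \<subseteq> J" by simp
  with 0 have "I = J" by (simp add: card_subset_eq)
  with 0 show ?case by simp
next
  case (Suc m)
  then obtain i where i: "i \<in> I" "i \<notin> J" by (metis Diff_iff card_eq_0_iff ex_in_conv nat.simps(3))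
  have "\<not> J \<subseteq> I" using Suc.prems(2) i by (metis card_subset_eq finite)
  then obtain j where j: "j \<in> J" "j \<notin> I" by auto
  define I' where "I' = insert j (I - {i})"
  have "ind I \<circ> Transposition.transpose i j = ind I'"
    using i j by (auto simp: fun_eq_iff ind_def I'_def Transposition.transpose_def)
  with wts_swap[OF Suc.prems(1), of i j] have 1: "ind I' \<in> wts" by simp
  have "I' - J = (I - J) - {i}" using i j by (auto simp: I'_def)
  then have 2: "m = card (I' - J)" using Suc.hyps(2) i by simp
  have "card I' = card I" using i j by (simp add: I'_def card.insert_remove card_gt_0_iff)
     (metis Suc_pred card_gt_0_iff empty_iff finite)
  then show ?case using Suc.hyps(1)[OF 2 1] Suc.prems(2) by simp
qed

lemma rel_bound_zero: "ind {} \<in> wts \<Longrightarrow> rel_bound wts 1"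
  using rel_boundI[of "{()}" "\<lambda>_. ind {}" wts "()" "\<lambda>_. 1" 0] by (simp add: ind_def)

lemma rel_bound_middle:
  assumes "ind I \<in> wts" "2 \<le> card I" "2 * card I \<le> CARD('n)"
  shows "rel_bound wts (CARD('n) - 1)"
  using rel_bound_subsets[OF assms(2,3)] ind_wts_card[OF assms(1)] by metis

lemma rel_bound_opposite:
  assumes "ind I \<in> wts" "ind J \<in> wts" "card I + card J = CARD('n)"
  shows "rel_bound wts 2"
proof -
  have "card (- I) = card J" using assms(3) by (simp add: Compl_eq_Diff_UNIV card_Diff_subset)
  then have "ind (- I) \<in> wts" using ind_wts_card[OF assms(2)] by simp
  moreover have "(\<Sum>b\<in>{False, True}. int 1 * ind (if b then I else - I) i) = 1" for i
    by (simp add: ind_def sum.insert del: sum_of_bool_eq)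
  ultimately have "rel_bound wts (card {False, True})"
    by (intro rel_boundI[where \<mu> = "\<lambda>b. ind (if b then I else - I)" and w = True and c = "\<lambda>_. 1" and k = 1])
      (simp_all add: assms(1))
  then show ?thesis by (simp add: numeral_2_eq_2)
qed

text \<open>The weight e_i + e_j - e_k replaces both e_i and e_j in the relation that the e_l sum to
  (1, ..., 1), which saves the term indexed by i; doubling e_k repairs the entry at k.\<close>

lemma rel_bound_triple:
  assumes ijk: "i \<noteq> j" "i \<noteq> k" "j \<noteq> k" and e: "\<And>l. ind {l} \<in> wts"
    and t: "shift_root (ind {i}) j k 1 \<in> wts"
  shows "rel_bound wts (CARD('n) - 1)"
proof -
  have "rel_bound wts (card (UNIV - {i}))"
  proof (rule rel_boundI[where \<mu> = "\<lambda>l. if l = j then shift_root (ind {i}) j k 1 else ind {l}"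
        and c = "\<lambda>l. if l = k then 2 else 1" and k = 1 and w = j])
    fix m
    have "(\<Sum>s\<in>UNIV - {i}. int (if s = k then 2 else 1) * (if s = j then shift_root (ind {i}) j k 1 else ind {s}) m)
      = (\<Sum>s\<in>UNIV - {i}. (if s = j then of_bool (m = i) + of_bool (m = j) - of_bool (m = k) else 0)
            + (if s = m then of_bool (m \<noteq> j) else 0) + (if s = k then of_bool (m = k) else 0))"
      using ijk by (intro sum.cong) (auto simp: shift_root_def ind_def)
    also have "\<dots> = 1"
      using ijk by (auto simp: sum.distrib)
    finally show "(\<Sum>s\<in>UNIV - {i}. int (if s = k then 2 else 1) *
         (if s = j then shift_root (ind {i}) j k 1 else ind {s}) m) = 1" .
  qed (use ijk e t in auto)
  then show ?thesis by (simp add: card_Diff_singleton)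
qed

lemma rel_bound_unit_vectors:
  assumes "\<And>l. ind {l} \<in> wts"
  shows "rel_bound wts CARD('n)"
  using rel_boundI[of UNIV "\<lambda>l. ind {l}" wts undefined "\<lambda>_. 1" 1] assms
  by (simp add: ind_def)

lemma rel_bound_swap:
  assumes "CARD('n) = 2" "\<mu> \<in> wts"
  shows "rel_bound wts 2"
proof -
  obtain a b :: 'n where ab: "UNIV = {a, b}" "a \<noteq> b" using assms(1) by (metis card_2_iff)
  have *: "\<mu> (Transposition.transpose a b i) + \<mu> i = \<mu> a + \<mu> b" for i
  proof -
    have "i = a \<or> i = b" using ab(1) by auto
    then show ?thesis by (auto simp: Transposition.transpose_def)
  qed
  have "rel_bound wts (card {False, True})"
    by (rule rel_boundI[where \<mu> = "\<lambda>c. if c then \<mu> else \<mu> \<circ> Transposition.transpose a b" and w = True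
          and c = "\<lambda>_. 1" and k = "\<mu> a + \<mu> b"])
      (use assms(2) wts_swap[OF assms(2)] * in auto)
  then show ?thesis by (simp add: numeral_2_eq_2)
qed

text \<open>Runs the balancing backwards: one move before e_a the weight is e_a + e_i - e_j up to a
  constant. For a = j this is e_i again; in the other cases a weight as in
  \<open>rel_bound_triple\<close> appears.\<close>

lemma unit_class_dichotomy:
  assumes N: "3 \<le> CARD('n)" and none: "\<And>I. ind I \<in> wts \<Longrightarrow> I \<noteq> UNIV \<Longrightarrow> card I = 1"
    and no_rel: "\<not> rel_bound wts (CARD('n) - 1)" and mu: "\<mu> \<in> wts"
  shows "\<exists>i c. \<mu> = (\<lambda>l. ind {i} l + c)"
proof -
  obtain I where I: "ind I \<in> wts" "card I = 1" using wts_reduction[OF mu] none by blast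
  then have e: "ind {l} \<in> wts" for l using ind_wts_card[of I "{l}"] by simp
  have no_triple: False if "shift_root (ind {i}) j k 1 \<in> wts" "i \<noteq> j" "i \<noteq> k" "j \<noteq> k" for i j k
    using rel_bound_triple[OF that(2-4) e that(1)] no_rel by simp
  show ?thesis
    using mu
  proof (induction rule: balance_induct)
    case (balance \<mu>)
    show ?case
    proof (cases "\<exists>i j. \<mu> j + 2 \<le> \<mu> i")
      case True
      then obtain i j where ij: "\<mu> j + 2 \<le> \<mu> i" by auto
      then have ne: "i \<noteq> j" by auto
      from balance(2)[OF ij] obtain a c where "shift_root \<mu> i j (-1) = (\<lambda>l. ind {a} l + c)" by auto
      then have "shift_root (shift_root \<mu> i j (-1)) i j 1 = shift_root (\<lambda>l. ind {a} l + c) i j 1" by simp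
      then have mu: "\<mu> = (\<lambda>l. shift_root (ind {a}) i j 1 l + c)"
        by (simp add: shift_root_add) (simp add: shift_root_def fun_eq_iff)
      with balance(1) have w: "shift_root (ind {a}) i j 1 \<in> wts" using wts_add_const by metis
      show ?thesis
      proof (cases "a = j")
        case True
        then have "\<mu> = (\<lambda>l. ind {i} l + c)"
          unfolding mu using ne by (auto simp: fun_eq_iff shift_root_def ind_def)
        then show ?thesis by blast
      next
        case aj: False
        show ?thesis
        proof (cases "a = i")
          case False with aj ne no_triple[OF w] show ?thesis by blast
        next
          case True
          \<comment> \<open>Up to a constant, \<mu> is 2 e_i - e_j. Moving a unit from i to a third
            index k gives e_i + e_k - e_j, which is excluded as well.\<close>
          have "card {i, j} < card (UNIV :: 'n set)" using N ne by simp
          then have "{i, j} \<noteq> UNIV" by auto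
          then obtain k where k: "k \<noteq> i" "k \<noteq> j" by auto
          have "shift_root (shift_root (ind {i}) i j 1) i k (-1) \<in> wts"
            by (rule wts_balance) (use w True k ne in \<open>auto simp: shift_root_def ind_def\<close>)
          also have "shift_root (shift_root (ind {i}) i j 1) i k (-1) = shift_root (ind {i}) k j 1"
            using k ne by (auto simp: shift_root_def ind_def fun_eq_iff)
          finally show ?thesis using no_triple k ne by blast
        qed
      qed
    next
      case False
    have "\<mu> i \<le> \<mu> j + 1" for i j
    proof (rule ccontr)
      assume "\<not> ?thesis"
      then have "\<mu> j + 2 \<le> \<mu> i" by linarith
      with False show False by blast
    qed
      then obtain I c where I: "I \<noteq> UNIV" "\<mu> = (\<lambda>i. ind I i + c)" using almost_constant by blast
      with balance(1) none wts_add_const have "card I = 1" by metis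
      with I(2) show ?thesis by (metis card_1_singletonE)
    qed
  qed
qed

end

section \<open>Symmetric powers\<close>

lemma linear_form_add: "linear_form (v + w) \<xi> = linear_form v \<xi> + linear_form w \<xi>"
  by (simp add: linear_form_def distrib_right sum.distrib)

lemma linear_form_scale: "linear_form (c *s v) \<xi> = c * linear_form v \<xi>"
  by (simp add: linear_form_def sum_distrib_left mult_ac)

lemma linear_form_0: "linear_form 0 \<xi> = 0"
  by (simp add: linear_form_def)

lemma linear_form_mult_vec: "linear_form w (transpose g *v \<xi>) = linear_form (g *v w) \<xi>" for g :: "complex ^ 'n ^ 'n"
  using fun_cong[OF sym_action_product[of g "\<lambda>_. w" "Suc 0"], of \<xi>] by (simp add: sym_action_def)

text \<open>Polarisation: the factors of a product are exchanged one by one, each time comparing the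
  coefficients of \<open>x\<close> in a power of \<open>m + x u\<close>.\<close>

lemma sym_power_subset_span_powers:
  "(sym_power k :: (complex ^ 'n \<Rightarrow> complex) set) \<subseteq> fun_space.span (range (\<lambda>m \<xi>. linear_form m \<xi> ^ k))"
proof -
  define W where "W = fun_space.span (range (\<lambda>m \<xi>. linear_form (m :: complex ^ 'n) \<xi> ^ k))"
  have W: "fun_space.subspace W" unfolding W_def by (rule fun_space.subspace_span)
  have "(\<lambda>\<xi>. (\<Prod>j<r. linear_form (v j) \<xi>) * linear_form m \<xi> ^ (k - r)) \<in> W"
    if "r \<le> k" for v :: "nat \<Rightarrow> complex ^ 'n" and m r
    using that
  proof (induction r arbitrary: m)
    case 0
    then show ?case by (auto simp: W_def intro: fun_space.span_base)
  next
    case (Suc r)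
    define d where "d = k - r"
    have d: "1 \<le> d" "k - Suc r = d - 1" using Suc.prems by (auto simp: d_def)
    define P where "P \<xi> = (\<Prod>j<r. linear_form (v j) \<xi>)" for \<xi>
    define w where "w i = (\<lambda>\<xi>. P \<xi> * (of_nat (d choose i) * linear_form (v r) \<xi> ^ i * linear_form m \<xi> ^ (d - i)))" for i
    have "(\<Sum>i\<le>d. fun_scale (x ^ i) (w i)) \<in> W" for x
    proof -
      have "(\<Sum>i\<le>d. fun_scale (x ^ i) (w i)) = (\<lambda>\<xi>. P \<xi> * linear_form (x *s v r + m) \<xi> ^ d)"
        by (simp add: fun_eq_iff sum_fun_apply fun_scale_def w_def linear_form_add linear_form_scale
            binomial_ring sum_distrib_left power_mult_distrib mult_ac)
      then show ?thesis using Suc.IH[of "x *s v r + m"] Suc.prems by (simp add: P_def d_def)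
    qed
    \<comment> \<open>The coefficient of x is d times the product in which one of the d = k - r
      factors m has become \<open>v r\<close>.\<close>
    from polynomial_coeffs_in_subspace[OF vector_space_fun_scale W this d(1)]
    have "fun_scale (1 / of_nat d) (w 1) \<in> W" using W by (simp add: fun_space.subspace_scale)
    also have "fun_scale (1 / of_nat d) (w 1) = (\<lambda>\<xi>. (\<Prod>j<Suc r. linear_form (v j) \<xi>) * linear_form m \<xi> ^ (k - Suc r))"
      using d by (simp add: fun_eq_iff fun_scale_def w_def P_def mult_ac)
    finally show ?case .
  qed
  from this[of k] have "range (\<lambda>v \<xi>. \<Prod>j<k. linear_form (v j :: complex ^ 'n) \<xi>) \<subseteq> W" by auto
  then show ?thesis unfolding sym_power_def W_def[symmetric] by (rule fun_space.span_minimal[OF _ W])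
qed

lemma tchar_shift_cancel:
  assumes "tchar (shift_root \<mu> i j (int m)) = tchar \<nu>" "i \<noteq> j"
  shows "tchar (shift_root \<nu> j i (int m)) = tchar \<mu>"
proof
  fix t
  show "tchar (shift_root \<nu> j i (int m)) t = tchar \<mu> t"
  proof (cases "t \<in> diag_torus")
    case False then show ?thesis by (simp add: tchar_def)
  next
    case True
    have "tchar \<nu> t = tchar \<mu> t * (t $ i $ i / t $ j $ j) ^ m"
      using fun_cong[OF assms(1), of t] tchar_shift_root[OF True assms(2)] by simp
    then show ?thesis
      using True assms(2) diag_torus_nonzero[OF True] by (simp add: tchar_shift_root power_divide)
  qed
qed

section \<open>Recognising a symmetric power by its top weight\<close>

locale irreducible_split_rep = split_rep smul \<rho>
  for smul :: "complex \<Rightarrow> 'v::ab_group_add \<Rightarrow> 'v" and \<rho> :: "complex ^ 'n ^ 'n \<Rightarrow> 'v \<Rightarrow> 'v" +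
  assumes nonzero: "\<exists>v::'v. v \<noteq> 0"
    and irreducible: "subspace W \<Longrightarrow> (\<And>g w. g \<in> SL \<Longrightarrow> w \<in> W \<Longrightarrow> \<rho> g w \<in> W) \<Longrightarrow> W = {0} \<or> W = UNIV"
begin

text \<open>With \<open>l\<close> a functional that extracts the component of weight \<open>k e\<^sub>a\<close>, the isomorphism sends \<open>w\<close> to the
  function \<open>\<xi> \<mapsto> l (h w)\<close>, where \<open>h \<in> SL\<close> is any matrix with row \<open>a\<close> equal to \<open>\<xi>\<close>.\<close>

lemma is_sym_power_of_top_weight:
  fixes a :: 'n and k :: nat
  defines "\<omega> \<equiv> \<lambda>l. if l = a then int k else 0"
  assumes N: "2 \<le> CARD('n)" and k: "1 \<le> k" and \<omega>: "\<omega> \<in> wts"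
    and high: "\<And>i j m. i \<noteq> a \<Longrightarrow> j \<noteq> i \<Longrightarrow> 0 < m \<Longrightarrow> shift_root \<omega> j i (int m) \<notin> wts"
  shows "is_sym_power k smul \<rho>"
proof -
  have tchar_top: "tchar \<omega> t = t $ a $ a ^ k" if "t \<in> diag_torus" for t
  proof -
    have "tchar \<omega> t = (\<Prod>i\<in>UNIV. t $ i $ i powi \<omega> i)" using that by (simp add: tchar_def)
    also have "\<dots> = (\<Prod>i\<in>UNIV. if i = a then t $ i $ i ^ k else 1)"
      by (intro prod.cong) (auto simp: \<omega>_def)
    finally show ?thesis by simp
  qed
  obtain v where v: "v \<in> wspace \<omega>" "v \<noteq> 0" using \<omega> by (auto simp: wts_def)
  \<comment> \<open>The sum of all other weight spaces; a functional that vanishes on it sees only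
    the component of weight \<omega>.\<close>
  define V' where "V' = (\<Union>\<nu>\<in>{\<nu>. tchar \<nu> \<noteq> tchar \<omega>}. wspace \<nu>)"
  have "v \<notin> span V'" using wspace_in_span[OF v] by (auto simp: V'_def)
  from separating_functional[OF vs this] obtain l where
    l: "Vector_Spaces.linear smul (*) l" "l v = 1" "\<forall>w\<in>span V'. l w = 0" by auto
  interpret l: Vector_Spaces.linear smul "(*)" l by fact
  have l0: "l w = 0" if "w \<in> wspace \<nu>" "tchar \<nu> \<noteq> tchar \<omega>" for w \<nu>
    using that l(3) span_base[of w V'] by (auto simp: V'_def)
  have in_span: "w \<in> span (\<Union>\<mu>. wspace \<mu>)" for w by (simp add: span_wspaces)
  have l_torus: "l (\<rho> t w) = tchar \<omega> t * l w" if t: "t \<in> diag_torus" for t w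
    using in_span[of w]
  proof (induction rule: span_induct_alt)
    case base then show ?case by (simp add: action_zero diag_torus_SL t l.zero)
  next
    case (step c x y)
    then obtain \<mu> where mu: "x \<in> wspace \<mu>" by auto
    then have "l (\<rho> t x) = tchar \<mu> t * l x" using t by (simp add: wspace_def l.scale)
    then have "l (\<rho> t x) = tchar \<omega> t * l x" using l0[OF mu] by (cases "tchar \<mu> = tchar \<omega>") auto
    with step show ?case
      by (simp add: action_add action_scale diag_torus_SL t l.add l.scale algebra_simps)
  qed
  have l_low: "l (\<rho> (transv i j x) w) = l w" if ij: "i \<noteq> a" "i \<noteq> j" for i j x w
    using in_span[of w]
  proof (induction rule: span_induct_alt)
    case base then show ?case by (simp add: action_zero transv_SL ij)
  next
    case (step c u y)
    then obtain \<mu> where mu: "u \<in> wspace \<mu>" by auto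
    from root_expansion[OF mu ij(2)] obtain d z where
      z: "\<forall>x. \<rho> (transv i j x) u = (\<Sum>k\<le>d. smul (x ^ k) (z k))" "z 0 = u"
        "\<forall>k. z k \<in> wspace (shift_root \<mu> i j (int k))" "\<forall>l m. z l = 0 \<longrightarrow> l \<le> m \<longrightarrow> z m = 0"
      by (elim exE conjE)
    have lz: "l (z m) = 0" if m: "0 < m" for m
    proof (rule ccontr)
      assume ne: "l (z m) \<noteq> 0"
      then have "z m \<noteq> 0" using l.zero by auto
      then have "u \<noteq> 0" using z(2,4) by (metis le0)
      then have "\<mu> \<in> wts" using mu by (auto simp: wts_def)
      moreover have "tchar (shift_root \<mu> i j (int m)) = tchar \<omega>" using l0[OF z(3)[rule_format]] ne by auto
      ultimately have "shift_root \<omega> j i (int m) \<in> wts"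
        using wts_cong[OF tchar_shift_cancel] ij(2) by blast
      with high[OF ij(1) ij(2)[symmetric] m] show False by simp
    qed
    have "l (\<rho> (transv i j x) u) = (\<Sum>k\<le>d. x ^ k * l (z k))"
      unfolding z(1)[rule_format] by (rule linear_functional_sum[OF l(1)])
    also have "\<dots> = (\<Sum>k\<le>d. if k = 0 then l u else 0)"
      using lz z(2) by (intro sum.cong) auto
    finally have "l (\<rho> (transv i j x) u) = l u" by simp
    with step show ?case
      by (simp add: action_add action_scale transv_SL ij l.add l.scale)
  qed
  have v_top: "\<rho> (transv a j x) v = v" if j: "j \<noteq> a" for j x
  proof -
    from root_expansion[OF v(1) j[symmetric]] obtain d z where
      z: "\<forall>x. \<rho> (transv a j x) v = (\<Sum>k\<le>d. smul (x ^ k) (z k))" "z 0 = v"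
        "\<forall>k. z k \<in> wspace (shift_root \<omega> a j (int k))"
      by (elim exE conjE)
    have "z m = 0" if "0 < m" for m
      using high[OF j j[symmetric] that] z(3) by (auto simp: wts_def)
    then have "\<rho> (transv a j x) v = (\<Sum>k\<le>d. if k = 0 then v else 0)"
      unfolding z(1)[rule_format] using z(2) by (intro sum.cong) auto
    then show ?thesis by simp
  qed
  have l_stab: "\<forall>w. l (\<rho> s w) = l w" if "s \<in> SL" "s $ a = axis a 1" for s
    using that
  proof (rule row_stabiliser_induct)
    fix A i j x assume "A \<in> SL" "i \<noteq> a" "i \<noteq> j" "\<forall>w. l (\<rho> (transv i j x ** A) w) = l w"
    then show "\<forall>w. l (\<rho> A w) = l w" by (simp add: action_mult transv_SL l_low)
  qed (simp add: l_torus tchar_top)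
  \<comment> \<open>No matrix in SL has row 0, so the value there is set by hand; 0 is the right
    value for forms of degree k \<ge> 1.\<close>
  define \<Phi> where "\<Phi> w \<xi> = (if \<xi> = 0 then 0 else l (\<rho> (SOME h. h \<in> SL \<and> h $ a = \<xi>) w))" for w and \<xi> :: "complex ^ 'n"
  have \<Phi>_row: "\<Phi> w (h $ a) = l (\<rho> h w)" if h: "h \<in> SL" for h w
  proof -
    define h' where "h' = (SOME h'. h' \<in> SL \<and> h' $ a = h $ a)"
    have h': "h' \<in> SL" "h' $ a = h $ a"
      using someI[of "\<lambda>h'. h' \<in> SL \<and> h' $ a = h $ a" h] h by (auto simp: h'_def)
    \<comment> \<open>Two matrices with the same row a differ by a left factor whose row a is the
      unit vector, and l is invariant under such factors.\<close>
    define s where "s = h' ** matrix_inv h"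
    have "s $ a = (h ** matrix_inv h) $ a" unfolding s_def mult_row h'(2) ..
    then have "s $ a = axis a 1" by (simp add: SL_inverse h vec_eq_iff mat_def axis_def)
    moreover have s: "s \<in> SL" using h h' by (simp add: s_def SL_mult SL_inverse)
    moreover have "s ** h = h'" by (simp add: s_def matrix_mul_assoc[symmetric] SL_inverse h)
    then have "\<rho> h' w = \<rho> s (\<rho> h w)" using action_mult[OF s h] by simp
    ultimately have "l (\<rho> h' w) = l (\<rho> h w)" using l_stab by simp
    then show ?thesis using SL_row_nonzero[OF h] by (simp add: \<Phi>_def h'_def)
  qed
  have \<Phi>_eq: "\<Phi> w = f" if "f 0 = 0" "\<And>h. h \<in> SL \<Longrightarrow> l (\<rho> h w) = f (h $ a)" for w and f :: "complex ^ 'n \<Rightarrow> complex"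
  proof
    fix \<xi> show "\<Phi> w \<xi> = f \<xi>"
    proof (cases "\<xi> = 0")
      case True with that(1) show ?thesis by (simp add: \<Phi>_def)
    next
      case False
      from exists_SL_row[OF N this, of a] obtain h where "h \<in> SL" "h $ a = \<xi>" by blast
      with that(2) \<Phi>_row show ?thesis by metis
    qed
  qed
  have \<Phi>_0: "\<Phi> w 0 = 0" for w by (simp add: \<Phi>_def)
  have \<Phi>_lin: "Vector_Spaces.linear smul fun_scale \<Phi>"
    unfolding Vector_Spaces.linear_iff
  proof (intro conjI allI vs vector_space_fun_scale)
    fix x y show "\<Phi> (x + y) = \<Phi> x + \<Phi> y"
      by (rule \<Phi>_eq) (simp_all add: \<Phi>_0 \<Phi>_row action_add l.add)
  next
    fix c x show "\<Phi> (smul c x) = fun_scale c (\<Phi> x)"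
      by (rule \<Phi>_eq) (simp_all add: \<Phi>_0 \<Phi>_row action_scale l.scale fun_scale_def)
  qed
  interpret \<Phi>: Vector_Spaces.linear smul fun_scale \<Phi> by (rule \<Phi>_lin)
  have \<Phi>_action: "\<Phi> (\<rho> g w) = sym_action g (\<Phi> w)" if g: "g \<in> SL" for g w
  proof (rule \<Phi>_eq)
    show "sym_action g (\<Phi> w) 0 = 0" by (simp add: sym_action_def \<Phi>_0)
    fix h :: "complex ^ 'n ^ 'n" assume h: "h \<in> SL"
    show "l (\<rho> h (\<rho> g w)) = sym_action g (\<Phi> w) (h $ a)"
      using \<Phi>_row[OF SL_mult[OF h g], of w] by (simp add: sym_action_def mult_row action_mult h g)
  qed
  have \<Phi>_v: "\<Phi> v = (\<lambda>\<xi>. (\<xi> $ a) ^ k)"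
  proof
    fix \<xi>
    \<comment> \<open>If \<xi> has a nonzero entry at a, the matrix with row \<xi> can be a torus
      element times a unipotent matrix fixing v.\<close>
    have gen: "\<Phi> v \<xi> = (\<xi> $ a) ^ k" if nz: "\<xi> $ a \<noteq> 0" for \<xi>
    proof -
      obtain t :: "complex ^ 'n ^ 'n" where t: "t \<in> diag_torus" "t $ a $ a = \<xi> $ a"
        using exists_torus_entry[OF N nz] by blast
      define U :: "complex ^ 'n ^ 'n" where
        "U = (\<chi> r c. of_bool (r = c) + (if r = a \<and> c \<in> UNIV - {a} then \<xi> $ c / \<xi> $ a else 0))"
      have U: "U \<in> SL \<and> \<rho> U v = v" unfolding U_def
        by (rule row_unipotent_induct) (auto simp: SL_one SL_mult transv_SL action_one action_mult v_top)
      have "(t ** U) $ a = \<xi>"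
        using nz t by (auto simp: vec_eq_iff diag_torus_mult_left U_def)
      then have "\<Phi> v \<xi> = l (\<rho> (t ** U) v)" using \<Phi>_row[of "t ** U" v] U t by (simp add: SL_mult diag_torus_SL)
      also have "\<dots> = (\<xi> $ a) ^ k" using U t l(2) by (simp add: action_mult diag_torus_SL l_torus tchar_top)
      finally show ?thesis .
    qed
    show "\<Phi> v \<xi> = (\<xi> $ a) ^ k"
    proof (cases "\<xi> $ a = 0")
      case False then show ?thesis by (rule gen)
    next
      case True
      show ?thesis
      proof (cases "\<xi> = 0")
        case True then show ?thesis using k by (simp add: \<Phi>_0)
      next
        case False
        from exists_SL_row[OF N this, of a] obtain h where h: "h \<in> SL" "h $ a = \<xi>" by blast
        obtain b where b: "\<xi> $ b \<noteq> 0" using False by (auto simp: vec_eq_iff)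
        with True have ba: "b \<noteq> a" by auto
        from root_expansion[OF v(1) ba] obtain d z where
          z: "\<forall>x. \<rho> (transv b a x) v = (\<Sum>k\<le>d. smul (x ^ k) (z k))" "z 0 = v"
          by (elim exE conjE)
        \<comment> \<open>Right multiplication by \<open>transv b a (y / \<xi> $ b)\<close> moves
          the row \<xi> along the axis a, so \<open>\<Phi> v\<close> is polynomial on this line. Off
          y = 0 it equals y^k, and continuity gives the value at 0.\<close>
        define q where "q y = (\<Sum>m\<le>d. (y / \<xi> $ b) ^ m * l (\<rho> h (z m)))" for y
        have q: "\<Phi> v (\<xi> + axis a y) = q y" for y
        proof -
          have "(h ** transv b a (y / \<xi> $ b)) $ a = \<xi> + axis a y"
            using b by (auto simp: vec_eq_iff mult_transv_entry h(2) axis_def)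
          then have "\<Phi> v (\<xi> + axis a y) = l (\<rho> h (\<rho> (transv b a (y / \<xi> $ b)) v))"
            using \<Phi>_row[of "h ** transv b a (y / \<xi> $ b)" v] h(1) ba
            by (simp add: SL_mult transv_SL action_mult)
          also have "\<dots> = q y"
            unfolding z(1)[rule_format] q_def
            by (simp add: action_sum action_scale h(1) linear_functional_sum[OF l(1)])
          finally show ?thesis .
        qed
        have "q y = y ^ k" if "y \<noteq> 0" for y
          using gen[of "\<xi> + axis a y"] q[of y] True that by simp
        then have "\<forall>\<^sub>F y in at 0. y ^ k = q y" by (simp add: eventually_at_filter)
        moreover have "((\<lambda>y. y ^ k) \<longlongrightarrow> 0 ^ k) (at (0 :: complex))" by (intro tendsto_intros)
        ultimately have "(q \<longlongrightarrow> 0 ^ k) (at 0)" by (rule Lim_transform_eventually[rotated])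
        moreover have "isCont q 0" unfolding q_def by (intro continuous_intros) (use b in auto)
        then have "(q \<longlongrightarrow> q 0) (at 0)" by (rule isContD)
        ultimately have "q 0 = 0 ^ k" using LIM_unique[of q "0 ^ k" 0 "q 0"] by simp
        moreover have "\<xi> + axis a 0 = \<xi>" by (simp add: vec_eq_iff axis_def)
        then have "\<Phi> v \<xi> = q 0" using q[of 0] by (simp only:)
        ultimately show ?thesis using True by simp
      qed
    qed
  qed
  \<comment> \<open>The orbit of v spans by irreducibility, and \<Phi> maps it to k-th powers of
    linear forms. Every nonzero linear form arises, so polarisation gives all of
    \<open>sym_power k\<close>.\<close>
  define G where "G = {\<rho> g v | g. g \<in> SL}"
  have vG: "v \<in> G" unfolding G_def using SL_one action_one[of v, symmetric] by blast
  have G: "span G = UNIV"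
  proof -
    have "span G = {0} \<or> span G = UNIV"
    proof (rule irreducible)
      fix g :: "complex ^ 'n ^ 'n" and w assume g: "g \<in> SL" "w \<in> span G"
      show "\<rho> g w \<in> span G"
      proof (rule action_span[OF g(1) _ g(2)])
        fix w assume "w \<in> G"
        then obtain h where h: "h \<in> SL" "w = \<rho> h v" by (auto simp: G_def)
        then have "\<rho> g w = \<rho> (g ** h) v" using g by (simp add: action_mult)
        then show "\<rho> g w \<in> span G" using SL_mult[OF g(1) h(1)] by (intro span_base) (auto simp: G_def)
      qed
    qed (rule subspace_span)
    then show ?thesis using span_base[OF vG] v(2) by auto
  qed
  have \<Phi>_G: "\<Phi> (\<rho> g v) = (\<lambda>\<xi>. linear_form (transpose g $ a) \<xi> ^ k)" if "g \<in> SL" for g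
    by (simp add: \<Phi>_action that \<Phi>_v sym_action_def fun_eq_iff linear_form_def matrix_vector_mult_def)
  have "range \<Phi> = sym_power k"
  proof -
    have "range \<Phi> = fun_space.span (\<Phi> ` G)" using \<Phi>.span_image[of G] G by simp
    also have "\<dots> = sym_power k"
    proof
      have "\<Phi> ` G \<subseteq> range (\<lambda>v \<xi>. \<Prod>j<k. linear_form (v j) \<xi>)"
      proof
        fix f assume "f \<in> \<Phi> ` G"
        then obtain g where "g \<in> SL" "f = \<Phi> (\<rho> g v)" by (auto simp: G_def)
        then have "f = (\<lambda>\<xi>. \<Prod>j<k. linear_form (transpose g $ a) \<xi>)" by (simp add: \<Phi>_G)
        then show "f \<in> range (\<lambda>v \<xi>. \<Prod>j<k. linear_form (v j) \<xi>)"
          using rangeI[of "\<lambda>v \<xi>. \<Prod>j<k. linear_form (v j :: complex ^ 'n) \<xi>" "\<lambda>_. transpose g $ a"] by simp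
      qed
      then show "fun_space.span (\<Phi> ` G) \<subseteq> sym_power k"
        unfolding sym_power_def by (rule fun_space.span_mono)
    next
      have "(\<lambda>\<xi>. linear_form m \<xi> ^ k) \<in> fun_space.span (\<Phi> ` G)" for m
      proof (cases "m = 0")
        case True
        then have "(\<lambda>\<xi>. linear_form m \<xi> ^ k) = 0" using k by (simp add: fun_eq_iff linear_form_0)
        then show ?thesis by (simp add: fun_space.span_zero)
      next
        case False
        from exists_SL_row[OF N this, of a] obtain h where h: "h \<in> SL" "h $ a = m" by blast
        then have "transpose h \<in> SL" by (simp add: SL_def)
        then have "\<Phi> (\<rho> (transpose h) v) \<in> \<Phi> ` G" unfolding G_def by blast
        moreover have "\<Phi> (\<rho> (transpose h) v) = (\<lambda>\<xi>. linear_form m \<xi> ^ k)"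
          using \<Phi>_G[OF \<open>transpose h \<in> SL\<close>] h by simp
        ultimately show ?thesis by (metis fun_space.span_base)
      qed
      then have "fun_space.span (range (\<lambda>m \<xi>. linear_form m \<xi> ^ k)) \<subseteq> fun_space.span (\<Phi> ` G)"
        by (intro fun_space.span_minimal) auto
      then show "sym_power k \<subseteq> fun_space.span (\<Phi> ` G)" using sym_power_subset_span_powers by blast
    qed
    finally show ?thesis .
  qed
  moreover have "inj \<Phi>"
  proof -
    have "{w. \<Phi> w = 0} = {0} \<or> {w. \<Phi> w = 0} = UNIV"
    proof (rule irreducible)
      show "subspace {w. \<Phi> w = 0}" by (rule \<Phi>.subspace_kernel)
      fix g :: "complex ^ 'n ^ 'n" and w assume "g \<in> SL" "w \<in> {w. \<Phi> w = 0}"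
      then show "\<rho> g w \<in> {w. \<Phi> w = 0}" by (simp add: \<Phi>_action sym_action_def fun_eq_iff)
    qed
    moreover have "\<Phi> v \<noteq> 0"
    proof
      assume "\<Phi> v = 0"
      then have "\<Phi> v (axis a 1) = 0" by simp
      then show False by (simp add: \<Phi>_v)
    qed
    ultimately show ?thesis using \<Phi>.inj_iff_eq_0 by blast
  qed
  ultimately show ?thesis
    unfolding is_sym_power_def rep_iso_def bij_betw_def using \<Phi>_lin \<Phi>_action by blast
qed

end

lemma is_standard_of_sym_power_1:
  fixes \<rho> :: "complex ^ 'n ^ 'n \<Rightarrow> 'v::ab_group_add \<Rightarrow> 'v"
  assumes "is_sym_power 1 smul \<rho>"
  shows "is_standard smul \<rho>"
proof -
  have "sym_power 1 = range (linear_form :: complex ^ 'n \<Rightarrow> _)"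
  proof -
    have "range (\<lambda>v \<xi>. \<Prod>j<(1::nat). linear_form (v j :: complex ^ 'n) \<xi>) = range linear_form"
    proof -
      have *: "(\<lambda>\<xi>. \<Prod>j<(1::nat). linear_form (v j) \<xi>) = linear_form (v 0)" for v :: "nat \<Rightarrow> complex ^ 'n"
        by (simp add: fun_eq_iff lessThan_Suc)
      have "range (\<lambda>v. linear_form (v (0::nat))) = range (linear_form :: complex ^ 'n \<Rightarrow> _)"
        using surjI[of "\<lambda>v :: nat \<Rightarrow> complex ^ 'n. v 0" "\<lambda>x _. x"] by (metis image_image)
      then show ?thesis unfolding * .
    qed
    moreover have "fun_space.subspace (range (linear_form :: complex ^ 'n \<Rightarrow> _))"
    proof (rule fun_space.subspaceI)
      show "0 \<in> range (linear_form :: complex ^ 'n \<Rightarrow> _)"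
        by (rule range_eqI[of _ _ 0]) (simp add: fun_eq_iff linear_form_0)
      fix x y assume "x \<in> range (linear_form :: complex ^ 'n \<Rightarrow> _)" "y \<in> range (linear_form :: complex ^ 'n \<Rightarrow> _)"
      then obtain v w where "x = linear_form v" "y = linear_form (w :: complex ^ 'n)" by blast
      then show "x + y \<in> range (linear_form :: complex ^ 'n \<Rightarrow> _)"
        by (intro range_eqI[of _ _ "v + w"]) (simp add: fun_eq_iff linear_form_add)
    next
      fix c x assume "x \<in> range (linear_form :: complex ^ 'n \<Rightarrow> _)"
      then obtain v where "x = linear_form (v :: complex ^ 'n)" by blast
      then show "fun_scale c x \<in> range (linear_form :: complex ^ 'n \<Rightarrow> _)"
        by (intro range_eqI[of _ _ "c *s v"]) (simp add: fun_eq_iff linear_form_scale fun_scale_def)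
    qed
    ultimately show ?thesis unfolding sym_power_def by (simp add: fun_space.span_eq_iff)
  qed
  with assms obtain \<phi> where phi: "Vector_Spaces.linear smul fun_scale \<phi>"
    "bij_betw \<phi> UNIV (range (linear_form :: complex ^ 'n \<Rightarrow> _))" "\<forall>g\<in>SL. \<forall>v. \<phi> (\<rho> g v) = sym_action g (\<phi> v)"
    unfolding is_sym_power_def rep_iso_def by auto
  interpret phi: Vector_Spaces.linear smul fun_scale \<phi> by fact
  define ev where "ev f = (\<chi> i. f (axis i 1))" for f :: "complex ^ 'n \<Rightarrow> complex"
  have ev: "ev (linear_form v) = v" for v
    by (simp add: ev_def vec_eq_iff linear_form_def axis_def if_distrib[where f = "\<lambda>y. _ * y"] cong: if_cong)
  have phi_ev: "linear_form (ev (\<phi> v)) = \<phi> v" for v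
  proof -
    have "\<phi> v \<in> range linear_form" using phi(2) by (auto simp: bij_betw_def)
    then show ?thesis using ev by auto
  qed
  have "Vector_Spaces.linear smul (*s) (ev \<circ> \<phi>)"
    unfolding Vector_Spaces.linear_iff
    using phi(1)[unfolded Vector_Spaces.linear_iff] vec.vector_space_axioms
    by (intro conjI allI)
      (simp_all add: phi.add phi.scale ev_def vec_eq_iff fun_scale_def)
  moreover have "bij_betw (ev \<circ> \<phi>) UNIV UNIV"
  proof (rule bij_betw_trans[OF phi(2)])
    show "bij_betw ev (range linear_form) UNIV"
      by (rule bij_betw_byWitness[of _ linear_form]) (auto simp: ev)
  qed
  moreover have "(ev \<circ> \<phi>) (\<rho> g v) = g *v (ev \<circ> \<phi>) v" if "g \<in> SL" for g v
  proof -
    have "\<phi> (\<rho> g v) = sym_action g (linear_form (ev (\<phi> v)))" using phi(3) that phi_ev by simp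
    also have "\<dots> = linear_form (g *v ev (\<phi> v))"
      unfolding sym_action_def linear_form_mult_vec ..
    finally show ?thesis by (simp add: ev)
  qed
  ultimately show ?thesis unfolding is_standard_def rep_iso_def by blast
qed

section \<open>Algebraic representations and the contragredient\<close>

lemma tchar_ind: "t \<in> diag_torus \<Longrightarrow> tchar (ind {i}) t = t $ i $ i"
proof -
  assume t: "t \<in> diag_torus"
  have "(\<Prod>l\<in>UNIV. t $ l $ l powi ind {i} l) = (\<Prod>l\<in>UNIV. if l = i then t $ l $ l else 1)"
    by (intro prod.cong) (auto simp: ind_def)
  then show ?thesis using t by (simp add: tchar_def)
qed

lemma tchar_span_mult:
  assumes "f \<in> fun_space.span (range tchar)" "g \<in> fun_space.span (range tchar)"
  shows "(\<lambda>A. f A * g A) \<in> fun_space.span (range tchar)"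
  using assms(1)
proof (induction rule: fun_space.span_induct_alt)
  case base
  have "(\<lambda>A. (0 :: complex ^ 'a ^ 'a \<Rightarrow> complex) A * g A) = 0" by (simp add: fun_eq_iff)
  then show ?case by (simp add: fun_space.span_zero)
next
  case (step c x y)
  then obtain \<mu> where mu: "x = tchar \<mu>" by auto
  have "(\<lambda>A. tchar \<mu> A * g A) \<in> fun_space.span (range tchar)"
    using assms(2)
  proof (induction rule: fun_space.span_induct_alt)
    case base
    have "(\<lambda>A. tchar \<mu> A * (0 :: complex ^ 'a ^ 'a \<Rightarrow> complex) A) = 0" by (simp add: fun_eq_iff)
    then show ?case by (simp add: fun_space.span_zero)
  next
    case (step d u w)
    then obtain \<nu> where nu: "u = tchar \<nu>" by auto
    have "(\<lambda>A. tchar \<mu> A * (fun_scale d u + w) A) =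
        fun_scale d (tchar (\<lambda>i. \<mu> i + \<nu> i)) + (\<lambda>A. tchar \<mu> A * w A)"
      by (rule ext, rename_tac A, case_tac "A \<in> diag_torus")
        (simp_all add: nu fun_scale_def tchar_add algebra_simps, simp add: tchar_def)
    with step.IH show ?case
      by (simp add: fun_space.span_add fun_space.span_scale fun_space.span_base)
  qed
  moreover have "(\<lambda>A. (fun_scale c x + y) A * g A) = fun_scale c (\<lambda>A. tchar \<mu> A * g A) + (\<lambda>A. y A * g A)"
    by (simp add: fun_eq_iff mu fun_scale_def algebra_simps)
  ultimately show ?case using step.IH by (simp add: fun_space.span_add fun_space.span_scale)
qed

text \<open>On the torus, diagonal entries are characters and the other entries vanish; products of
  characters are characters, so their span is an algebra.\<close>

lemma matrix_poly_torus:
  fixes p :: "complex ^ 'n ^ 'n \<Rightarrow> complex"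
  assumes "p \<in> matrix_polys"
  shows "(\<lambda>A. if A \<in> diag_torus then p A else 0) \<in> fun_space.span (range tchar)"
  using assms
proof (induction rule: matrix_polys.induct)
  case (const c)
  have "(\<lambda>A. if A \<in> diag_torus then c else 0) = fun_scale c (tchar (\<lambda>_. 0))"
    by (simp add: fun_eq_iff fun_scale_def tchar_def)
  also have "\<dots> \<in> fun_space.span (range tchar)"
    by (intro fun_space.span_scale fun_space.span_base rangeI)
  finally show ?case .
next
  case (entry i j)
  show ?case
  proof (cases "i = j")
    case False
    then have "(\<lambda>A. if A \<in> diag_torus then A $ i $ j else 0) = 0"
      by (simp add: fun_eq_iff diag_torus_off_diag)
    then show ?thesis by (simp add: fun_space.span_zero)
  next
    case True
    have "A $ i $ i = tchar (ind {i}) A" if "A \<in> diag_torus" for A :: "complex ^ 'n ^ 'n"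
      by (simp add: tchar_ind that)
    then have "(\<lambda>A. if A \<in> diag_torus then A $ i $ j else 0) = tchar (ind {i})"
      using True by (simp add: fun_eq_iff tchar_def)
    then show ?thesis by (simp add: fun_space.span_base)
  qed
next
  case (add p q)
  have "(\<lambda>A. if A \<in> diag_torus then p A + q A else 0) =
      (\<lambda>A. if A \<in> diag_torus then p A else 0) + (\<lambda>A. if A \<in> diag_torus then q A else 0)"
    by (simp add: fun_eq_iff)
  with add show ?case by (simp add: fun_space.span_add)
next
  case (mult p q)
  have "(\<lambda>A. if A \<in> diag_torus then p A * q A else 0) =
      (\<lambda>A. (if A \<in> diag_torus then p A else 0) * (if A \<in> diag_torus then q A else 0))"
    by (simp add: fun_eq_iff)
  with tchar_span_mult[OF mult.IH] show ?case by simp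
qed

lemma matrix_poly_transv:
  assumes "p \<in> matrix_polys"
  shows "\<exists>q. \<forall>x. p (transv i j x) = poly q x"
  using assms
proof (induction rule: matrix_polys.induct)
  case (const c)
  show ?case by (rule exI[of _ "[:c:]"]) simp
next
  case (entry k l)
  show ?case
    by (rule exI[of _ "if k = i \<and> l = j then [:of_bool (k = l), 1:] else [:of_bool (k = l):]"])
      (auto simp: transv_def)
next
  case (add p q)
  then show ?case by (metis poly_add)
next
  case (mult p q)
  then show ?case by (metis poly_mult)
qed

lemma poly_as_sum_le:
  fixes q :: "complex poly"
  assumes "degree q \<le> d"
  shows "poly q x = (\<Sum>k\<le>d. x ^ k * coeff q k)"
proof -
  have "poly q x = (\<Sum>k\<le>degree q. coeff q k * x ^ k)" by (rule poly_altdef)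
  also have "\<dots> = (\<Sum>k\<le>d. coeff q k * x ^ k)"
    using assms by (intro sum.mono_neutral_left) (auto simp: coeff_eq_0)
  finally show ?thesis by (simp add: mult.commute)
qed

section \<open>Weight decomposition of algebraic representations\<close>

context SL_rep
begin

lemma finite_coordinates:
  shows "\<exists>B f. finite B \<and> (\<forall>b. Vector_Spaces.linear smul (*) (f b)) \<and> (\<forall>w. w = (\<Sum>b\<in>B. smul (f b w) b))"
proof -
  obtain B0 where B0: "finite B0" "span B0 = UNIV" using finite_dim by auto
  obtain B where B: "B \<subseteq> B0" "independent B" "B0 \<subseteq> span B" by (rule maximal_independent_subset)
  have sB: "span B = UNIV" using B B0 span_mono[OF B(3)] by (auto simp: span_span)
  have fB: "finite B" using finite_subset[OF B(1) B0(1)] .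
  show ?thesis
  proof (intro exI[of _ B] exI[of _ "\<lambda>b w. representation B w b"] conjI allI fB)
    show "Vector_Spaces.linear smul (*) (\<lambda>w. representation B w b)" for b
      by (rule linear_representation[OF B(2) sB])
    show "w = (\<Sum>b\<in>B. smul (representation B w b) b)" for w
      by (rule sum_representation_eq[symmetric, OF B(2) _ fB order_refl]) (simp add: sB)
  qed
qed

lemma torus_expansion:
  shows "\<exists>(S :: (complex ^ 'n ^ 'n \<Rightarrow> complex) set) w. finite S \<and> S \<subseteq> range tchar \<and>
    (\<forall>t\<in>diag_torus. \<rho> t v = (\<Sum>h\<in>S. smul (h t) (w h)))"
proof -
  obtain B f where fc: "finite B" "\<forall>b. Vector_Spaces.linear smul (*) (f b)"
      "\<forall>w. w = (\<Sum>b\<in>B. smul (f b w) b)"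
    using finite_coordinates by (elim exE conjE)
  note B = fc(1) fc(2)[rule_format] fc(3)[rule_format]
  define g where "g b t = (if t \<in> diag_torus then f b (\<rho> t v) else 0)" for b t
  have "g b \<in> fun_space.span (range tchar)" for b
  proof -
    from algebraic[OF B(2), of b v] obtain p where p: "p \<in> matrix_polys" "\<forall>A\<in>SL. f b (\<rho> A v) = p A"
      by (auto simp: regular_on_def)
    then have "g b = (\<lambda>A. if A \<in> diag_torus then p A else 0)"
      by (auto simp: g_def diag_torus_SL fun_eq_iff)
    with matrix_poly_torus[OF p(1)] show ?thesis by simp
  qed
  then have "\<exists>S. finite S \<and> S \<subseteq> range tchar \<and> g b \<in> fun_space.span S" for b
    unfolding fun_space.span_explicit by fastforce
  then obtain S where S: "\<And>b. finite (S b)" "\<And>b. S b \<subseteq> range tchar" "\<And>b. g b \<in> fun_space.span (S b)"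
    by metis
  define S' where "S' = (\<Union>b\<in>B. S b)"
  have fS: "finite S'" using B(1) S(1) by (simp add: S'_def)
  have "\<exists>u. g b = (\<Sum>h\<in>S'. fun_scale (u h) h)" if "b \<in> B" for b
  proof -
    have "g b \<in> fun_space.span S'"
      using S(3)[of b] fun_space.span_mono[of "S b" S'] that by (auto simp: S'_def)
    then show ?thesis unfolding fun_space.span_finite[OF fS] by auto
  qed
  then have "\<exists>u. \<forall>b\<in>B. g b = (\<Sum>h\<in>S'. fun_scale (u b h) h)" by (intro bchoice ballI)
  then obtain u where u: "\<forall>b\<in>B. g b = (\<Sum>h\<in>S'. fun_scale (u b h) h)" by (elim exE)
  have "\<rho> t v = (\<Sum>h\<in>S'. smul (h t) (\<Sum>b\<in>B. smul (u b h) b))" if t: "t \<in> diag_torus" for t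
  proof -
    have "\<rho> t v = (\<Sum>b\<in>B. smul (g b t) b)" using B(3)[of "\<rho> t v"] t by (simp add: g_def)
    also have "\<dots> = (\<Sum>b\<in>B. smul (\<Sum>h\<in>S'. u b h * h t) b)"
      by (intro sum.cong refl) (simp add: u sum_fun_apply fun_scale_def)
    also have "\<dots> = (\<Sum>h\<in>S'. smul (h t) (\<Sum>b\<in>B. smul (u b h) b))"
      by (simp add: scale_sum_left scale_sum_right, subst sum.swap) (simp add: mult.commute)
    finally show ?thesis .
  qed
  moreover have "S' \<subseteq> range tchar" using S(2) by (auto simp: S'_def)
  ultimately show ?thesis using fS by (intro exI[of _ S'] exI[of _ "\<lambda>h. \<Sum>b\<in>B. smul (u b h) b"]) simp
qed

text \<open>Expanding \<open>\<rho> (s ** t) v\<close> as a combination of characters of t in two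
  ways and using their independence shows that the coefficient vectors \<open>w h\<close> are weight
  vectors; at t = 1 they sum to v. Along a root subgroup, the coordinates of the orbit map are
  polynomials in x.\<close>

lemma split_rep: "split_rep smul \<rho>"
proof (intro split_rep.intro split_rep_axioms.intro vector_space_axioms)
  show "\<exists>B. finite B \<and> span B = UNIV" by (rule finite_dim)
  show "Vector_Spaces.linear smul smul (\<rho> g)" if "g \<in> SL" for g by (rule linear_action[OF that])
  show "\<rho> (mat 1) v = v" for v by (rule action_one)
  show "\<rho> (g ** h) v = \<rho> g (\<rho> h v)" if "g \<in> SL" "h \<in> SL" for g h v by (rule action_mult[OF that])
  have vs: "vector_space smul" by (rule vector_space_axioms)
  show "span {v. \<exists>\<mu>. \<forall>t\<in>diag_torus. \<rho> t v = smul (tchar \<mu> t) v} = UNIV"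
  proof -
    have "v \<in> span {v. \<exists>\<mu>. \<forall>t\<in>diag_torus. \<rho> t v = smul (tchar \<mu> t) v}" for v
    proof -
      obtain S :: "(complex ^ 'n ^ 'n \<Rightarrow> complex) set" and w where te: "finite S" "S \<subseteq> range tchar"
        "\<forall>t\<in>diag_torus. \<rho> t v = (\<Sum>h\<in>S. smul (h t) (w h))"
        using torus_expansion[of v] by (elim exE conjE)
      note S = te(1,2) te(3)[rule_format]
      have wt: "\<rho> s (w h) = smul (h s) (w h)" if h: "h \<in> S" and s: "s \<in> diag_torus" for h s
      proof (rule ccontr)
        assume "\<not> ?thesis"
        then have "\<rho> s (w h) - smul (h s) (w h) \<noteq> 0" by simp
        from separating_functional_0[OF vs this] obtain f where
          f: "Vector_Spaces.linear smul (*) f" "f (\<rho> s (w h) - smul (h s) (w h)) = 1" by auto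
        interpret f: Vector_Spaces.linear smul "(*)" f by fact
        interpret r: Vector_Spaces.linear smul smul "\<rho> s" by (rule linear_action[OF diag_torus_SL[OF s]])
        have "\<forall>h\<in>S. f (\<rho> s (w h) - smul (h s) (w h)) = 0"
        proof (rule multiplicative_coeffs_zero[where T = diag_torus and m = "(**)" and e = "mat 1", OF S(1)])
          show "\<forall>h\<in>S. multiplicative_on diag_torus (**) (mat 1) h"
            using S(2) multiplicative_tchar by auto
          fix t :: "complex ^ 'n ^ 'n" assume t: "t \<in> diag_torus"
          have "(\<Sum>h\<in>S. smul (h t) (\<rho> s (w h))) = \<rho> s (\<rho> t v)" by (simp add: S(3)[OF t] r.sum r.scale)
          also have "\<dots> = \<rho> (s ** t) v" using action_mult s t by (simp add: diag_torus_SL)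
          also have "\<dots> = (\<Sum>h\<in>S. smul (h (s ** t)) (w h))" by (rule S(3)[OF diag_torus_mult[OF s t]])
          also have "\<dots> = (\<Sum>h\<in>S. smul (h t) (smul (h s) (w h)))"
            using S(2) tchar_mult[OF s t] by (intro sum.cong) (auto simp: mult.commute)
          finally have "(\<Sum>h\<in>S. smul (h t) (\<rho> s (w h) - smul (h s) (w h))) = 0"
            by (simp add: scale_right_diff_distrib sum_subtractf)
          then have "f (\<Sum>h\<in>S. smul (h t) (\<rho> s (w h) - smul (h s) (w h))) = 0" by (simp add: f.zero)
          then show "(\<Sum>h\<in>S. f (\<rho> s (w h) - smul (h s) (w h)) * h t) = 0"
            by (simp add: linear_functional_sum[OF f(1)] mult.commute)
        qed (auto simp: diag_torus_one diag_torus_mult)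
        with f(2) h show False by simp
      qed
      have "v = \<rho> (mat 1) v" by (simp add: action_one)
      also have "\<dots> = (\<Sum>h\<in>S. w h)"
        unfolding S(3)[OF diag_torus_one] using S(2) by (intro sum.cong) (auto simp: tchar_one)
      also have "\<dots> \<in> span {v. \<exists>\<mu>. \<forall>t\<in>diag_torus. \<rho> t v = smul (tchar \<mu> t) v}"
      proof (intro span_sum span_base CollectI)
        fix h assume h: "h \<in> S"
        then obtain \<mu> where "h = tchar \<mu>" using S(2) by auto
        with wt[OF h] show "\<exists>\<mu>. \<forall>t\<in>diag_torus. \<rho> t (w h) = smul (tchar \<mu> t) (w h)" by auto
      qed
      finally show ?thesis .
    qed
    then show ?thesis by auto
  qed
  show "\<exists>d w. \<forall>x. \<rho> (transv i j x) v = (\<Sum>k\<le>d. smul (x ^ k) (w k))" if ij: "i \<noteq> j" for i j v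
  proof -
    obtain B f where fc: "finite B" "\<forall>b. Vector_Spaces.linear smul (*) (f b)"
        "\<forall>w. w = (\<Sum>b\<in>B. smul (f b w) b)"
      using finite_coordinates by (elim exE conjE)
    note B = fc(1) fc(2)[rule_format] fc(3)[rule_format]
    have "\<exists>q. \<forall>x. f b (\<rho> (transv i j x) v) = poly q x" for b
    proof -
      from algebraic[OF B(2), of b v] obtain p where "p \<in> matrix_polys" "\<forall>A\<in>SL. f b (\<rho> A v) = p A"
        by (auto simp: regular_on_def)
      with matrix_poly_transv[of p i j] transv_SL[OF ij] show ?thesis by metis
    qed
    then obtain q where q: "\<And>b x. f b (\<rho> (transv i j x) v) = poly (q b) x" by metis
    define d where "d = (\<Sum>b\<in>B. degree (q b))"
    have d: "degree (q b) \<le> d" if "b \<in> B" for b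
      unfolding d_def using B(1) that by (intro member_le_sum) auto
    have "\<rho> (transv i j x) v = (\<Sum>k\<le>d. smul (x ^ k) (\<Sum>b\<in>B. smul (coeff (q b) k) b))" for x
    proof -
      have "\<rho> (transv i j x) v = (\<Sum>b\<in>B. smul (\<Sum>k\<le>d. x ^ k * coeff (q b) k) b)"
        using B(3)[of "\<rho> (transv i j x) v"] by (simp add: q poly_as_sum_le[OF d])
      also have "\<dots> = (\<Sum>k\<le>d. smul (x ^ k) (\<Sum>b\<in>B. smul (coeff (q b) k) b))"
        by (simp add: scale_sum_left scale_sum_right, subst sum.swap) simp
      finally show ?thesis .
    qed
    then show ?thesis by (intro exI[of _ d] exI[of _ "\<lambda>k. \<Sum>b\<in>B. smul (coeff (q b) k) b"] allI)
  qed
qed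

end

section \<open>The twist by inverse transposition\<close>

definition inv_transpose :: "complex ^ 'n ^ 'n \<Rightarrow> complex ^ 'n ^ 'n" where
  "inv_transpose g = transpose (matrix_inv g)"

lemma matrix_inv_eqI:
  assumes "A \<in> SL" "A ** B = mat 1" shows "matrix_inv A = B"
  using SL_inverse[OF assms(1)] assms(2) by (metis matrix_mul_assoc matrix_mul_lid matrix_mul_rid)

lemma inv_transpose_SL: "g \<in> SL \<Longrightarrow> inv_transpose g \<in> SL"
  using SL_inverse(3)[of g] by (simp add: inv_transpose_def SL_def)

lemma inv_transpose_mult:
  assumes "g \<in> SL" "h \<in> SL" shows "inv_transpose (g ** h) = inv_transpose g ** inv_transpose h"
proof -
  have "(g ** h) ** (matrix_inv h ** matrix_inv g) = g ** (h ** matrix_inv h) ** matrix_inv g"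
    by (simp add: matrix_mul_assoc)
  then have "matrix_inv (g ** h) = matrix_inv h ** matrix_inv g"
    using assms by (intro matrix_inv_eqI SL_mult) (simp_all add: SL_inverse)
  then show ?thesis by (simp add: inv_transpose_def matrix_transpose_mul)
qed

lemma inv_transpose_involution:
  assumes "g \<in> SL" shows "inv_transpose (inv_transpose g) = g"
proof -
  have "inv_transpose g ** transpose g = mat 1"
    by (simp add: inv_transpose_def matrix_transpose_mul[symmetric] SL_inverse[OF assms] transpose_mat)
  then have "matrix_inv (inv_transpose g) = transpose g" by (rule matrix_inv_eqI[OF inv_transpose_SL[OF assms]])
  then show ?thesis by (simp add: inv_transpose_def)
qed

lemma inv_transpose_eqI:
  assumes "A \<in> SL" "A ** B = mat 1" shows "inv_transpose A = transpose B"
  by (simp add: inv_transpose_def matrix_inv_eqI[OF assms])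

lemma inv_transpose_one: "inv_transpose (mat 1) = mat 1"
  using inv_transpose_eqI[OF SL_one, of "mat 1"] by (simp add: transpose_mat)

lemma inv_transpose_transv: "i \<noteq> j \<Longrightarrow> inv_transpose (transv i j x) = transv j i (- x)"
  by (subst inv_transpose_eqI[OF transv_SL, of _ _ _ "transv i j (- x)"])
    (auto simp: transv_add transv_0, auto simp: transpose_def transv_def vec_eq_iff)

lemma inv_transpose_torus:
  assumes t: "t \<in> diag_torus"
  shows "inv_transpose t \<in> diag_torus" "inv_transpose t $ i $ i = inverse (t $ i $ i)"
proof -
  have d: "diag_mat (\<lambda>i. inverse (t $ i $ i)) \<in> diag_torus"
    using prod_inversef[of "\<lambda>i. t $ i $ i" UNIV] diag_torus_prod[OF t] by (intro diag_mat_torus) (simp add: o_def)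
  have "t ** diag_mat (\<lambda>i. inverse (t $ i $ i)) = mat 1"
    using diag_torus_nonzero[OF t] by (auto simp: vec_eq_iff diag_torus_mult_left[OF t] diag_mat_entry mat_def)
  then have "inv_transpose t = transpose (diag_mat (\<lambda>i. inverse (t $ i $ i)))"
    by (rule inv_transpose_eqI[OF diag_torus_SL[OF t]])
  also have "\<dots> = diag_mat (\<lambda>i. inverse (t $ i $ i))" by (auto simp: transpose_def diag_mat_def vec_eq_iff)
  finally show "inv_transpose t \<in> diag_torus" "inv_transpose t $ i $ i = inverse (t $ i $ i)"
    using d by (simp_all add: diag_mat_entry)
qed

lemma tchar_inv_transpose:
  assumes "t \<in> diag_torus" shows "tchar \<mu> (inv_transpose t) = tchar (\<lambda>i. - \<mu> i) t"
  by (simp add: tchar_def assms inv_transpose_torus[OF assms] power_int_minus power_int_inverse)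

context split_rep
begin

text \<open>Inverse transposition inverts the torus and sends \<open>transv i j x\<close> to
  \<open>transv j i (- x)\<close>, so the twisted action on the same space has the negated weights
  and again polynomial root subgroups.\<close>

lemma split_rep_contra: "split_rep smul (\<lambda>g. \<rho> (inv_transpose g))"
proof (intro split_rep.intro split_rep_axioms.intro vector_space_axioms)
  show "\<exists>B. finite B \<and> span B = UNIV" by (rule finite_dim)
  show "Vector_Spaces.linear smul smul (\<rho> (inv_transpose g))" if "g \<in> SL" for g by (rule linear_action[OF inv_transpose_SL[OF that]])
  show "\<rho> (inv_transpose (mat 1)) v = v" for v by (simp add: inv_transpose_one action_one)
  show "\<rho> (inv_transpose (g ** h)) v = \<rho> (inv_transpose g) (\<rho> (inv_transpose h) v)" if "g \<in> SL" "h \<in> SL" for g h v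
    using that by (simp add: inv_transpose_mult action_mult inv_transpose_SL)
  have "wspace \<mu> \<subseteq> {v. \<exists>\<mu>. \<forall>t\<in>diag_torus. \<rho> (inv_transpose t) v = smul (tchar \<mu> t) v}" for \<mu>
    by (auto simp: wspace_def inv_transpose_torus tchar_inv_transpose intro!: exI[of _ "\<lambda>i. - \<mu> i"])
  then have "span (\<Union>\<mu>. wspace \<mu>) \<subseteq> span {v. \<exists>\<mu>. \<forall>t\<in>diag_torus. \<rho> (inv_transpose t) v = smul (tchar \<mu> t) v}"
    by (intro span_mono) blast
  then show "span {v. \<exists>\<mu>. \<forall>t\<in>diag_torus. \<rho> (inv_transpose t) v = smul (tchar \<mu> t) v} = UNIV"
    using span_wspaces by auto
  show "\<exists>d w. \<forall>x. \<rho> (inv_transpose (transv i j x)) v = (\<Sum>k\<le>d. smul (x ^ k) (w k))" if ij: "i \<noteq> j" for i j v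
  proof -
    obtain d w where "\<forall>x. \<rho> (transv j i x) v = (\<Sum>k\<le>d. smul (x ^ k) (w k))"
      using root_poly[OF ij[symmetric], of v] by blast
    then have "\<rho> (inv_transpose (transv i j x)) v = (\<Sum>k\<le>d. smul (x ^ k) (smul ((- 1) ^ k) (w k)))" for x
      by (simp add: inv_transpose_transv ij power_minus[of x] mult.commute)
    then show ?thesis by (intro exI[of _ d] exI[of _ "\<lambda>k. smul ((- 1) ^ k) (w k)"] allI)
  qed
qed

lemma wts_contra: "\<mu> \<in> split_rep.wts smul (\<lambda>g. \<rho> (inv_transpose g)) \<longleftrightarrow> (\<lambda>i. - \<mu> i) \<in> wts"
proof -
  have "(\<forall>t\<in>diag_torus. \<rho> (inv_transpose t) v = smul (tchar \<mu> t) v) \<longleftrightarrow>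
      (\<forall>t\<in>diag_torus. \<rho> t v = smul (tchar (\<lambda>i. - \<mu> i) t) v)" for v
    by (metis inv_transpose_torus(1) inv_transpose_involution diag_torus_SL tchar_inv_transpose)
  then show ?thesis
    by (simp add: wts_def wspace_def split_rep.wts_def[OF split_rep_contra] split_rep.wspace_def[OF split_rep_contra])
qed

end

lemma (in irreducible_split_rep) irreducible_split_rep_contra:
  "irreducible_split_rep smul (\<lambda>g. \<rho> (inv_transpose g))"
proof (intro irreducible_split_rep.intro split_rep_contra irreducible_split_rep_axioms.intro nonzero)
  fix W assume W: "subspace W" "\<And>g w. g \<in> SL \<Longrightarrow> w \<in> W \<Longrightarrow> \<rho> (inv_transpose g) w \<in> W"
  show "W = {0} \<or> W = UNIV"
    by (rule irreducible[OF W(1)]) (metis W(2) inv_transpose_SL inv_transpose_involution)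
qed

lemma (in irreducible_SL_rep) irreducible_split_rep: "irreducible_split_rep smul \<rho>"
  by (intro irreducible_split_rep.intro split_rep irreducible_split_rep_axioms.intro nonzero irreducible)

section \<open>Recognising the standard representation by its weights\<close>

context irreducible_split_rep
begin

lemma wts_nonempty: "\<exists>\<mu>. \<mu> \<in> wts"
proof (rule ccontr)
  assume "\<not> ?thesis"
  then have "(\<Union>\<mu>. wspace \<mu>) \<subseteq> {0}" by (auto simp: wts_def)
  then have "span (\<Union>\<mu>. wspace \<mu>) \<subseteq> span {0}" by (rule span_mono)
  with nonzero span_wspaces show False by auto
qed

lemma is_standard_of_unit_weights:
  assumes N: "3 \<le> CARD('n)" and unit: "\<And>\<mu>. \<mu> \<in> wts \<Longrightarrow> \<exists>i c. \<mu> = (\<lambda>l. ind {i} l + c)"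
  shows "is_standard smul \<rho>"
proof -
  obtain \<mu> where mu: "\<mu> \<in> wts" using wts_nonempty by blast
  then obtain a c where "\<mu> = (\<lambda>l. ind {a} l + c)" using unit by blast
  with mu have a: "ind {a} \<in> wts" using wts_add_const by metis
  have \<omega>: "(\<lambda>l. if l = a then int 1 else 0) = ind {a}" by (auto simp: ind_def)
  have "is_sym_power 1 smul \<rho>"
  proof (rule is_sym_power_of_top_weight[where a = a], unfold \<omega>)
    fix i j m assume ij: "i \<noteq> a" "j \<noteq> i" "0 < (m::nat)"
    show "shift_root (ind {a}) j i (int m) \<notin> wts"
    proof
      assume "shift_root (ind {a}) j i (int m) \<in> wts"
      then obtain l c where l: "shift_root (ind {a}) j i (int m) = (\<lambda>k. ind {l} k + c)" using unit by blast
      \<comment> \<open>Shifting along a root keeps the coordinate sum 1, so the constant c is 0;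
        but then the entry at i would be - m < 0 on one side and nonnegative on the other.\<close>
      have "(\<Sum>k\<in>UNIV. shift_root (ind {a}) j i (int m) k) = (\<Sum>k\<in>UNIV. ind {l} k + c)" unfolding l ..
      then have "c = 0" using ij by (simp add: sum_shift_root sum.distrib ind_def sum_of_bool_eq)
      with fun_cong[OF l, of i] ij show False
        by (auto simp: shift_root_def ind_def of_bool_def split: if_splits)
    qed
  qed (use N a in auto)
  then show ?thesis by (rule is_standard_of_sym_power_1)
qed

end

section \<open>Degeneracy\<close>

lemma power_matrix_polys: "p \<in> matrix_polys \<Longrightarrow> (\<lambda>A. p A ^ k) \<in> matrix_polys"
  by (induction k) (auto intro: matrix_polys.intros)

lemma prod_matrix_polys:
  "(\<And>i. i \<in> I \<Longrightarrow> p i \<in> matrix_polys) \<Longrightarrow> (\<lambda>A. \<Prod>i\<in>I. p i A) \<in> matrix_polys"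
  by (induction I rule: infinite_finite_induct) (auto intro: matrix_polys.intros)

text \<open>Same character on the torus, but \<open>undefined\<close> instead of 0 outside, as
  membership in \<open>characters\<close> requires.\<close>

definition tcharacter :: "('n \<Rightarrow> int) \<Rightarrow> complex ^ 'n ^ 'n \<Rightarrow> complex" where
  "tcharacter \<mu> = restrict (tchar \<mu>) diag_torus"

lemma tcharacter_in_characters: "tcharacter \<mu> \<in> characters diag_torus" for \<mu> :: "'n::finite \<Rightarrow> int"
proof -
  \<comment> \<open>A constant large enough to make all exponents nonnegative; since the diagonal
    entries multiply to 1, adding it leaves the character unchanged and exhibits it as a
    polynomial.\<close>
  define c where "c = (\<Sum>i\<in>UNIV. \<bar>\<mu> i\<bar>)"
  have c: "0 \<le> \<mu> i + c" for i
    using member_le_sum[of i UNIV "\<lambda>i. \<bar>\<mu> i\<bar>"] by (simp add: c_def)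
  define p where "p A = (\<Prod>i\<in>UNIV. A $ i $ i ^ nat (\<mu> i + c))" for A :: "complex ^ 'n ^ 'n"
  have "p \<in> matrix_polys"
    unfolding p_def by (intro prod_matrix_polys power_matrix_polys matrix_polys.entry)
  moreover have "tcharacter \<mu> A = p A" if "A \<in> diag_torus" for A
  proof -
    have "tchar \<mu> A = tchar (\<lambda>i. \<mu> i + c) A" by (simp add: tchar_add_const)
    also have "\<dots> = p A" using that c by (simp add: tchar_def p_def power_int_def)
    finally show ?thesis using that by (simp add: tcharacter_def)
  qed
  ultimately have "regular_on diag_torus (tcharacter \<mu>)" by (auto simp: regular_on_def)
  then show ?thesis
    by (simp add: characters_def tcharacter_def tchar_nonzero tchar_mult diag_torus_mult)
qed

lemma char_mult_tcharacter: "char_mult diag_torus (tcharacter \<mu>) (tcharacter \<nu>) = tcharacter (\<lambda>i. \<mu> i + \<nu> i)"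
  by (auto simp: char_mult_def tcharacter_def restrict_def fun_eq_iff tchar_add)

lemma tcharacter_add_const: "tcharacter (\<lambda>i. \<mu> i + c) = tcharacter \<mu>"
  by (simp add: tcharacter_def tchar_add_const)

interpretation rat_space: vector_space "rat_scale :: rat \<Rightarrow> ('a \<Rightarrow>\<^sub>0 rat) \<Rightarrow> 'a \<Rightarrow>\<^sub>0 rat"
  by (rule vector_space_rat_scale)

lemma rat_scale_single: "rat_scale q (Poly_Mapping.single a r) = Poly_Mapping.single a (q * r)"
  by (rule poly_mapping_eqI) (simp add: lookup_rat_scale lookup_single when_def)

lemma subspace_tensor_relations: "rat_space.subspace (tensor_relations T)"
  unfolding tensor_relations_def by (rule rat_space.subspace_span)

lemma relation_add:
  "Poly_Mapping.single (tcharacter (\<lambda>i. \<mu> i + \<nu> i)) q - Poly_Mapping.single (tcharacter \<mu>) q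
     - Poly_Mapping.single (tcharacter \<nu>) q \<in> tensor_relations diag_torus"
proof -
  have "Poly_Mapping.single (tcharacter (\<lambda>i. \<mu> i + \<nu> i)) 1 - Poly_Mapping.single (tcharacter \<mu>) 1
     - Poly_Mapping.single (tcharacter \<nu>) 1 \<in> tensor_relations diag_torus"
    unfolding tensor_relations_def char_mult_tcharacter[symmetric]
    using tcharacter_in_characters by (intro rat_space.span_base) blast
  from rat_space.subspace_scale[OF subspace_tensor_relations this, of q]
  show ?thesis by (simp add: rat_space.scale_right_diff_distrib rat_scale_single)
qed

text \<open>At \<mu> = \<nu> = 0, \<open>relation_add\<close> leaves exactly the negative of this
  element.\<close>

lemma relation_zero: "Poly_Mapping.single (tcharacter (\<lambda>_. 0)) q \<in> tensor_relations diag_torus"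
  using relation_add[of "\<lambda>_. 0" "\<lambda>_. 0" q] rat_space.subspace_neg[OF subspace_tensor_relations] by force

lemma relation_const: "Poly_Mapping.single (tcharacter (\<lambda>_::'n::finite. c)) q \<in> tensor_relations diag_torus"
  using relation_zero[of q] tcharacter_add_const[of "\<lambda>_::'n. 0" c] by simp

lemma relation_mult:
  "Poly_Mapping.single (tcharacter (\<lambda>i. int k * \<mu> i)) q - Poly_Mapping.single (tcharacter \<mu>) (q * of_nat k)
    \<in> tensor_relations diag_torus"
proof (induction k)
  case 0
  then show ?case using relation_zero by simp
next
  case (Suc k)
  have "(\<lambda>i. int k * \<mu> i + \<mu> i) = (\<lambda>i. int (Suc k) * \<mu> i)" by (simp add: fun_eq_iff algebra_simps)
  with relation_add[of "\<lambda>i. int k * \<mu> i" \<mu> q]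
  have "Poly_Mapping.single (tcharacter (\<lambda>i. int (Suc k) * \<mu> i)) q
    - Poly_Mapping.single (tcharacter (\<lambda>i. int k * \<mu> i)) q
    - Poly_Mapping.single (tcharacter \<mu>) q \<in> tensor_relations diag_torus" by simp
  from rat_space.subspace_add[OF subspace_tensor_relations this Suc.IH]
  show ?case by (simp add: distrib_left single_add algebra_simps)
qed

lemma relation_sum:
  "finite S \<Longrightarrow> Poly_Mapping.single (tcharacter (\<lambda>i. \<Sum>s\<in>S. int (c s) * \<mu> s i)) q
    - (\<Sum>s\<in>S. Poly_Mapping.single (tcharacter (\<mu> s)) (q * of_nat (c s))) \<in> tensor_relations diag_torus"
proof (induction S rule: finite_induct)
  case empty
  then show ?case using relation_zero by simp
next
  case (insert s S)
  note R = rat_space.subspace_add[OF subspace_tensor_relations]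
  from R[OF R[OF relation_add[of "\<lambda>i. int (c s) * \<mu> s i" "\<lambda>i. \<Sum>s\<in>S. int (c s) * \<mu> s i" q]
        relation_mult[of "c s" "\<mu> s" q]] insert.IH] insert.hyps
  show ?case by (simp add: algebra_simps)
qed

definition degen_witness :: "(complex ^ 'n ^ 'n) set \<Rightarrow> (complex \<Rightarrow> 'v::ab_group_add \<Rightarrow> 'v) \<Rightarrow>
    (complex ^ 'n ^ 'n \<Rightarrow> 'v \<Rightarrow> 'v) \<Rightarrow> nat \<Rightarrow> bool" where
  "degen_witness T smul \<rho> m \<longleftrightarrow> (\<exists>\<xi> a. (\<forall>i\<in>{1..m+1}. \<xi> i \<in> weights T smul \<rho> \<and> a i \<ge> 0) \<and>
     (\<Sum>i=1..m+1. a i) = 1 \<and> (\<Sum>i=1..m+1. Poly_Mapping.single (\<xi> i) (a i)) \<in> tensor_relations T)"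

lemma degen_eq_Least: "degen T smul \<rho> = (LEAST m. degen_witness T smul \<rho> m)"
  unfolding degen_def degen_witness_def ..

lemma degen_le: "degen_witness T smul \<rho> m \<Longrightarrow> degen T smul \<rho> \<le> m"
  unfolding degen_eq_Least by (rule Least_le)

lemma degen_witness_degen: "degen_witness T smul \<rho> m \<Longrightarrow> degen_witness T smul \<rho> (degen T smul \<rho>)"
  unfolding degen_eq_Least by (rule LeastI)

lemma (in split_rep) tcharacter_weight: "\<mu> \<in> wts \<Longrightarrow> tcharacter \<mu> \<in> weights diag_torus smul \<rho>"
  by (auto simp: weights_def wts_def wspace_def tcharacter_in_characters) (auto simp: tcharacter_def)

lemma (in split_rep) rel_bound_degen_witness:
  assumes "rel_bound wts r"
  shows "degen_witness diag_torus smul \<rho> (r - 1)"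
proof -
  obtain \<mu> c k where *: "\<forall>s<r. \<mu> s \<in> wts" "\<exists>s<r. c s \<noteq> (0::nat)" "\<forall>i. (\<Sum>s<r. int (c s) * \<mu> s i) = k"
    using assms by (auto simp: rel_bound_def)
  \<comment> \<open>Some index below r exists, so r > 0 and the truncated subtraction is
    harmless.\<close>
  then have r: "(r - 1) + 1 = r" by auto
  define C where "C = (\<Sum>s<r. c s)"
  have C: "C \<noteq> 0" using *(2) by (auto simp: C_def)
  define \<xi> where "\<xi> i = tcharacter (\<mu> (i - 1))" for i
  define a where "a i = 1 / of_nat C * (of_nat (c (i - 1)) :: rat)" for i
  have "(\<Sum>i=1..(r-1)+1. a i) = 1"
  proof -
    have "(\<Sum>i=1..(r-1)+1. a i) = (\<Sum>s<r. 1 / of_nat C * of_nat (c s))"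
      unfolding r using sum.atLeast1_atMost_eq[of a r] by (simp add: a_def)
    also have "\<dots> = 1 / of_nat C * (of_nat C :: rat)" by (simp only: sum_distrib_left[symmetric] C_def of_nat_sum)
    finally show ?thesis using C by simp
  qed
  moreover have "(\<Sum>i=1..(r-1)+1. Poly_Mapping.single (\<xi> i) (a i)) \<in> tensor_relations diag_torus"
  proof -
    have "(\<Sum>i=1..(r-1)+1. Poly_Mapping.single (\<xi> i) (a i)) =
      (\<Sum>s<r. Poly_Mapping.single (tcharacter (\<mu> s)) (1 / of_nat C * of_nat (c s)))"
      using sum.atLeast1_atMost_eq[of "\<lambda>i. Poly_Mapping.single (\<xi> i) (a i)" r] unfolding r by (simp add: a_def \<xi>_def)
    also have "\<dots> = Poly_Mapping.single (tcharacter (\<lambda>_. k)) (1 / of_nat C) -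
       (Poly_Mapping.single (tcharacter (\<lambda>i. \<Sum>s<r. int (c s) * \<mu> s i)) (1 / of_nat C) -
        (\<Sum>s<r. Poly_Mapping.single (tcharacter (\<mu> s)) (1 / of_nat C * of_nat (c s))))"
      using *(3) by simp
    also have "\<dots> \<in> tensor_relations diag_torus"
      by (intro rat_space.subspace_diff[OF subspace_tensor_relations] relation_const relation_sum) simp
    finally show ?thesis .
  qed
  moreover have "\<xi> i \<in> weights diag_torus smul \<rho> \<and> a i \<ge> 0" if "i \<in> {1..(r-1)+1}" for i
    using that * r by (auto simp: \<xi>_def a_def intro!: tcharacter_weight)
  ultimately show ?thesis unfolding degen_witness_def by blast
qed

text \<open>Evaluation of characters at \<open>t\<close>, followed by \<open>ln |\<cdot>|\<close>, is a linear functional on \<open>X(T) \<otimes> \<rat>\<close>.\<close>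

definition log_eval :: "'g \<Rightarrow> (('g \<Rightarrow> complex) \<Rightarrow>\<^sub>0 rat) \<Rightarrow> real" where
  "log_eval t p = (\<Sum>\<xi>\<in>Poly_Mapping.keys p. of_rat (Poly_Mapping.lookup p \<xi>) * ln (cmod (\<xi> t)))"

lemma log_eval_add: "log_eval t (p + q) = log_eval t p + log_eval t q"
  unfolding log_eval_def
  by (rule setsum_keys_plus_distrib) (simp_all add: of_rat_add distrib_right)

lemma log_eval_single: "log_eval t (Poly_Mapping.single \<xi> q) = of_rat q * ln (cmod (\<xi> t))"
  by (cases "q = 0") (simp_all add: log_eval_def)

lemma log_eval_0: "log_eval t 0 = 0"
  by (simp add: log_eval_def)

lemma log_eval_scale: "log_eval t (rat_scale c p) = of_rat c * log_eval t p"
proof (cases "c = 0")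
  case True
  then have "rat_scale c p = 0" by (simp add: poly_mapping_eqI lookup_rat_scale)
  then show ?thesis using True by (simp add: log_eval_0)
next
  case False
  then have "Poly_Mapping.keys (rat_scale c p) = Poly_Mapping.keys p"
    by (auto simp: in_keys_iff lookup_rat_scale)
  then show ?thesis by (simp add: log_eval_def lookup_rat_scale of_rat_mult sum_distrib_left mult_ac)
qed

lemma log_eval_diff: "log_eval t (p - q) = log_eval t p - log_eval t q"
  using log_eval_add[of t "p - q" q] by simp

lemma log_eval_sum: "log_eval t (\<Sum>i\<in>I. f i) = (\<Sum>i\<in>I. log_eval t (f i))"
  by (induction I rule: infinite_finite_induct) (simp_all add: log_eval_0 log_eval_add)

lemma log_eval_relations:
  assumes "p \<in> tensor_relations T" "t \<in> T"
  shows "log_eval t p = 0"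
  using assms(1) unfolding tensor_relations_def
proof (induction rule: rat_space.span_induct_alt)
  case base then show ?case by (rule log_eval_0)
next
  case (step c x y)
  then obtain \<alpha> \<beta> where x: "x = Poly_Mapping.single (char_mult T \<alpha> \<beta>) 1 - Poly_Mapping.single \<alpha> 1
      - Poly_Mapping.single \<beta> 1" and c: "\<alpha> \<in> characters T" "\<beta> \<in> characters T" by auto
  have "\<alpha> t \<noteq> 0" "\<beta> t \<noteq> 0" using c assms(2) by (auto simp: characters_def)
  then have "log_eval t x = 0"
    using assms(2) by (simp add: x log_eval_diff log_eval_single char_mult_def norm_mult ln_mult)
  with step show ?case by (simp add: log_eval_add log_eval_scale)
qed

section \<open>Lower bounds and the degeneracy of the standard representation and its dual\<close>

lemma witness_log_eval:
  assumes "(\<Sum>i\<in>I. Poly_Mapping.single (\<xi> i) (a i)) \<in> tensor_relations T" "t \<in> T"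
  shows "(\<Sum>i\<in>I. of_rat (a i) * ln (cmod (\<xi> i t))) = 0"
  using log_eval_relations[OF assms] by (simp add: log_eval_sum log_eval_single)

text \<open>Let \<open>mass i\<close> be the total coefficient on the weight \<epsilon> e_i.
  Evaluation at \<open>coroot i j 2\<close> gives \<epsilon> ln 2 (mass i - mass j) = 0, so all
  masses agree; with fewer than \<open>CARD('n)\<close> weights one mass is 0, hence all are,
  although they sum to 1. The sign \<epsilon> covers the standard representation and its
  dual.\<close>

lemma degen_witness_unit_weights:
  fixes \<rho> :: "complex ^ 'n ^ 'n \<Rightarrow> 'v::ab_group_add \<Rightarrow> 'v" and \<epsilon> :: real
  assumes w: "degen_witness diag_torus smul \<rho> m" and \<epsilon>: "\<epsilon> \<noteq> 0"
    and unit: "\<And>\<xi>. \<xi> \<in> weights diag_torus smul \<rho> \<Longrightarrow>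
      \<exists>i. \<forall>t\<in>diag_torus. ln (cmod (\<xi> t)) = \<epsilon> * ln (cmod (t $ i $ i))"
  shows "CARD('n) \<le> m + 1"
proof (rule ccontr)
  assume less: "\<not> ?thesis"
  obtain \<xi> a where \<xi>: "\<forall>s\<in>{1..m+1}. \<xi> s \<in> weights diag_torus smul \<rho>" "(\<Sum>s=1..m+1. a s) = 1"
    "(\<Sum>s=1..m+1. Poly_Mapping.single (\<xi> s) (a s)) \<in> tensor_relations diag_torus"
    using w unfolding degen_witness_def by blast
  have "\<exists>c. \<forall>s\<in>{1..m+1}. \<forall>t\<in>diag_torus. ln (cmod (\<xi> s t)) = \<epsilon> * ln (cmod (t $ c s $ c s))"
    using \<xi>(1) unit by (intro bchoice ballI) blast
  then obtain c :: "nat \<Rightarrow> 'n" where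
    c: "\<forall>s\<in>{1..m+1}. \<forall>t\<in>diag_torus. ln (cmod (\<xi> s t)) = \<epsilon> * ln (cmod (t $ c s $ c s))" by blast
  define mass where "mass i = (\<Sum>s=1..m+1. if c s = i then real_of_rat (a s) else 0)" for i
  have eq: "mass i = mass j" for i j
  proof (cases "i = j")
    case False
    define t where "t = (coroot i j 2 :: complex ^ 'n ^ 'n)"
    have t: "t \<in> diag_torus" using False by (simp add: t_def coroot_torus)
    have "0 = (\<Sum>s=1..m+1. of_rat (a s) * ln (cmod (\<xi> s t)))"
      using witness_log_eval[OF \<xi>(3) t] by simp
    also have "\<dots> = (\<Sum>s=1..m+1. \<epsilon> * ln 2 * ((if c s = i then of_rat (a s) else 0) - (if c s = j then of_rat (a s) else 0)))"
      using c t False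
      by (intro sum.cong) (auto simp: t_def coroot_entry norm_inverse ln_inverse ln_div)
    also have "\<dots> = \<epsilon> * ln 2 * (mass i - mass j)"
      by (simp only: sum_distrib_left[symmetric] sum_subtractf mass_def)
    finally show ?thesis using \<epsilon> by simp
  qed simp
  have "card (c ` {1..m+1}) < CARD('n)" using card_image_le[of "{1..m+1}" c] less by simp
  then obtain i where i: "i \<notin> c ` {1..m+1}" by (metis UNIV_eq_I less_irrefl)
  then have "mass i = 0" unfolding mass_def by (intro sum.neutral) auto
  then have "(\<Sum>i\<in>UNIV. mass i) = 0" using eq[of _ i] by simp
  moreover have "(\<Sum>i\<in>UNIV. mass i) = of_rat (\<Sum>s=1..m+1. a s)"
    unfolding mass_def by (subst sum.swap) (simp add: of_rat_sum of_rat_add)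
  ultimately show False using \<xi>(2) by simp
qed

lemma standard_weights:
  fixes \<rho> :: "complex ^ 'n ^ 'n \<Rightarrow> 'v::ab_group_add \<Rightarrow> 'v"
  assumes std: "is_standard smul \<rho>" and vs: "vector_space smul"
  shows "v \<noteq> 0 \<Longrightarrow> (\<And>t. t \<in> diag_torus \<Longrightarrow> \<rho> t v = smul (\<xi> t) v) \<Longrightarrow> \<exists>i. \<forall>t\<in>diag_torus. \<xi> t = t $ i $ i"
    and "\<exists>v. v \<noteq> 0 \<and> (\<forall>t\<in>diag_torus. \<rho> t v = smul (t $ i $ i) v)"
proof -
  obtain \<phi> where \<phi>: "Vector_Spaces.linear smul (*s) \<phi>" "bij \<phi>" "\<forall>g\<in>SL. \<forall>v. \<phi> (\<rho> g v) = g *v \<phi> v"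
    using std by (auto simp: is_standard_def rep_iso_def)
  interpret \<phi>: Vector_Spaces.linear smul "(*s)" \<phi> by fact
  have t_mult: "(t *v x) $ i = t $ i $ i * x $ i" if "t \<in> diag_torus" for t :: "complex ^ 'n ^ 'n" and x i
  proof -
    have "(t *v x) $ i = (\<Sum>j\<in>UNIV. if j = i then t $ i $ i * x $ i else 0)"
      unfolding matrix_vector_mult_def vec_lambda_beta
      by (intro sum.cong) (use diag_torus_off_diag[OF that] in auto)
    then show ?thesis by simp
  qed
  show "\<exists>i. \<forall>t\<in>diag_torus. \<xi> t = t $ i $ i"
    if v: "v \<noteq> 0" "\<And>t. t \<in> diag_torus \<Longrightarrow> \<rho> t v = smul (\<xi> t) v"
  proof -
    have "\<phi> v \<noteq> 0" using v(1) \<phi>(2) \<phi>.zero by (metis bij_is_inj inj_eq)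
    then obtain i where i: "\<phi> v $ i \<noteq> 0" by (auto simp: vec_eq_iff)
    have "\<xi> t = t $ i $ i" if t: "t \<in> diag_torus" for t
    proof -
      have "t *v \<phi> v = \<xi> t *s \<phi> v"
        using \<phi>(3) diag_torus_SL[OF t] v(2)[OF t] \<phi>.scale by metis
      then have "(t *v \<phi> v) $ i = \<xi> t * \<phi> v $ i" by simp
      then show ?thesis using i by (simp add: t_mult[OF t])
    qed
    then show ?thesis by blast
  qed
  show "\<exists>v. v \<noteq> 0 \<and> (\<forall>t\<in>diag_torus. \<rho> t v = smul (t $ i $ i) v)"
  proof -
    obtain v where v: "\<phi> v = axis i 1" using \<phi>(2) by (metis bij_is_surj surjD)
    have "v \<noteq> 0" using v \<phi>.zero by (metis axis_eq_0_iff zero_neq_one)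
    moreover have "\<rho> t v = smul (t $ i $ i) v" if t: "t \<in> diag_torus" for t
    proof -
      have "t *v axis i 1 = t $ i $ i *s axis i 1"
        unfolding vec_eq_iff t_mult[OF t] by (simp add: axis_def)
      then have "\<phi> (\<rho> t v) = \<phi> (smul (t $ i $ i) v)"
        using \<phi>(3) diag_torus_SL[OF t] v by (simp add: \<phi>.scale)
      then show ?thesis using \<phi>(2) by (simp add: bij_is_inj inj_eq)
    qed
    ultimately show ?thesis by blast
  qed
qed

lemma (in split_rep) standard_rel_bound:
  assumes "is_standard smul \<rho>"
  shows "rel_bound wts CARD('n)"
proof (rule rel_bound_unit_vectors)
  fix l :: 'n
  from standard_weights(2)[OF assms vs, of l] show "ind {l} \<in> wts"
    by (auto simp: wts_def wspace_def tchar_ind)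
qed

lemma (in split_rep) degen_standard:
  assumes "is_standard smul \<rho>"
  shows "degen diag_torus smul \<rho> = CARD('n) - 1"
proof -
  note w = rel_bound_degen_witness[OF standard_rel_bound[OF assms]]
  have "CARD('n) \<le> degen diag_torus smul \<rho> + 1"
  proof (rule degen_witness_unit_weights[OF degen_witness_degen[OF w], of 1])
    fix \<xi> assume "\<xi> \<in> weights diag_torus smul \<rho>"
    then obtain v where "v \<noteq> 0" "\<forall>t\<in>diag_torus. \<rho> t v = smul (\<xi> t) v" by (auto simp: weights_def)
    with standard_weights(1)[OF assms vs, of v \<xi>]
    show "\<exists>i. \<forall>t\<in>diag_torus. ln (cmod (\<xi> t)) = 1 * ln (cmod (t $ i $ i))" by auto
  qed simp
  with degen_le[OF w] show ?thesis by simp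
qed

lemma (in split_rep) degen_contra_standard:
  assumes std: "is_standard smul (\<lambda>g. \<rho> (inv_transpose g))"
  shows "degen diag_torus smul \<rho> = CARD('n) - 1"
proof -
  have "rel_bound wts CARD('n)"
    using split_rep.standard_rel_bound[OF split_rep_contra std]
    by (rule rel_bound_uminus) (simp add: wts_contra)
  note w = rel_bound_degen_witness[OF this]
  have "CARD('n) \<le> degen diag_torus smul \<rho> + 1"
  proof (rule degen_witness_unit_weights[OF degen_witness_degen[OF w], of "- 1"])
    fix \<xi> assume "\<xi> \<in> weights diag_torus smul \<rho>"
    then obtain v where v: "v \<noteq> 0" "\<forall>t\<in>diag_torus. \<rho> t v = smul (\<xi> t) v" by (auto simp: weights_def)
    have "\<exists>i. \<forall>t\<in>diag_torus. \<xi> (inv_transpose t) = t $ i $ i"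
      by (rule standard_weights(1)[OF std vs v(1)]) (use v(2) inv_transpose_torus in auto)
    then obtain i where i: "\<forall>t\<in>diag_torus. \<xi> (inv_transpose t) = t $ i $ i" by blast
    have "\<xi> t = inverse (t $ i $ i)" if t: "t \<in> diag_torus" for t
      using i inv_transpose_torus[OF t] inv_transpose_involution[OF diag_torus_SL[OF t]] by metis
    then show "\<exists>i. \<forall>t\<in>diag_torus. ln (cmod (\<xi> t)) = - 1 * ln (cmod (t $ i $ i))"
      by (intro exI[of _ i]) (simp add: norm_inverse ln_inverse diag_torus_nonzero)
  qed simp
  with degen_le[OF w] show ?thesis by simp
qed

text \<open>Writing a functional as \<open>linear_form w\<close> turns precomposition with the
  inverse of g into the map sending w to \<open>inv_transpose g *v w\<close>.\<close>

lemma is_dual_standard_iff_contra: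
  fixes \<rho> :: "complex ^ 'n ^ 'n \<Rightarrow> 'v::ab_group_add \<Rightarrow> 'v"
  assumes "vector_space smul"
  shows "is_dual_standard smul \<rho> \<longleftrightarrow> is_standard smul (\<lambda>g. \<rho> (inv_transpose g))"
proof -
  define W where "W = {f :: complex ^ 'n \<Rightarrow> complex. Vector_Spaces.linear (*s) (*) f}"
  define ev where "ev f = (\<chi> i. f (axis i 1))" for f :: "complex ^ 'n \<Rightarrow> complex"
  have ev: "ev (linear_form v) = v" for v
    by (simp add: ev_def vec_eq_iff linear_form_def axis_def if_distrib[where f = "\<lambda>y. _ * y"] cong: if_cong)
  have lf_W: "linear_form v \<in> W" for v
    unfolding W_def Vector_Spaces.linear_iff using vec.vector_space_axioms vector_space_mult_complex
    by (simp add: linear_form_def distrib_left sum.distrib sum_distrib_left mult_ac)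
  have lf_ev: "linear_form (ev f) = f" if "f \<in> W" for f
  proof
    fix x
    interpret f: Vector_Spaces.linear "(*s)" "(*)" f using that by (simp add: W_def)
    have "f x = f (\<Sum>i\<in>UNIV. (x $ i) *s axis i 1)" by (simp add: basis_expansion)
    also have "\<dots> = linear_form (ev f) x"
      by (simp only: f.sum f.scale) (simp add: linear_form_def ev_def mult.commute)
    finally show "linear_form (ev f) x = f x" ..
  qed
  have lf_add: "linear_form (v + w) = linear_form v + linear_form w" for v w :: "complex ^ 'n"
    by (simp add: fun_eq_iff linear_form_add)
  have lf_scale: "linear_form (c *s v) = fun_scale c (linear_form v)" for c and v :: "complex ^ 'n"
    by (simp add: fun_eq_iff linear_form_scale fun_scale_def)
  have ev_add: "ev (f + g) = ev f + ev g" and ev_scale: "ev (fun_scale c f) = c *s ev f" for f g c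
    by (simp_all add: ev_def vec_eq_iff fun_scale_def)
  have inv_transpose_action: "linear_form (inv_transpose g *v w) x = linear_form w (matrix_inv g *v x)" for g w x
    using linear_form_mult_vec[of w "inv_transpose g" x] by (simp add: inv_transpose_def)
  show ?thesis
  proof
    assume "is_dual_standard smul \<rho>"
    then obtain \<phi> where \<phi>: "Vector_Spaces.linear smul fun_scale \<phi>" "bij_betw \<phi> UNIV W"
      "\<forall>g\<in>SL. \<forall>v. \<phi> (\<rho> g v) = (\<lambda>x. \<phi> v (matrix_inv g *v x))"
      unfolding is_dual_standard_def rep_iso_def W_def by blast
    have phiW: "\<phi> v \<in> W" for v using \<phi>(2) by (auto simp: bij_betw_def)
    have "Vector_Spaces.linear smul (*s) (ev \<circ> \<phi>)"
      using \<phi>(1) vec.vector_space_axioms by (simp add: Vector_Spaces.linear_iff ev_add ev_scale)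
    moreover have "bij_betw (ev \<circ> \<phi>) UNIV UNIV"
      by (rule bij_betw_trans[OF \<phi>(2)], rule bij_betw_byWitness[of _ linear_form]) (auto simp: ev lf_ev lf_W)
    moreover have "(ev \<circ> \<phi>) (\<rho> (inv_transpose g) v) = g *v (ev \<circ> \<phi>) v" if g: "g \<in> SL" for g v
    proof -
      have "\<phi> (\<rho> (inv_transpose g) v) = (\<lambda>x. linear_form (ev (\<phi> v)) (matrix_inv (inv_transpose g) *v x))"
        using \<phi>(3) inv_transpose_SL[OF g] lf_ev[OF phiW] by simp
      also have "\<dots> = linear_form (g *v ev (\<phi> v))"
        unfolding inv_transpose_action[symmetric] inv_transpose_involution[OF g] ..
      finally show ?thesis by (simp add: ev)
    qed
    ultimately show "is_standard smul (\<lambda>g. \<rho> (inv_transpose g))"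
      unfolding is_standard_def rep_iso_def by blast
  next
    assume "is_standard smul (\<lambda>g. \<rho> (inv_transpose g))"
    then obtain \<phi> where \<phi>: "Vector_Spaces.linear smul (*s) \<phi>" "bij_betw \<phi> UNIV UNIV"
      "\<forall>g\<in>SL. \<forall>v. \<phi> (\<rho> (inv_transpose g) v) = g *v \<phi> v"
      unfolding is_standard_def rep_iso_def by blast
    have "Vector_Spaces.linear smul fun_scale (linear_form \<circ> \<phi>)"
      using \<phi>(1) vector_space_fun_scale by (simp add: Vector_Spaces.linear_iff lf_add lf_scale)
    moreover have "bij_betw (linear_form \<circ> \<phi>) UNIV W"
      by (rule bij_betw_trans[OF \<phi>(2)], rule bij_betw_byWitness[of _ ev]) (auto simp: ev lf_ev lf_W)
    moreover have "(linear_form \<circ> \<phi>) (\<rho> g v) = (\<lambda>x. (linear_form \<circ> \<phi>) v (matrix_inv g *v x))" if g: "g \<in> SL" for g v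
    proof -
      have "\<phi> (\<rho> g v) = inv_transpose g *v \<phi> v" using \<phi>(3) inv_transpose_SL[OF g] inv_transpose_involution[OF g] by metis
      then show ?thesis by (simp add: inv_transpose_action fun_eq_iff)
    qed
    ultimately show "is_dual_standard smul \<rho>"
      unfolding is_dual_standard_def rep_iso_def W_def by blast
  qed
qed

section \<open>Symmetric powers for SL(2)\<close>

lemma two_element_UNIV:
  assumes "CARD('n::finite) = 2"
  obtains a b :: "'n::finite" where "a \<noteq> b" "UNIV = {a, b}"
  using assms by (metis card_2_iff)

lemma sym_power_restrict_line:
  fixes f :: "complex ^ 'n \<Rightarrow> complex"
  assumes f: "f \<in> sym_power k" and ab: "a \<noteq> b" "UNIV = {a, b :: 'n}"
  shows "\<exists>c. \<forall>\<xi>. f \<xi> = (\<Sum>j\<le>k. c j * (\<xi> $ a) ^ j * (\<xi> $ b) ^ (k - j))"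
proof -
  have "f \<in> fun_space.span (range (\<lambda>m \<xi>. linear_form m \<xi> ^ k))"
    using f sym_power_subset_span_powers by blast
  then show ?thesis
  proof (induction rule: fun_space.span_induct_alt)
    case base
    show ?case by (rule exI[of _ "\<lambda>_. 0"]) simp
  next
    case (step d x y)
    then obtain m c where m: "x = (\<lambda>\<xi>. linear_form m \<xi> ^ k)"
      and c: "\<forall>\<xi>. y \<xi> = (\<Sum>j\<le>k. c j * (\<xi> $ a) ^ j * (\<xi> $ b) ^ (k - j))" by blast
    have "linear_form m \<xi> = m $ a * \<xi> $ a + m $ b * \<xi> $ b" for \<xi>
      unfolding linear_form_def ab(2) using ab(1) by simp
    then have "x \<xi> = (\<Sum>j\<le>k. (of_nat (k choose j) * (m $ a) ^ j * (m $ b) ^ (k - j)) * (\<xi> $ a) ^ j * (\<xi> $ b) ^ (k - j))" for \<xi>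
      by (simp add: m binomial_ring power_mult_distrib mult_ac)
    then have "(fun_scale d x + y) \<xi> =
        (\<Sum>j\<le>k. (d * (of_nat (k choose j) * (m $ a) ^ j * (m $ b) ^ (k - j)) + c j) * (\<xi> $ a) ^ j * (\<xi> $ b) ^ (k - j))" for \<xi>
      using c by (simp add: fun_scale_def sum_distrib_left) (simp add: sum.distrib[symmetric] algebra_simps)
    then show ?case
      by (intro exI[of _ "\<lambda>j. d * (of_nat (k choose j) * (m $ a) ^ j * (m $ b) ^ (k - j)) + c j"] allI)
  qed
qed

text \<open>The matrix diag(2, 1/2) multiplies the monomial with exponents j and k - j by 2^(2j -
  k), which has modulus 1 only if k = 2j. The assumption on z concerns the modulus because
  \<open>log_eval\<close> sees nothing else.\<close>

lemma sym_power_no_zero_weight: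
  fixes f :: "complex ^ 'n \<Rightarrow> complex"
  assumes f: "f \<in> sym_power k" and ab: "a \<noteq> b" "UNIV = {a, b :: 'n}" and k: "odd k"
    and eig: "sym_action (coroot a b 2) f = fun_scale z f" and z: "cmod z = 1"
  shows "f = 0"
proof -
  obtain c where c: "\<forall>\<xi>. f \<xi> = (\<Sum>j\<le>k. c j * (\<xi> $ a) ^ j * (\<xi> $ b) ^ (k - j))"
    using sym_power_restrict_line[OF f ab] by blast
  have "(\<Sum>j\<le>k. (c j * 2 ^ j * inverse 2 ^ (k - j)) * x ^ j) = (\<Sum>j\<le>k. (z * c j) * x ^ j)" for x
  proof -
    \<comment> \<open>Dehomogenising turns the eigenvector equation for binary forms into an
      identity of polynomials in x.\<close>
    define \<xi> :: "complex ^ 'n" where "\<xi> = (\<chi> i. if i = a then x else 1)"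
    have 1: "\<xi> $ a = x" "\<xi> $ b = 1" using ab by (auto simp: \<xi>_def)
    have "transpose (coroot a b 2) = (coroot a b 2 :: complex ^ 'n ^ 'n)"
      by (auto simp: transpose_def coroot_def diag_mat_def vec_eq_iff)
    then have "(transpose (coroot a b 2) *v \<xi>) $ a = 2 * x" "(transpose (coroot a b 2) *v \<xi>) $ b = inverse 2"
      unfolding matrix_vector_mult_def vec_lambda_beta ab(2) using ab(1) 1
      by (simp_all add: coroot_def diag_mat_entry)
    then have "sym_action (coroot a b 2) f \<xi> = (\<Sum>j\<le>k. c j * (2 * x) ^ j * inverse 2 ^ (k - j))"
      by (simp only: sym_action_def c[rule_format])
    moreover have "fun_scale z f \<xi> = z * (\<Sum>j\<le>k. c j * x ^ j)" by (simp add: fun_scale_def c[rule_format] 1)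
    ultimately show ?thesis using eig by (simp add: power_mult_distrib sum_distrib_left mult_ac)
  qed
  then have *: "\<forall>j\<le>k. c j * 2 ^ j * inverse 2 ^ (k - j) = z * c j"
    using polyfun_eq_coeffs[of "\<lambda>j. c j * 2 ^ j * inverse 2 ^ (k - j)" k "\<lambda>j. z * c j"] by simp
  have "c j = 0" if j: "j \<le> k" for j
  proof (rule ccontr)
    assume "c j \<noteq> 0"
    moreover have "(2 ^ j * inverse 2 ^ (k - j)) * c j = z * c j" using *[rule_format, OF j] by (simp add: mult_ac)
    ultimately have "2 ^ j * inverse 2 ^ (k - j) = z" by simp
    with z have "cmod (2 ^ j * inverse 2 ^ (k - j)) = 1" by simp
    then have "(2 :: real) ^ j * inverse 2 ^ (k - j) = 1"
      by (simp only: norm_mult norm_power norm_inverse norm_numeral)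
    then have "(2 :: real) ^ j = 2 ^ (k - j)" by (simp add: power_inverse field_simps)
    then have "j = k - j" by (subst (asm) power_inject_exp) auto
    with j have "k = 2 * j" by simp
    with k show False by simp
  qed
  with c show ?thesis by (simp add: fun_eq_iff)
qed

text \<open>Degeneracy 0 means one weight with coefficient 1, so its value at diag(2, 1/2) has
  logarithmic modulus 0. The witness m guarantees that the least value is attained.\<close>

lemma (in split_rep) degen_odd_sym_power:
  assumes sym: "is_sym_power k smul \<rho>" and k: "odd k" and N: "CARD('n) = 2" and nz: "\<exists>v::'v. v \<noteq> 0"
    and w: "degen_witness diag_torus smul \<rho> m"
  shows "degen diag_torus smul \<rho> \<noteq> 0"
proof
  assume 0: "degen diag_torus smul \<rho> = 0"
  obtain a b :: 'n where ab: "a \<noteq> b" "UNIV = {a, b}" using two_element_UNIV[OF N] by blast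
  define t :: "complex ^ 'n ^ 'n" where "t = coroot a b 2"
  have t: "t \<in> diag_torus" using ab(1) by (simp add: t_def coroot_torus)
  obtain \<xi> and q :: "nat \<Rightarrow> rat" where \<xi>: "\<forall>i\<in>{1..0+1}. \<xi> i \<in> weights diag_torus smul \<rho> \<and> q i \<ge> 0"
    "(\<Sum>i=1..0+1. q i) = (1::rat)" "(\<Sum>i=1..0+1. Poly_Mapping.single (\<xi> i) (q i)) \<in> tensor_relations diag_torus"
    using degen_witness_degen[OF w] unfolding 0 degen_witness_def by (elim exE conjE)
  have "ln (cmod (\<xi> 1 t)) = 0" using witness_log_eval[OF \<xi>(3) t] \<xi>(2) by simp
  moreover have \<xi>1: "\<xi> 1 \<in> weights diag_torus smul \<rho>" using \<xi>(1) by simp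
  then have "\<xi> 1 t \<noteq> 0" using t by (auto simp: weights_def characters_def)
  ultimately have z: "cmod (\<xi> 1 t) = 1" by simp
  obtain v where v: "v \<noteq> 0" "\<rho> t v = smul (\<xi> 1 t) v" using \<xi>1 t by (auto simp: weights_def)
  obtain \<phi> where \<phi>: "Vector_Spaces.linear smul fun_scale \<phi>" "bij_betw \<phi> UNIV (sym_power k)"
    "\<forall>g\<in>SL. \<forall>v. \<phi> (\<rho> g v) = sym_action g (\<phi> v)"
    using sym unfolding is_sym_power_def rep_iso_def by blast
  interpret \<phi>: Vector_Spaces.linear smul fun_scale \<phi> by fact
  have "sym_action t (\<phi> v) = fun_scale (\<xi> 1 t) (\<phi> v)"
    using \<phi>(3) diag_torus_SL[OF t] v(2) \<phi>.scale by metis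
  moreover have "\<phi> v \<in> sym_power k" using \<phi>(2) by (auto simp: bij_betw_def)
  ultimately have "\<phi> v = 0" using sym_power_no_zero_weight[OF _ ab k _ z] by (simp add: t_def)
  then have "\<phi> v = \<phi> 0" by (simp add: \<phi>.zero)
  moreover have "inj \<phi>" using \<phi>(2) by (simp add: bij_betw_def)
  ultimately show False using v(1) by (simp only: inj_eq)
qed

section \<open>Classification of the exceptional representations\<close>

context irreducible_split_rep
begin

lemma is_odd_sym_power:
  assumes N: "CARD('n) = 2" and zero: "ind {} \<notin> wts"
  shows "\<exists>l. is_sym_power (2 * l + 1) smul \<rho>"
proof -
  define D where "D = {\<mu> i - \<mu> j | \<mu> i j. \<mu> \<in> wts}"
  obtain C where C: "\<forall>\<mu>\<in>wts. \<forall>i j. \<mu> i - \<mu> j \<le> C" using wts_bounded by blast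
  obtain \<mu>0 where mu0: "\<mu>0 \<in> wts" using wts_nonempty by blast
  have "0 \<in> D" unfolding D_def using mu0 by force
  \<comment> \<open>The largest coordinate difference of any weight. Every difference is at most C
    and 0 is one of them, so intersecting with {0..C} makes the set finite and keeps its
    maximum.\<close>
  define d where "d = Max (D \<inter> {0..C})"
  have fin: "finite (D \<inter> {0..C})" by simp
  have "0 \<le> C" using bspec[OF C mu0] by (metis diff_self)
  then have "0 \<in> D \<inter> {0..C}" using \<open>0 \<in> D\<close> by simp
  then have "d \<in> D \<inter> {0..C}" unfolding d_def by (intro Max_in[OF fin]) auto
  then have "d \<in> D" "0 \<le> d" by auto
  then obtain \<mu> a b where mu: "\<mu> \<in> wts" "\<mu> a - \<mu> b = d" by (auto simp: D_def)
  have max: "\<nu> i - \<nu> j \<le> d" if "\<nu> \<in> wts" for \<nu> i j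
  proof (cases "0 \<le> \<nu> i - \<nu> j")
    case True
    then show ?thesis unfolding d_def using that C fin by (intro Max_ge) (auto simp: D_def)
  next
    case False
    then show ?thesis using \<open>0 \<le> d\<close> by simp
  qed
  have "d \<noteq> 0"
  proof
    assume "d = 0"
    then have "\<mu> i = \<mu> a" for i using max[OF mu(1), of i a] max[OF mu(1), of a i] by simp
    then have "\<mu> = (\<lambda>i. ind {} i + \<mu> a)" by (auto simp: ind_def)
    with mu(1) zero wts_add_const show False by metis
  qed
  with mu \<open>0 \<le> d\<close> have ab: "a \<noteq> b" by auto
  have U: "UNIV = {a, b}"
    using N ab by (metis card_2_iff card_subset_eq finite subset_UNIV)
  define k where "k = nat d"
  have k: "int k = d" "1 \<le> k" using \<open>0 \<le> d\<close> \<open>d \<noteq> 0\<close> by (auto simp: k_def)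
  define \<omega> where "\<omega> l = (if l = a then int k else 0)" for l
  have "\<mu> = (\<lambda>i. \<omega> i + \<mu> b)"
  proof
    fix i show "\<mu> i = \<omega> i + \<mu> b" using U k mu(2) ab by (cases "i = a") (auto simp: \<omega>_def)
  qed
  with mu(1) wts_add_const have \<omega>: "\<omega> \<in> wts" by metis
  have \<omega>_eq: "(\<lambda>l. if l = a then int k else 0) = \<omega>" by (simp add: \<omega>_def fun_eq_iff)
  have "is_sym_power k smul \<rho>"
  proof (rule is_sym_power_of_top_weight[where a = a], unfold \<omega>_eq)
    show "\<omega> \<in> wts" by (rule \<omega>)
    fix i j m assume ij: "i \<noteq> a" "j \<noteq> i" "0 < (m::nat)"
    then have "i = b" "j = a" using U by auto
    then show "shift_root \<omega> j i (int m) \<notin> wts"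
      using max[of "shift_root \<omega> a b (int m)" a b] ij(3) ab k by (auto simp: shift_root_def \<omega>_def)
  qed (use N k in auto)
  \<comment> \<open>Balancing \<omega> ends at an indicator e_I with |I| < 2; weight 0 is excluded,
    so |I| = 1, and the congruence on coordinate sums makes k odd.\<close>
  moreover have "odd k"
  proof -
    obtain I q where I: "ind I \<in> wts" "I \<noteq> UNIV" "(\<Sum>l\<in>UNIV. \<omega> l) = int (card I) + int CARD('n) * q"
      using wts_reduction[OF \<omega>] by blast
    have "card I < CARD('n)" using I(2) by (intro psubset_card_mono) auto
    moreover have "card I \<noteq> 0" using I(1) zero by auto
    ultimately have "card I = 1" using N by linarith
    then have "int k = 1 + 2 * q" using I(3) N by (simp add: \<omega>_def)
    then show ?thesis by presburger
  qed
  ultimately show ?thesis by (auto elim!: oddE)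
qed

text \<open>A relation among r weights bounds the degeneracy by r - 1, and
  \<open>CARD('n) - 2\<close> is n - 1. Negation of weights preserves relations, so the assumption
  for contradiction excludes short ones for V and its twist at once.\<close>

lemma rel_bound_or_special:
  assumes N: "3 \<le> CARD('n)"
  shows "(\<exists>r. r - 1 \<le> CARD('n) - 2 \<and> rel_bound wts r) \<or> is_standard smul \<rho> \<or>
    is_standard smul (\<lambda>g. \<rho> (inv_transpose g))"
proof (rule ccontr)
  assume not: "\<not> ?thesis"
  define N where "N = CARD('n)"
  interpret contra: irreducible_split_rep smul "\<lambda>g. \<rho> (inv_transpose g)"
    by (rule irreducible_split_rep_contra)
  have wts_uminus: "\<mu> \<in> contra.wts \<longleftrightarrow> (\<lambda>i. - \<mu> i) \<in> wts" for \<mu> by (rule wts_contra)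
  have no: "\<not> rel_bound wts r" if "r - 1 \<le> N - 2" for r using not that by (auto simp: N_def)
  have no': "\<not> rel_bound contra.wts r" if "r - 1 \<le> N - 2" for r
    using no[OF that] rel_bound_uminus[of contra.wts r wts] by (auto simp: wts_uminus)
  have noN: "\<not> rel_bound wts (N - 1)" by (rule no) linarith
  have noN': "\<not> rel_bound contra.wts (N - 1)" by (rule no') linarith
  have ind_contra: "ind J \<in> contra.wts \<longleftrightarrow> ind (- J) \<in> wts" for J
  proof -
    have "(\<lambda>i. - ind J i + 1) = ind (- J)" by (auto simp: ind_def)
    then show ?thesis unfolding wts_uminus using wts_add_const[of "\<lambda>i. - ind J i" 1] by simp
  qed
  have cards: "card I = 1 \<or> card I = N - 1" if I: "ind I \<in> wts" "I \<noteq> UNIV" for I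
  proof (rule ccontr)
    assume c: "\<not> ?thesis"
    have less: "card I < N" unfolding N_def using I(2) by (intro psubset_card_mono) auto
    have "card I \<noteq> 0" using no[of 1] rel_bound_zero I(1) by auto
    with c less have c2: "2 \<le> card I" "card I \<le> N - 2" by linarith+
    show False
    proof (cases "2 * card I \<le> N")
      case True
      then show False using rel_bound_middle[OF I(1) c2(1)] noN by (simp add: N_def)
    next
      case False
      have "card (- I) = N - card I" by (simp add: Compl_eq_Diff_UNIV card_Diff_subset N_def)
      moreover have "ind (- I) \<in> contra.wts" using I(1) by (simp add: ind_contra)
      moreover have "2 \<le> N - card I" "2 * (N - card I) \<le> N" using False c2 less by linarith+
      ultimately show False
        using contra.rel_bound_middle[of "- I"] noN' by (simp add: N_def)
    qed
  qed
  \<comment> \<open>Complementary indicators sum to (1, ..., 1), so two weights suffice; this is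
    short enough because n \<ge> 2.\<close>
  have opp: False if "ind I \<in> wts" "card I = 1" "ind J \<in> wts" "card J = N - 1" for I J
    using rel_bound_opposite[OF that(1,3)] no[of 2] that N by (simp add: N_def)
  obtain \<mu> where mu: "\<mu> \<in> wts" using wts_nonempty by blast
  then obtain I where I: "ind I \<in> wts" "I \<noteq> UNIV" using wts_reduction by blast
  show False
  proof (cases "card I = 1")
    case True
    have "card J = 1" if "ind J \<in> wts" "J \<noteq> UNIV" for J
      using cards[OF that] opp[OF I(1) True that(1)] by blast
    then have "is_standard smul \<rho>"
      using unit_class_dichotomy[OF N] noN by (intro is_standard_of_unit_weights N) (auto simp: N_def)
    with not show False by simp
  next
    case False
    with cards[OF I] have cI: "card I = N - 1" by simp
    have "card J = 1" if J: "ind J \<in> contra.wts" "J \<noteq> UNIV" for J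
    proof -
      have w: "ind (- J) \<in> wts" using J by (simp add: ind_contra)
      have J0: "- J \<noteq> UNIV"
      proof
        assume "- J = UNIV"
        then have "J = {}" by auto
        with J(1) no'[of 1] contra.rel_bound_zero show False by simp
      qed
      have "card (- J) \<noteq> 1" using opp[OF w _ I(1) cI] by blast
      with cards[OF w J0] have "card (- J) = N - 1" by simp
      moreover have "card (- J) = N - card J" by (simp add: Compl_eq_Diff_UNIV card_Diff_subset N_def)
      moreover have "card J \<le> N" by (simp add: N_def card_mono)
      ultimately show ?thesis using N by (simp add: N_def)
    qed
    then have "is_standard smul (\<lambda>g. \<rho> (inv_transpose g))"
      using contra.unit_class_dichotomy[OF N] noN'
      by (intro contra.is_standard_of_unit_weights N) (auto simp: N_def)
    with not show False by simp
  qed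
qed

end

theorem lemma4p0p10:
  fixes n :: nat
    and smul :: "complex \<Rightarrow> 'v::ab_group_add \<Rightarrow> 'v"
    and \<rho> :: "complex ^ 'n ^ 'n \<Rightarrow> 'v \<Rightarrow> 'v"
  assumes "n \<ge> 1"
    and "CARD('n) = n + 1"
    and "irreducible_SL_rep smul \<rho>"
  shows "(if is_standard smul \<rho> \<or> is_dual_standard smul \<rho> \<or>
             (n = 1 \<and> (\<exists>l. is_sym_power (2 * l + 1) smul \<rho>))
          then degen diag_torus smul \<rho> = n
          else degen diag_torus smul \<rho> \<le> n - 1)"
proof -
  interpret irreducible_split_rep smul \<rho>
    by (rule irreducible_SL_rep.irreducible_split_rep[OF assms(3)])
  note dual = is_dual_standard_iff_contra[OF vs, of \<rho>]
  obtain \<mu> where mu: "\<mu> \<in> wts" using wts_nonempty by blast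
  consider "is_standard smul \<rho>" | "is_dual_standard smul \<rho>"
    | l where "n = 1" "is_sym_power (2 * l + 1) smul \<rho>"
    | "\<not> (is_standard smul \<rho> \<or> is_dual_standard smul \<rho> \<or> (n = 1 \<and> (\<exists>l. is_sym_power (2 * l + 1) smul \<rho>)))"
    by blast
  then show ?thesis
  proof cases
    case 1
    then show ?thesis using degen_standard assms(2) by simp
  next
    case 2
    then show ?thesis using degen_contra_standard assms(2) dual by simp
  next
    case (3 l)
    have N: "CARD('n) = 2" using assms(2) 3(1) by simp
    \<comment> \<open>Exchanging the two coordinates gives a witness with m = 1: it shows that the
      least value is attained and is at most 1.\<close>
    note w = rel_bound_degen_witness[OF rel_bound_swap[OF N mu]]
    have "degen diag_torus smul \<rho> \<noteq> 0"
      by (rule degen_odd_sym_power[OF 3(2) _ N nonzero w]) simp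
    with degen_le[OF w] have "degen diag_torus smul \<rho> = n" using 3(1) by simp
    with 3 show ?thesis by auto
  next
    case 4
    have "degen diag_torus smul \<rho> \<le> n - 1"
    proof (cases "n = 1")
      case True
      \<comment> \<open>If weight 0 were absent, V would be an odd symmetric power.\<close>
      then have "ind {} \<in> wts" using is_odd_sym_power 4 assms(2) by auto
      then show ?thesis using degen_le[OF rel_bound_degen_witness[OF rel_bound_zero]] by simp
    next
      case False
      then have "3 \<le> CARD('n)" using assms(1,2) by simp
      from rel_bound_or_special[OF this] 4 dual obtain r where r: "r - 1 \<le> CARD('n) - 2" "rel_bound wts r"
        by blast
      from degen_le[OF rel_bound_degen_witness[OF r(2)]] r(1) show ?thesis using assms(2) by simp
    qed
    then show ?thesis unfolding if_not_P[OF 4] .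
  qed
qed

end
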